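(* In the setting described in the context, let $\{(u_0^k,(u_i^k)_i,(z_i^k)_i,(s_j^k)_j)\}_{k\in\mathbb N}$ be a sequence generated by the relaxed scheme. Let $\tau_j>0$ ($j\in[m]$) be arbitrary, and set $\bar\tau_i=\sum_{j\in\mathcal J_{c,i}}\tau_j$ and $1/\bar\beta_i=\sum_{l\in\mathcal P_i}1/\beta_l$ for $i\in[n-1]$ (empty sums are $0$). Assume that for all $i\in[n-1]$ and $j\in[m]$: (a) $\theta_i,\zeta_j\in(0,2)$; (b) $M_i\succeq\alpha_iI$ with $\alpha_i>\frac1{2-\theta_i}\big(2\bar\tau_i+\frac1{2\bar\beta_i}\big)$; (c) $N_j\succeq\sigma_jI$ with $\sigma_j>\frac1{2-\zeta_j}\big(\frac{\|L_j\|^2}{2\tau_j}+\frac1{2\nu_j}\big)$. Then: (i) there exists $((z_i^\star)_i,(s_j^\star)_j)\in\mathrm{Fix}\,\mathcal T_{zs,\theta,\zeta}$ such that $(z_i^k,s_j^k)_{i,j}\rightharpoonup(z_i^\star,s_j^\star)_{i,j}$ weakly as $k\to\infty$; (ii) $J_{A_0}^{\sum_{c\in\mathrm{ch}(0)}M_c}\big(\sum_{c\in\mathrm{ch}(0)}M_cz_c^\star-\sum_{j\in\mathcal J_0}L_j^*s_j^\star+a\big)$ solves (P).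
   Context: Notation: $[r]=\{1,\dots,r\}$. For $M$ bounded, self-adjoint, uniformly positive definite and $A$ maximally monotone, $J_A^M:=J_{M^{-1}A}\circ M^{-1}=(M+A)^{-1}$. Problem data: $n\ge2$ and $m,p\ge0$ are integers; $\mathcal H,\mathcal K_1,\dots,\mathcal K_m$ are real Hilbert spaces; $A_i:\mathcal H\to2^{\mathcal H}$ ($i=0,\dots,n-1$) and $B_j:\mathcal K_j\to2^{\mathcal K_j}$ are maximally monotone; $D_j:\mathcal K_j\to2^{\mathcal K_j}$ is maximally monotone and $\nu_j$-strongly monotone, $\nu_j>0$ (so $D_j^{-1}$ is single-valued and $\nu_j$-cocoercive; if $D_j$ is the normal cone operator of $\{0\}$, then $D_j^{-1}=0$ and one puts $\nu_j=+\infty$, $1/\nu_j=0$); $C_l:\mathcal H\to\mathcal H$ ($l\in[p]$) is $\beta_l$-cocoercive, $\beta_l>0$; $L_j:\mathcal H\to\mathcal K_j$ is bounded linear; $a\in\mathcal H$, $b_j\in\mathcal K_j$. Problem (P): find $u\in\mathcal H$ with $a\in\sum_{i=0}^{n-1}A_iu+\sum_{j=1}^mL_j^*(B_j\square D_j)(L_ju-b_j)+\sum_{l=1}^pC_lu$, where $B\square D=(B^{-1}+D^{-1})^{-1}$. Standing assumption: (P) has at least one solution. Tree data: an arbitrary rooted tree with node set $\{0,\dots,n-1\}$ and root $0$; $\mathrm{pa}(i)$ is the parent of $i\in[n-1]$, $\mathrm{ch}(i)$ the set of children of $i$. $(\mathcal J_i)_{i=0}^{n-1}$ is a partition of $[m]$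 (empty cells allowed) with $\mathcal J_i=\varnothing$ for every leaf $i$. $(\mathcal P_i)_{i=0}^{n-1}$ is a partition of $[p]$ (empty cells allowed) with $\mathcal P_0=\varnothing$. For each non-leaf node $r$, $(\mathcal J_{c,i})_{i\in\mathrm{ch}(r)}$ is a partition (empty cells allowed) of $\mathcal J_r$. Metrics: $M_i$ on $\mathcal H$ ($i\in[n-1]$) and $N_j$ on $\mathcal K_j$ ($j\in[m]$) are linear, bounded, self-adjoint, uniformly positive definite. Prediction map $\mathcal T_{zs}$: given $(z,s)=((z_i)_{i\in[n-1]},(s_j)_{j\in[m]})$, compute from root to leaves (root) $0\in A_0u_0+\sum_{c\in\mathrm{ch}(0)}M_c(u_0-z_c)+\sum_{j\in\mathcal J_0}L_j^*s_j-a$; (duals, for each node $i$ and $j\in\mathcal J_i$) $0\in B_j^{-1}\tilde s_j+N_j(\tilde s_j-s_j)+D_j^{-1}s_j-L_ju_i+b_j$; (nodes $i\in[n-1]$) $0\in A_iu_i+M_i(u_i+z_i-2u_{\mathrm{pa}(i)})+\sum_{c\in\mathrm{ch}(i)}M_c(u_i-z_c)+\sum_{l\in\mathcal P_i}C_lu_{\mathrm{pa}(i)}+\sum_{j\in\mathcal J_i}L_j^*s_j+\sum_{j\in\mathcal J_{c,i}}L_j^*(\tilde s_j-s_j)$; $\tilde z_i=z_i+u_i-u_{\mathrm{pa}(i)}$; $\mathcal T_{zs}(z,s)=(\tilde z,\tilde s)$. Relaxed scheme: $\mathcal T_{zs,\theta,\zeta}(z,s)=(z^+,s^+)$ with $z_i^+=z_i+\theta_i(\tilde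 z_i-z_i)$, $s_j^+=s_j+\zeta_j(\tilde s_j-s_j)$. The sequence is generated from arbitrary $(z^0,s^0)$ by $(z^{k+1},s^{k+1})=\mathcal T_{zs,\theta,\zeta}(z^k,s^k)$, with $u_0^{k+1},u_i^{k+1}$ the intermediate $u$'s computed from $(z^k,s^k)$. *)

theory Defs
  imports
    "HOL-Analysis.Analysis"
    "HOL-Library.Set_Algebras"
    "HOL-Library.FuncSet"
    "HOL-Library.Extended_Real"
begin

text \<open>
  A set-valued operator is a function \<open>A :: 'a \<Rightarrow> 'a set\<close>.  The spaces
  \<open>\<K>\<^sub>1, \<dots>, \<K>\<^sub>m\<close> may differ from each other, so each of them is a closed subspace of one
  ambient Hilbert space \<open>'k\<close> (for instance of their direct sum), and notions needed on
  \<open>\<K>\<^sub>j\<close> take a carrier \<open>S\<close>; on \<open>\<H>\<close> the carrier is \<open>UNIV\<close>.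

  Sums of sets are Minkowski sums; an empty sum of sets is \<open>{0}\<close>.
\<close>

section \<open>Operators on a Hilbert space\<close>

definition operator_on :: "'a set \<Rightarrow> ('a \<Rightarrow> 'a set) \<Rightarrow> bool" where
  "operator_on S A \<longleftrightarrow> (\<forall>x. A x \<subseteq> S) \<and> (\<forall>x. x \<notin> S \<longrightarrow> A x = {})"

definition monotone_operator :: "('a::real_inner \<Rightarrow> 'a set) \<Rightarrow> bool" where
  "monotone_operator A \<longleftrightarrow> (\<forall>x y. \<forall>v\<in>A x. \<forall>w\<in>A y. 0 \<le> (x - y) \<bullet> (v - w))"

definition maximally_monotone_on :: "'a::real_inner set \<Rightarrow> ('a \<Rightarrow> 'a set) \<Rightarrow> bool" where
  "maximally_monotone_on S A \<longleftrightarrow>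
     operator_on S A \<and> monotone_operator A \<and>
     (\<forall>A'. operator_on S A' \<and> monotone_operator A' \<and> (\<forall>x. A x \<subseteq> A' x) \<longrightarrow> A' = A)"

definition strongly_monotone :: "real \<Rightarrow> ('a::real_inner \<Rightarrow> 'a set) \<Rightarrow> bool" where
  "strongly_monotone r A \<longleftrightarrow>
     (\<forall>x y. \<forall>v\<in>A x. \<forall>w\<in>A y. r * (norm (x - y))\<^sup>2 \<le> (x - y) \<bullet> (v - w))"

definition cocoercive :: "real \<Rightarrow> ('a::real_inner \<Rightarrow> 'a) \<Rightarrow> bool" where
  "cocoercive r C \<longleftrightarrow> (\<forall>x y. r * (norm (C x - C y))\<^sup>2 \<le> (x - y) \<bullet> (C x - C y))"

definition normal_cone_on :: "'a::real_inner set \<Rightarrow> 'a set \<Rightarrow> 'a \<Rightarrow> 'a set" where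
  "normal_cone_on S C x = (if x \<in> C then {v \<in> S. \<forall>y\<in>C. v \<bullet> (y - x) \<le> 0} else {})"

definition inverse_operator :: "('a \<Rightarrow> 'b set) \<Rightarrow> 'b \<Rightarrow> 'a set" where
  "inverse_operator A y = {x. y \<in> A x}"

definition parallel_sum :: "('a::real_inner \<Rightarrow> 'a set) \<Rightarrow> ('a \<Rightarrow> 'a set) \<Rightarrow> 'a \<Rightarrow> 'a set" where
  "parallel_sum B D =
     inverse_operator (\<lambda>v. inverse_operator B v + inverse_operator D v)"

definition bounded_below_on :: "'a::real_inner set \<Rightarrow> ('a \<Rightarrow> 'a) \<Rightarrow> real \<Rightarrow> bool" where
  \<comment> \<open>\<open>M \<succeq> r I\<close> on \<open>S\<close>\<close>
  "bounded_below_on S M r \<longleftrightarrow> (\<forall>x\<in>S. r * (norm x)\<^sup>2 \<le> M x \<bullet> x)"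

definition metric_on :: "'a::real_inner set \<Rightarrow> ('a \<Rightarrow> 'a) \<Rightarrow> bool" where
  \<comment> \<open>linear, bounded, self-adjoint and uniformly positive definite on the subspace \<open>S\<close>\<close>
  "metric_on S M \<longleftrightarrow>
     M ` S \<subseteq> S \<and>
     (\<forall>x\<in>S. \<forall>y\<in>S. M (x + y) = M x + M y) \<and>
     (\<forall>c. \<forall>x\<in>S. M (c *\<^sub>R x) = c *\<^sub>R M x) \<and>
     (\<exists>B. \<forall>x\<in>S. norm (M x) \<le> B * norm x) \<and>
     (\<forall>x\<in>S. \<forall>y\<in>S. M x \<bullet> y = x \<bullet> M y) \<and>
     (\<exists>r>0. bounded_below_on S M r)"

definition warped_resolvent :: "('a::real_inner \<Rightarrow> 'a) \<Rightarrow> ('a \<Rightarrow> 'a set) \<Rightarrow> 'a \<Rightarrow> 'a" where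
  \<comment> \<open>\<open>(M + A)\<^sup>-\<^sup>1\<close>, which is single-valued for a metric \<open>M\<close> and maximally monotone \<open>A\<close>\<close>
  "warped_resolvent M A x = the_elem (inverse_operator (\<lambda>u. {M u} + A u) x)"


section \<open>The inclusion problem\<close>

record ('h, 'k) inclusion_problem =
  n_of :: nat
  m_of :: nat
  p_of :: nat
  Ksp  :: "nat \<Rightarrow> 'k set"
  opA  :: "nat \<Rightarrow> 'h \<Rightarrow> 'h set"
  opB  :: "nat \<Rightarrow> 'k \<Rightarrow> 'k set"
  opD  :: "nat \<Rightarrow> 'k \<Rightarrow> 'k set"
  opC  :: "nat \<Rightarrow> 'h \<Rightarrow> 'h"
  opL  :: "nat \<Rightarrow> 'h \<Rightarrow> 'k"
  vec_a :: 'h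
  vec_b :: "nat \<Rightarrow> 'k"
  nu   :: "nat \<Rightarrow> ereal"
  beta :: "nat \<Rightarrow> real"

definition problem_data ::
  "('h::{real_inner,complete_space}, 'k::{real_inner,complete_space}, 'more)
     inclusion_problem_scheme \<Rightarrow> bool" where
  "problem_data S \<longleftrightarrow>
     2 \<le> n_of S \<and>
     (\<forall>i<n_of S. maximally_monotone_on UNIV (opA S i)) \<and>
     (\<forall>j\<in>{1..m_of S}.
        subspace (Ksp S j) \<and> closed (Ksp S j) \<and>
        maximally_monotone_on (Ksp S j) (opB S j) \<and>
        maximally_monotone_on (Ksp S j) (opD S j) \<and>
        (if opD S j = normal_cone_on (Ksp S j) {0} then nu S j = \<infinity>
         else \<exists>r>0. nu S j = ereal r \<and> strongly_monotone r (opD S j)) \<and>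
        bounded_linear (opL S j) \<and> range (opL S j) \<subseteq> Ksp S j \<and>
        vec_b S j \<in> Ksp S j) \<and>
     (\<forall>l\<in>{1..p_of S}. 0 < beta S l \<and> cocoercive (beta S l) (opC S l))"

text \<open>
  \<open>nu S j = \<infinity>\<close> exactly when \<open>D\<^sub>j\<close> is the normal cone operator of \<open>{0}\<close>, i.e. \<open>D\<^sub>j\<^sup>-\<^sup>1 = 0\<close>; in
  \<^typ>\<open>ereal\<close> then \<open>1 / (2 * \<infinity>) = 0\<close>.

  For \<open>L\<^sub>j\<close> with range in \<open>\<K>\<^sub>j\<close>, the Hilbert adjoint \<open>\<K>\<^sub>j \<rightarrow> \<H>\<close> is the restriction to \<open>\<K>\<^sub>j\<close>
  of \<open>adjoint (opL S j)\<close>, and it is only applied to elements of \<open>\<K>\<^sub>j\<close> below.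
\<close>

definition solves_P ::
  "('h::{real_inner,complete_space}, 'k::{real_inner,complete_space}, 'more)
     inclusion_problem_scheme \<Rightarrow> 'h \<Rightarrow> bool" where
  "solves_P S u \<longleftrightarrow>
     vec_a S \<in>
       (\<Sum>i<n_of S. opA S i u) +
       (\<Sum>j\<in>{1..m_of S}. adjoint (opL S j) `
            parallel_sum (opB S j) (opD S j) (opL S j u - vec_b S j)) +
       {\<Sum>l\<in>{1..p_of S}. opC S l u}"


section \<open>Tree data and metrics\<close>

record ('h, 'k) tree_splitting = "('h, 'k) inclusion_problem" +
  parent :: "nat \<Rightarrow> nat"
  cellJ  :: "nat \<Rightarrow> nat set"
  cellP  :: "nat \<Rightarrow> nat set"
  cellJc :: "nat \<Rightarrow> nat set"
  metM   :: "nat \<Rightarrow> 'h \<Rightarrow> 'h"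
  metN   :: "nat \<Rightarrow> 'k \<Rightarrow> 'k"

definition rooted_tree :: "nat \<Rightarrow> (nat \<Rightarrow> nat) \<Rightarrow> bool" where
  \<comment> \<open>\<open>pa\<close> is the parent map of a tree on \<open>{0..<n}\<close> with root \<open>0\<close>; \<open>pa 0\<close> is irrelevant\<close>
  "rooted_tree n pa \<longleftrightarrow>
     (\<forall>i\<in>{1..<n}. pa i < n) \<and> (\<forall>i<n. \<exists>k. (pa ^^ k) i = 0)"

definition ch :: "('h, 'k, 'more) tree_splitting_scheme \<Rightarrow> nat \<Rightarrow> nat set" where
  "ch S i = {c \<in> {1..<n_of S}. parent S c = i}"

definition partition_family :: "nat set \<Rightarrow> (nat \<Rightarrow> nat set) \<Rightarrow> nat set \<Rightarrow> bool" where
  \<comment> \<open>\<open>(X i)\<close>, \<open>i \<in> I\<close>, is a partition of \<open>Y\<close> with possibly empty cells\<close>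
  "partition_family I X Y \<longleftrightarrow> (\<Union>i\<in>I. X i) = Y \<and> disjoint_family_on X I"

definition tree_data :: "('h, 'k, 'more) tree_splitting_scheme \<Rightarrow> bool" where
  "tree_data S \<longleftrightarrow>
     rooted_tree (n_of S) (parent S) \<and>
     partition_family {..<n_of S} (cellJ S) {1..m_of S} \<and>
     (\<forall>i<n_of S. ch S i = {} \<longrightarrow> cellJ S i = {}) \<and>
     partition_family {..<n_of S} (cellP S) {1..p_of S} \<and> cellP S 0 = {} \<and>
     (\<forall>r<n_of S. ch S r \<noteq> {} \<longrightarrow> partition_family (ch S r) (cellJc S) (cellJ S r))"

definition metric_data ::
  "('h::real_inner, 'k::real_inner, 'more) tree_splitting_scheme \<Rightarrow> bool" where
  "metric_data S \<longleftrightarrow>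
     (\<forall>i\<in>{1..<n_of S}. metric_on UNIV (metM S i)) \<and>
     (\<forall>j\<in>{1..m_of S}. metric_on (Ksp S j) (metN S j))"


section \<open>The prediction map and the relaxed scheme\<close>

text \<open>
  Elements \<open>(z, s)\<close> of \<open>\<H>\<^sup>n\<^sup>-\<^sup>1 \<times> \<K>\<^sub>1 \<times> \<dots> \<times> \<K>\<^sub>m\<close> are pairs of extensional functions on
  \<open>{1..<n}\<close> and \<open>{1..m}\<close>.
\<close>

definition state_space ::
  "('h, 'k, 'more) tree_splitting_scheme \<Rightarrow> ((nat \<Rightarrow> 'h) \<times> (nat \<Rightarrow> 'k)) set" where
  "state_space S = ({1..<n_of S} \<rightarrow>\<^sub>E UNIV) \<times> (\<Pi>\<^sub>E j\<in>{1..m_of S}. Ksp S j)"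

fun prediction ::
  "('h::{real_inner,complete_space}, 'k::{real_inner,complete_space}, 'more)
     tree_splitting_scheme \<Rightarrow> (nat \<Rightarrow> 'h) \<times> (nat \<Rightarrow> 'k) \<Rightarrow> (nat \<Rightarrow> 'h) \<Rightarrow>
     (nat \<Rightarrow> 'h) \<times> (nat \<Rightarrow> 'k) \<Rightarrow> bool" where
  \<comment> \<open>the inclusions defining the intermediate points \<open>u\<close> and the predicted point \<open>(zt, st)\<close>\<close>
  "prediction S (z, s) u (zt, st) \<longleftrightarrow>
     (zt, st) \<in> state_space S \<and>
     0 \<in> opA S 0 (u 0) +
         {(\<Sum>c\<in>ch S 0. metM S c (u 0 - z c)) +
          (\<Sum>j\<in>cellJ S 0. adjoint (opL S j) (s j)) - vec_a S} \<and>
     (\<forall>i<n_of S. \<forall>j\<in>cellJ S i.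
        0 \<in> inverse_operator (opB S j) (st j) + {metN S j (st j - s j)} +
            inverse_operator (opD S j) (s j) + {- opL S j (u i) + vec_b S j}) \<and>
     (\<forall>i\<in>{1..<n_of S}.
        0 \<in> opA S i (u i) +
            {metM S i (u i + z i - 2 *\<^sub>R u (parent S i)) +
             (\<Sum>c\<in>ch S i. metM S c (u i - z c)) +
             (\<Sum>l\<in>cellP S i. opC S l (u (parent S i))) +
             (\<Sum>j\<in>cellJ S i. adjoint (opL S j) (s j)) +
             (\<Sum>j\<in>cellJc S i. adjoint (opL S j) (st j - s j))}) \<and>
     (\<forall>i\<in>{1..<n_of S}. zt i = z i + u i - u (parent S i))"

text \<open>
  For given \<open>x\<close> the system of inclusions has exactly one solution (the \<open>u i\<close> with \<open>i \<ge> n\<close>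
  do not occur in it), so the description below is proper.
\<close>

definition T_zs ::
  "('h::{real_inner,complete_space}, 'k::{real_inner,complete_space}, 'more)
     tree_splitting_scheme \<Rightarrow> (nat \<Rightarrow> 'h) \<times> (nat \<Rightarrow> 'k) \<Rightarrow> (nat \<Rightarrow> 'h) \<times> (nat \<Rightarrow> 'k)" where
  "T_zs S x = (THE xt. \<exists>u. prediction S x u xt)"

fun T_relaxed ::
  "('h::{real_inner,complete_space}, 'k::{real_inner,complete_space}, 'more)
     tree_splitting_scheme \<Rightarrow> (nat \<Rightarrow> real) \<Rightarrow> (nat \<Rightarrow> real) \<Rightarrow>
     (nat \<Rightarrow> 'h) \<times> (nat \<Rightarrow> 'k) \<Rightarrow> (nat \<Rightarrow> 'h) \<times> (nat \<Rightarrow> 'k)" where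
  "T_relaxed S \<theta> \<zeta> (z, s) =
     (let (zt, st) = T_zs S (z, s) in
       (\<lambda>i\<in>{1..<n_of S}. z i + \<theta> i *\<^sub>R (zt i - z i),
        \<lambda>j\<in>{1..m_of S}. s j + \<zeta> j *\<^sub>R (st j - s j)))"

definition Fix_relaxed ::
  "('h::{real_inner,complete_space}, 'k::{real_inner,complete_space}, 'more)
     tree_splitting_scheme \<Rightarrow> (nat \<Rightarrow> real) \<Rightarrow> (nat \<Rightarrow> real) \<Rightarrow>
     ((nat \<Rightarrow> 'h) \<times> (nat \<Rightarrow> 'k)) set" where
  "Fix_relaxed S \<theta> \<zeta> = {x \<in> state_space S. T_relaxed S \<theta> \<zeta> x = x}"

definition relaxed_sequence ::
  "('h::{real_inner,complete_space}, 'k::{real_inner,complete_space}, 'more)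
     tree_splitting_scheme \<Rightarrow> (nat \<Rightarrow> real) \<Rightarrow> (nat \<Rightarrow> real) \<Rightarrow>
     (nat \<Rightarrow> nat \<Rightarrow> 'h) \<Rightarrow> (nat \<Rightarrow> nat \<Rightarrow> 'h) \<Rightarrow> (nat \<Rightarrow> nat \<Rightarrow> 'k) \<Rightarrow> bool" where
  \<comment> \<open>first index of \<open>u\<close>, \<open>z\<close>, \<open>s\<close>: iteration; second index: node, resp. dual index\<close>
  "relaxed_sequence S \<theta> \<zeta> u z s \<longleftrightarrow>
     (z 0, s 0) \<in> state_space S \<and>
     (\<forall>k. (\<exists>xt. prediction S (z k, s k) (u (Suc k)) xt) \<and>
          (z (Suc k), s (Suc k)) = T_relaxed S \<theta> \<zeta> (z k, s k))"

fun state_inner ::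
  "('h::real_inner, 'k::real_inner, 'more) tree_splitting_scheme \<Rightarrow>
     (nat \<Rightarrow> 'h) \<times> (nat \<Rightarrow> 'k) \<Rightarrow> (nat \<Rightarrow> 'h) \<times> (nat \<Rightarrow> 'k) \<Rightarrow> real" where
  \<comment> \<open>the inner product of the product Hilbert space\<close>
  "state_inner S (z, s) (y, t) =
     (\<Sum>i\<in>{1..<n_of S}. z i \<bullet> y i) + (\<Sum>j\<in>{1..m_of S}. s j \<bullet> t j)"

definition weakly_converges ::
  "('h::real_inner, 'k::real_inner, 'more) tree_splitting_scheme \<Rightarrow>
     (nat \<Rightarrow> (nat \<Rightarrow> 'h) \<times> (nat \<Rightarrow> 'k)) \<Rightarrow> (nat \<Rightarrow> 'h) \<times> (nat \<Rightarrow> 'k) \<Rightarrow> bool" where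
  "weakly_converges S X x \<longleftrightarrow>
     (\<forall>y\<in>state_space S. (\<lambda>k. state_inner S (X k) y) \<longlonglongrightarrow> state_inner S x y)"

end

(* A solution of (P) gives an equilibrium: the dual variables come from the parallel sums and the
   z i are found by solving M i (z i - v) = w i, where w is a flow on the tree determined from the
   leaves to the root.  For the difference of a prediction step and an equilibrium, monotonicity of
   all A i and B j, summed over the tree, gives an inequality in which the cross terms telescope;
   after completing squares it says that the squared distance in the metric
   sum |z i|^2_M / theta i + sum |s j|^2_N / zeta j decreases, and that u i - u (pa i), the dual steps,
   C l u and d j all converge strongly.  The same identity then shows that the total duality product
   converges along weak cluster points, so that by maximality of the product operator every weak
   cluster point is an equilibrium, and Opial's argument makes it unique. *)
theory Submission
  imports Defs
begin

section \<open>Weak convergence in Hilbert spaces\<close>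

text \<open>The obstacle is that the graphs of the \<open>A i\<close> and \<open>B j\<close> are not
  closed when both arguments converge only weakly, and the products belonging to a single operator
  need not converge. Only their total does: the energy identity rewrites it into terms that each
  contain a null factor. The maps \<open>C l\<close> and the inverses of the \<open>D j\<close> can
  be treated one by one, since the completed squares make their values converge strongly; hence
  every cluster point carries the same selections \<open>d\<^sub>r\<close> as the reference
  equilibrium. The constants in (b) and (c) come from one expansion. With an edge step
  \<open>e\<close>, relaxation changes the weighted square by
  \<open>2 <z, e> + \<theta> |e|^2\<close>. Twice the monotonicity inequality cancels the first term
  and leaves \<open>(2 - \<theta>) |e|^2\<close> as a budget. It pays for the coupling through
  \<open>L j\<close> (Young's inequality with weight \<open>2 \<tau> j\<close>) and for evaluating
  \<open>C l\<close> at the parent; the dual budget pays likewise, with the old \<open>s j\<close>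
  in place of the parent. Predictions never have to be constructed: the sequence comes with them,
  and an equilibrium is its own prediction. The description in \<open>T_zs\<close> is resolved by
  uniqueness.\<close>

lemma parallelogram_law:
  fixes x y :: "'a::real_inner"
  shows "(norm (x + y))\<^sup>2 + (norm (x - y))\<^sup>2 = 2 * (norm x)\<^sup>2 + 2 * (norm y)\<^sup>2"
  by (simp add: power2_norm_eq_inner inner_simps inner_commute)

text \<open>A minimising sequence for the distance to \<open>V\<close> is Cauchy by the
  parallelogram law, and orthogonality of the residual is the first-order condition at its limit.
  The projection serves three purposes: Riesz representation, surjectivity of metrics, and weak
  closedness of the \<open>K j\<close>.\<close>

lemma closed_subspace_projection:
  fixes V :: "'a::{real_inner,complete_space} set"
  assumes V: "subspace V" "closed V"
  obtains p where "p \<in> V" "\<And>y. y \<in> V \<Longrightarrow> (x - p) \<bullet> y = 0"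
proof -
  define d where "d = infdist x V"
  have ne: "V \<noteq> {}" using subspace_0[OF V(1)] by auto
  have d0: "0 \<le> d" by (simp add: d_def infdist_nonneg)
  have dle: "d \<le> norm (x - y)" if "y \<in> V" for y
    using infdist_le[OF that, of x] by (simp add: d_def dist_norm)
  have "\<exists>y\<in>V. norm (x - y) < d + 1 / (real k + 1)" for k
  proof (rule ccontr)
    assume "\<not> ?thesis"
    then have "\<forall>y\<in>V. d + 1 / (real k + 1) \<le> dist x y" by (auto simp: dist_norm not_less)
    then have "d + 1 / (real k + 1) \<le> infdist x V"
      using ne by (auto simp: infdist_def intro!: cINF_greatest)
    moreover have "0 < 1 / (real k + 1)" by simp
    ultimately show False unfolding d_def by linarith
  qed
  then obtain Y where Y: "\<And>k. Y k \<in> V" "\<And>k. norm (x - Y k) < d + 1 / (real k + 1)" by metis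
  \<comment> \<open>The midpoint of \<open>y\<close> and \<open>y'\<close> lies in \<open>V\<close>,
    so its distance to \<open>x\<close> is at least \<open>d\<close>; this bounds the sum in the
    parallelogram law from below.\<close>
  have near: "(norm (y - y'))\<^sup>2 \<le> 2 * (norm (x - y))\<^sup>2 + 2 * (norm (x - y'))\<^sup>2 - 4 * d\<^sup>2"
    if "y \<in> V" "y' \<in> V" for y y'
  proof -
    have "(1/2) *\<^sub>R (y + y') \<in> V" using that V(1) by (simp add: subspace_add subspace_scale)
    then have "d \<le> norm (x - (1/2) *\<^sub>R (y + y'))" by (rule dle)
    moreover have "(x - y) + (x - y') = 2 *\<^sub>R (x - (1/2) *\<^sub>R (y + y'))"
      by (simp add: algebra_simps scaleR_2)
    ultimately have "2 * d \<le> norm ((x - y) + (x - y'))" by simp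
    then have "(2 * d)\<^sup>2 \<le> (norm ((x - y) + (x - y')))\<^sup>2" using d0 by (intro power_mono) auto
    moreover have "norm ((x - y) - (x - y')) = norm (y - y')" by (simp add: norm_minus_commute)
    ultimately show ?thesis using parallelogram_law[of "x - y" "x - y'"]
      by (simp add: power_mult_distrib)
  qed
  have lim: "(\<lambda>k. norm (x - Y k)) \<longlonglongrightarrow> d"
  proof (rule tendsto_sandwich[of "\<lambda>_. d" _ _ "\<lambda>k. d + 1 / (real k + 1)"])
    have "(\<lambda>k. d + 1 / (real k + 1)) \<longlonglongrightarrow> d + 0"
      by (intro tendsto_add tendsto_const LIMSEQ_ignore_initial_segment
          [OF lim_inverse_n', of 1, simplified add.commute[of _ 1], simplified])
         (use LIMSEQ_inverse_real_of_nat in \<open>simp add: inverse_eq_divide add.commute\<close>)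
    then show "(\<lambda>k. d + 1 / (real k + 1)) \<longlonglongrightarrow> d" by simp
    show "\<forall>\<^sub>F k in sequentially. norm (x - Y k) \<le> d + 1 / (real k + 1)"
      using less_imp_le[OF Y(2)] by simp
  qed (use dle Y(1) in auto)
  have "Cauchy Y"
  proof (rule metric_CauchyI)
    fix e :: real assume e: "0 < e"
    have "(\<lambda>k. (norm (x - Y k))\<^sup>2) \<longlonglongrightarrow> d\<^sup>2" by (intro tendsto_intros lim)
    moreover have "d\<^sup>2 < d\<^sup>2 + e\<^sup>2 / 4" using e by simp
    ultimately have "\<forall>\<^sub>F k in sequentially. (norm (x - Y k))\<^sup>2 < d\<^sup>2 + e\<^sup>2 / 4"
      by (rule order_tendstoD(2))
    then obtain K where K: "\<And>k. K \<le> k \<Longrightarrow> (norm (x - Y k))\<^sup>2 < d\<^sup>2 + e\<^sup>2 / 4"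
      by (auto simp: eventually_sequentially)
    have "dist (Y i) (Y j) < e" if "K \<le> i" "K \<le> j" for i j
    proof -
      have "(norm (Y i - Y j))\<^sup>2 < e\<^sup>2"
        using near[OF Y(1)[of i] Y(1)[of j]] K[OF that(1)] K[OF that(2)] by linarith
      then show ?thesis using e by (simp add: dist_norm power_less_imp_less_base)
    qed
    then show "\<exists>M. \<forall>i\<ge>M. \<forall>j\<ge>M. dist (Y i) (Y j) < e" by blast
  qed
  then obtain p where p: "Y \<longlonglongrightarrow> p" by (auto simp: Cauchy_convergent_iff convergent_def)
  have pV: "p \<in> V" using closed_sequentially[OF V(2) Y(1) p] .
  have "(\<lambda>k. norm (x - Y k)) \<longlonglongrightarrow> norm (x - p)" by (intro tendsto_intros p)
  with lim have dp: "norm (x - p) = d" by (simp add: LIMSEQ_unique)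
  have "(x - p) \<bullet> y = 0" if y: "y \<in> V" for y
  proof (cases "y = 0")
    case False
    \<comment> \<open>The minimiser of the quadratic distance from \<open>x\<close> to
      \<open>p + t *\<^sub>R y\<close> in \<open>t\<close>; it lowers the distance strictly unless
      the inner product is zero.\<close>
    define t where "t = ((x - p) \<bullet> y) / (y \<bullet> y)"
    have "p + t *\<^sub>R y \<in> V" using V(1) pV y by (simp add: subspace_add subspace_scale)
    then have "(norm (x - p))\<^sup>2 \<le> (norm (x - (p + t *\<^sub>R y)))\<^sup>2"
      using dle d0 dp by (intro power_mono) auto
    also have "\<dots> = (norm (x - p))\<^sup>2 - ((x - p) \<bullet> y)\<^sup>2 / (y \<bullet> y)"
    proof -
      have "(norm (x - (p + t *\<^sub>R y)))\<^sup>2 = (norm ((x - p) - t *\<^sub>R y))\<^sup>2" by (simp add: algebra_simps)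
      also have "\<dots> = (norm (x - p))\<^sup>2 - 2 * t * ((x - p) \<bullet> y) + t\<^sup>2 * (y \<bullet> y)"
        unfolding power2_norm_eq_inner inner_diff_left inner_diff_right
        by (simp add: inner_commute power2_eq_square algebra_simps)
      finally show ?thesis using False by (simp add: t_def power2_eq_square field_simps)
    qed
    finally have "((x - p) \<bullet> y)\<^sup>2 / (y \<bullet> y) \<le> 0" by simp
    moreover have "0 < y \<bullet> y" using False by simp
    ultimately have "((x - p) \<bullet> y)\<^sup>2 \<le> 0" by (simp add: divide_le_0_iff)
    then show ?thesis by simp
  qed simp
  with pV that show ?thesis by blast
qed

text \<open>Take \<open>e\<close> orthogonal to the kernel of \<open>f\<close> with
  \<open>f e\<close> nonzero. Every \<open>x\<close> differs from a multiple of \<open>e\<close> by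
  a kernel element, so \<open>f\<close> is a multiple of the inner product with
  \<open>e\<close>.\<close>

lemma riesz_representation:
  fixes f :: "'a::{real_inner,complete_space} \<Rightarrow> real"
  assumes f: "bounded_linear f"
  obtains v where "\<And>x. f x = x \<bullet> v"
proof (cases "\<forall>x. f x = 0")
  case True
  then show ?thesis using that[of 0] by simp
next
  case False
  interpret f: bounded_linear f by (rule f)
  obtain x0 where x0: "f x0 \<noteq> 0" using False by blast
  define V where "V = {x. f x = 0}"
  have "subspace V" by (auto simp: V_def subspace_def f.add f.scaleR)
  moreover have "closed V"
    unfolding V_def by (intro closed_Collect_eq linear_continuous_on f continuous_on_const)
  ultimately obtain p where p: "p \<in> V" "\<And>y. y \<in> V \<Longrightarrow> (x0 - p) \<bullet> y = 0"
    by (rule closed_subspace_projection[of V x0]) blast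
  define e where "e = x0 - p"
  have fe: "f e = f x0" using p(1) by (simp add: e_def V_def f.diff)
  have "e \<noteq> 0" using fe x0 f.zero by auto
  then have ee: "e \<bullet> e \<noteq> 0" by simp
  have "f x = x \<bullet> ((f e / (e \<bullet> e)) *\<^sub>R e)" for x
  proof -
    have "x - (f x / f e) *\<^sub>R e \<in> V" using x0 fe by (simp add: V_def f.diff f.scaleR)
    then have "e \<bullet> (x - (f x / f e) *\<^sub>R e) = 0" using p(2) by (simp add: e_def)
    then have "e \<bullet> x = (f x / f e) * (e \<bullet> e)" by (simp add: inner_diff_right)
    then show ?thesis using x0 fe ee by (simp add: inner_commute field_simps)
  qed
  then show ?thesis by (rule that)
qed

text \<open>\<open>adjoint\<close> is defined by a choice, which says nothing until some adjoint is
  known to exist. Riesz representation of the functionals \<open>L x \<bullet> y\<close> in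
  \<open>x\<close> provides one in infinite dimension.\<close>

lemma adjoint_hilbert:
  fixes L :: "'a::{real_inner,complete_space} \<Rightarrow> 'b::real_inner"
  assumes L: "bounded_linear L"
  shows "x \<bullet> adjoint L y = L x \<bullet> y"
proof -
  have "\<exists>v. \<forall>x. L x \<bullet> y = x \<bullet> v" for y
    using riesz_representation[OF bounded_linear_inner_left_comp[OF L, of y]] by metis
  then obtain g where g: "\<forall>x y. L x \<bullet> y = x \<bullet> g y" by metis
  with adjoint_unique[OF this] show ?thesis by metis
qed

lemma linear_adjoint_hilbert:
  fixes L :: "'a::{real_inner,complete_space} \<Rightarrow> 'b::real_inner"
  assumes L: "bounded_linear L"
  shows "linear (adjoint L)"
  by (rule linearI; rule vector_eq_ldot[THEN iffD1])
     (simp_all add: inner_add_right adjoint_hilbert[OF L])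

text \<open>Weak convergence is used along arbitrary filters: weak cluster points of a sequence are
  its weak limits along proper filters finer than \<^term>\<open>sequentially\<close>, so that no
  subsequences are needed.\<close>

definition weakly_tendsto :: "('i \<Rightarrow> 'a::real_inner) \<Rightarrow> 'a \<Rightarrow> 'i filter \<Rightarrow> bool" where
  "weakly_tendsto X x F \<longleftrightarrow> (\<forall>y. ((\<lambda>k. X k \<bullet> y) \<longlongrightarrow> x \<bullet> y) F)"

lemma weakly_tendsto_of_tendsto: "(X \<longlongrightarrow> x) F \<Longrightarrow> weakly_tendsto X x F"
  unfolding weakly_tendsto_def by (auto intro!: tendsto_intros)

lemma weakly_tendsto_const: "weakly_tendsto (\<lambda>_. x) x F"
  by (simp add: weakly_tendsto_def)

lemma weakly_tendsto_add:
  "weakly_tendsto X x F \<Longrightarrow> weakly_tendsto Y y F \<Longrightarrow> weakly_tendsto (\<lambda>k. X k + Y k) (x + y) F"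
  unfolding weakly_tendsto_def by (auto simp: inner_add_left intro!: tendsto_add)

lemma weakly_tendsto_diff:
  "weakly_tendsto X x F \<Longrightarrow> weakly_tendsto Y y F \<Longrightarrow> weakly_tendsto (\<lambda>k. X k - Y k) (x - y) F"
  unfolding weakly_tendsto_def by (auto simp: inner_diff_left intro!: tendsto_diff)

lemma weakly_tendsto_scaleR:
  "weakly_tendsto X x F \<Longrightarrow> weakly_tendsto (\<lambda>k. c *\<^sub>R X k) (c *\<^sub>R x) F"
  unfolding weakly_tendsto_def by (auto intro!: tendsto_mult_left)

lemma weakly_tendsto_sum:
  "(\<And>i. i \<in> I \<Longrightarrow> weakly_tendsto (X i) (x i) F) \<Longrightarrow>
    weakly_tendsto (\<lambda>k. \<Sum>i\<in>I. X i k) (\<Sum>i\<in>I. x i) F"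
  unfolding weakly_tendsto_def by (auto simp: inner_sum_left intro!: tendsto_sum)

lemma weakly_tendsto_bounded_linear:
  fixes X :: "'i \<Rightarrow> 'a::{real_inner,complete_space}"
  assumes "bounded_linear L" "weakly_tendsto X x F"
  shows "weakly_tendsto (\<lambda>k. L (X k)) (L x) F"
  using assms(2) by (simp add: weakly_tendsto_def adjoint_hilbert[OF assms(1), symmetric])

lemma weakly_tendsto_adjoint:
  fixes L :: "'a::{real_inner,complete_space} \<Rightarrow> 'b::real_inner"
  assumes "bounded_linear L" "weakly_tendsto X x F"
  shows "weakly_tendsto (\<lambda>k. adjoint L (X k)) (adjoint L x) F"
  using assms(2)
  by (simp add: weakly_tendsto_def adjoint_hilbert[OF assms(1)]
      inner_commute[of "adjoint L _"] inner_commute[of "L _"])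

text \<open>The residual \<open>x - p\<close> of the projection is orthogonal to every
  \<open>X k\<close>, hence to the weak limit \<open>x\<close>, and also to \<open>p\<close>; so it
  is orthogonal to itself.\<close>

lemma weakly_tendsto_closed_subspace:
  fixes V :: "'a::{real_inner,complete_space} set"
  assumes V: "subspace V" "closed V" and X: "weakly_tendsto X x F" "\<And>k. X k \<in> V"
    and F: "F \<noteq> bot"
  shows "x \<in> V"
proof -
  obtain p where p: "p \<in> V" "\<And>y. y \<in> V \<Longrightarrow> (x - p) \<bullet> y = 0"
    using closed_subspace_projection[OF V] by blast
  have "((\<lambda>k. X k \<bullet> (x - p)) \<longlongrightarrow> x \<bullet> (x - p)) F" using X(1) by (simp add: weakly_tendsto_def)
  moreover have "X k \<bullet> (x - p) = 0" for k using p(2)[OF X(2)] by (simp add: inner_commute)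
  ultimately have "x \<bullet> (x - p) = 0"
    using tendsto_unique[OF F tendsto_const] by fastforce
  moreover have "p \<bullet> (x - p) = 0" using p(2)[OF p(1)] by (simp add: inner_commute)
  ultimately have "(x - p) \<bullet> (x - p) = 0" by (simp add: inner_diff_left)
  then show ?thesis using p(1) by simp
qed

lemma tendsto_inner_bounded_null:
  assumes B: "\<And>k. norm (X k) \<le> B" and Y: "(Y \<longlongrightarrow> 0) F"
  shows "((\<lambda>k. X k \<bullet> Y k) \<longlongrightarrow> 0) F"
proof (rule Lim_null_comparison)
  have "norm (X k \<bullet> Y k) \<le> B * norm (Y k)" for k
    using Cauchy_Schwarz_ineq2[of "X k" "Y k"] mult_right_mono[OF B[of k] norm_ge_zero[of "Y k"]]
    by simp
  then show "\<forall>\<^sub>F k in F. norm (X k \<bullet> Y k) \<le> B * norm (Y k)" by simp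
  show "((\<lambda>k. B * norm (Y k)) \<longlongrightarrow> 0) F" using tendsto_mult_right_zero[OF tendsto_norm_zero[OF Y]] .
qed

text \<open>Tychonoff's theorem for the functionals \<open>y \<mapsto> X k \<bullet> y\<close> gives a filter along which all of
  them converge pointwise; the limit is represented by Riesz' theorem.\<close>

lemma bounded_weak_cluster:
  fixes X :: "'i \<Rightarrow> 'k \<Rightarrow> 'a::{real_inner,complete_space}"
  assumes B: "\<And>i k. norm (X i k) \<le> B i" and F: "F \<noteq> bot"
  obtains G x where "G \<noteq> bot" "G \<le> F" "\<And>i. weakly_tendsto (X i) (x i) G"
proof -
  define \<Phi> where "\<Phi> k = (\<lambda>(i, y). X i k \<bullet> y)" for k
  \<comment> \<open>The coordinates are pairs of a family index and a test vector, so one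
    compactness argument yields a single filter that serves all \<open>X i\<close>
    simultaneously.\<close>
  define K where "K = (\<Pi>\<^sub>E a\<in>(UNIV :: ('i \<times> 'a) set). {- (B (fst a) * norm (snd a))..B (fst a) * norm (snd a)})"
  have "compact K"
    unfolding K_def compactin_euclidean_iff[symmetric] euclidean_product_topology[symmetric]
      compactin_PiE
    by (auto simp: split_beta)
  moreover have \<Phi>K: "\<Phi> k \<in> K" for k
  proof -
    have "\<bar>X i k \<bullet> y\<bar> \<le> B i * norm y" for i y
      using Cauchy_Schwarz_ineq2[of "X i k" y] mult_right_mono[OF B[of i k] norm_ge_zero[of y]]
      by simp
    then show ?thesis by (auto simp: \<Phi>_def K_def abs_le_iff minus_le_iff)
  qed
  moreover have "filtermap \<Phi> F \<noteq> bot" using F by (simp add: filtermap_bot_iff)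
  ultimately obtain f where f: "inf (nhds f) (filtermap \<Phi> F) \<noteq> bot"
    unfolding compact_filter by (metis (mono_tags, lifting) \<Phi>K eventually_filtermap always_eventually)
  \<comment> \<open>The cluster point \<open>f\<close> lives on the image side. Pulling its
    neighbourhoods back along \<open>\<Phi>\<close> and meeting them with \<open>F\<close> gives a
    filter on the indices along which \<open>\<Phi>\<close> really converges to
    \<open>f\<close>.\<close>
  define G where "G = inf F (filtercomap \<Phi> (nhds f))"
  have "G \<noteq> bot"
  proof
    assume "G = bot"
    then have "eventually (\<lambda>_. False) G" by simp
    then obtain P Q where PQ: "eventually P F" "eventually Q (filtercomap \<Phi> (nhds f))"
        "\<And>k. P k \<Longrightarrow> Q k \<Longrightarrow> False"
      unfolding G_def eventually_inf by auto
    then obtain R where R: "eventually R (nhds f)" "\<And>k. R (\<Phi> k) \<Longrightarrow> Q k"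
      unfolding eventually_filtercomap by auto
    have "eventually (\<lambda>g. \<not> R g) (filtermap \<Phi> F)"
      unfolding eventually_filtermap using PQ(1) by eventually_elim (use PQ(3) R(2) in auto)
    then have "eventually (\<lambda>_. False) (inf (nhds f) (filtermap \<Phi> F))"
      unfolding eventually_inf using R(1) by blast
    with f show False by (simp add: trivial_limit_def)
  qed
  moreover have "G \<le> F" by (simp add: G_def)
  moreover have lim: "((\<lambda>k. X i k \<bullet> y) \<longlongrightarrow> f (i, y)) G" for i y
  proof -
    have "filterlim \<Phi> (nhds f) G"
      unfolding G_def filterlim_iff_le_filtercomap by simp
    then have "((\<lambda>k. \<Phi> k (i, y)) \<longlongrightarrow> f (i, y)) G"
      using continuous_on_tendsto_compose[OF continuous_on_product_coordinates[of "(i, y)"], of \<Phi> f G]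
      by simp
    then show ?thesis by (simp add: \<Phi>_def)
  qed
  moreover have "\<exists>x. \<forall>y. f (i, y) = x \<bullet> y" for i
  proof -
    \<comment> \<open>Additivity, homogeneity and the norm bound hold for every \<open>k\<close> and
      pass to the pointwise limit because limits along the proper filter \<open>G\<close> are unique
      and keep inequalities.\<close>
    have "bounded_linear (\<lambda>y. f (i, y))"
    proof (rule bounded_linear_intro[where K = "B i"])
      show "f (i, y + y') = f (i, y) + f (i, y')" for y y'
        by (rule tendsto_unique[OF \<open>G \<noteq> bot\<close> lim])
           (auto simp: inner_add_right intro!: tendsto_intros lim)
      show "f (i, r *\<^sub>R y) = r *\<^sub>R f (i, y)" for r y
        by (rule tendsto_unique[OF \<open>G \<noteq> bot\<close> lim]) (auto intro!: tendsto_intros lim)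
      show "norm (f (i, y)) \<le> norm y * B i" for y
      proof (rule tendsto_upperbound[OF tendsto_norm[OF lim] _ \<open>G \<noteq> bot\<close>])
        have "norm (X i k \<bullet> y) \<le> norm y * B i" for k
          using Cauchy_Schwarz_ineq2[of "X i k" y] mult_right_mono[OF B[of i k] norm_ge_zero[of y]]
          by (simp add: mult.commute)
        then show "\<forall>\<^sub>F k in G. norm (X i k \<bullet> y) \<le> norm y * B i" by simp
      qed
    qed
    then show ?thesis by (metis inner_commute riesz_representation)
  qed
  then obtain x where "\<And>i y. f (i, y) = x i \<bullet> y" by metis
  ultimately show ?thesis using that[of G x] unfolding weakly_tendsto_def by simp
qed

lemma weakly_tendsto_diff_iff: "weakly_tendsto X x F \<longleftrightarrow> weakly_tendsto (\<lambda>k. X k - x) 0 F"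
  unfolding weakly_tendsto_def
  by (simp add: inner_diff_left LIM_zero_iff[of "\<lambda>k. X k \<bullet> _" "x \<bullet> _"])

lemma weakly_tendsto_mono: "weakly_tendsto X x F \<Longrightarrow> G \<le> F \<Longrightarrow> weakly_tendsto X x G"
  unfolding weakly_tendsto_def using tendsto_mono by blast

text \<open>Weak times strong convergence. Boundedness of \<open>X\<close> is a separate assumption
  because along a general filter a weak limit does not imply it.\<close>

lemma weakly_tendsto_inner_tendsto:
  assumes X: "weakly_tendsto X x F" "\<And>k. norm (X k) \<le> B" and Y: "(Y \<longlongrightarrow> y) F"
  shows "((\<lambda>k. X k \<bullet> Y k) \<longlongrightarrow> x \<bullet> y) F"
proof -
  have "((\<lambda>k. X k \<bullet> (Y k - y)) \<longlongrightarrow> 0) F"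
    by (rule tendsto_inner_bounded_null[OF X(2) LIM_zero[OF Y]])
  then have "((\<lambda>k. X k \<bullet> (Y k - y) + X k \<bullet> y) \<longlongrightarrow> 0 + x \<bullet> y) F"
    using X(1) by (intro tendsto_add) (auto simp: weakly_tendsto_def)
  then show ?thesis by (simp add: inner_diff_right)
qed

text \<open>The products \<open>X k \<bullet> Y k\<close> have no reason to converge, but they
  cancel between the two terms. What remains is affine in \<open>X k\<close> and in
  \<open>Y k\<close> separately, so weak limits suffice.\<close>

lemma weakly_tendsto_inner_expand:
  assumes "weakly_tendsto X x F" "weakly_tendsto Y y F"
  shows "((\<lambda>k. (X k - p) \<bullet> (Y k - q) - (X k - x) \<bullet> (Y k - y)) \<longlongrightarrow> (x - p) \<bullet> (y - q)) F"
proof -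
  have "((\<lambda>k. X k \<bullet> (y - q)) \<longlongrightarrow> x \<bullet> (y - q)) F" "((\<lambda>k. Y k \<bullet> (x - p)) \<longlongrightarrow> y \<bullet> (x - p)) F"
    using assms by (auto simp: weakly_tendsto_def)
  then have "((\<lambda>k. X k \<bullet> (y - q) + Y k \<bullet> (x - p) - (x \<bullet> y - p \<bullet> q)) \<longlongrightarrow>
      x \<bullet> (y - q) + y \<bullet> (x - p) - (x \<bullet> y - p \<bullet> q)) F"
    by (intro tendsto_add tendsto_diff tendsto_const)
  then show ?thesis by (simp add: inner_diff_left inner_diff_right inner_commute algebra_simps)
qed

text \<open>The subsequence principle with finer filters in place of subsequences.\<close>

lemma tendsto_of_clusters:
  fixes f :: "'i \<Rightarrow> 'a::metric_space"
  assumes "\<And>G. G \<noteq> bot \<Longrightarrow> G \<le> F \<Longrightarrow> \<exists>H. H \<noteq> bot \<and> H \<le> G \<and> (f \<longlongrightarrow> l) H"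
  shows "(f \<longlongrightarrow> l) F"
proof (rule tendstoI, rule ccontr)
  fix e :: real assume e: "0 < e" and "\<not> (\<forall>\<^sub>F k in F. dist (f k) l < e)"
  \<comment> \<open>If convergence fails for some \<open>e\<close>, restricting \<open>F\<close> to
    the bad indices leaves a proper filter, on which no finer filter can converge to
    \<open>l\<close>.\<close>
  then have "inf F (principal {k. \<not> dist (f k) l < e}) \<noteq> bot"
    by (simp add: trivial_limit_def eventually_inf_principal)
  from assms[OF this] obtain H where H: "H \<noteq> bot" "H \<le> inf F (principal {k. \<not> dist (f k) l < e})"
      "(f \<longlongrightarrow> l) H" by auto
  have "\<forall>\<^sub>F k in H. \<not> dist (f k) l < e"
    by (rule filter_leD[OF H(2)]) (simp add: eventually_inf_principal)
  moreover have "\<forall>\<^sub>F k in H. dist (f k) l < e" using tendstoD[OF H(3) e] .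
  ultimately have "\<forall>\<^sub>F k in H. False" by eventually_elim simp
  with H(1) show False by (simp add: trivial_limit_def)
qed

lemma tendsto_0_of_square_bound:
  fixes X :: "'i \<Rightarrow> 'a::real_normed_vector"
  assumes c: "0 < c" and le: "\<And>k. c * (norm (X k))\<^sup>2 \<le> \<delta> k" and \<delta>: "(\<delta> \<longlongrightarrow> 0) F"
  shows "(X \<longlongrightarrow> 0) F"
proof -
  have "((\<lambda>k. (norm (X k))\<^sup>2) \<longlongrightarrow> 0) F"
  proof (rule tendsto_sandwich[of "\<lambda>_. 0" _ _ "\<lambda>k. \<delta> k / c"])
    show "\<forall>\<^sub>F k in F. (norm (X k))\<^sup>2 \<le> \<delta> k / c" using le c by (simp add: field_simps)
    show "((\<lambda>k. \<delta> k / c) \<longlongrightarrow> 0) F" using tendsto_divide[OF \<delta> tendsto_const, of c] c by simp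
  qed auto
  then have "((\<lambda>k. sqrt ((norm (X k))\<^sup>2)) \<longlongrightarrow> sqrt 0) F" by (rule tendsto_real_sqrt)
  then show ?thesis by (simp add: tendsto_norm_zero_iff)
qed

lemma bounded_diff_const:
  fixes X :: "'i \<Rightarrow> 'a::real_normed_vector"
  assumes "\<exists>b. \<forall>k. norm (X k) \<le> b"
  shows "\<exists>b. \<forall>k. norm (X k - x) \<le> b"
proof -
  obtain b where "\<And>k. norm (X k) \<le> b" using assms by blast
  then have "norm (X k - x) \<le> b + norm x" for k
    using norm_triangle_ineq4[of "X k" x] by (meson add_right_mono order_trans)
  then show ?thesis by blast
qed

section \<open>Positive definite maps and monotone operators\<close>

lemma metric_on_UNIV_bounded_linear: "metric_on UNIV M \<Longrightarrow> bounded_linear M"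
  unfolding metric_on_def by (metis UNIV_I bounded_linear_intro mult.commute)

text \<open>The Lax-Milgram argument: coercivity bounds \<open>M\<close> from below, so its range is
  complete and hence closed, and the same coercivity shows that nothing nonzero is orthogonal to the
  range.\<close>

lemma metric_on_UNIV_surj:
  fixes M :: "'a::{real_inner,complete_space} \<Rightarrow> 'a"
  assumes M: "metric_on UNIV M"
  obtains x where "M x = y"
proof -
  interpret bounded_linear M by (rule metric_on_UNIV_bounded_linear[OF M])
  obtain r where r: "0 < r" "\<And>x. r * (norm x)\<^sup>2 \<le> M x \<bullet> x"
    using M by (auto simp: metric_on_def bounded_below_on_def)
  have "r * norm x \<le> norm (M x)" for x
  proof (cases "x = 0")
    case False
    have "r * (norm x)\<^sup>2 \<le> norm (M x) * norm x"
      using r(2)[of x] norm_cauchy_schwarz[of "M x" x] by linarith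
    with False show ?thesis by (simp add: power2_eq_square)
  qed simp
  then have "complete (M ` UNIV)"
    using r(1) by (intro complete_isometric_image bounded_linear_axioms subspace_UNIV) auto
  then have "closed (range M)" by (rule complete_imp_closed)
  moreover have "subspace (range M)" by (rule linear_subspace_image[OF linear_axioms subspace_UNIV])
  ultimately obtain p where p: "p \<in> range M" "\<And>v. v \<in> range M \<Longrightarrow> (y - p) \<bullet> v = 0"
    using closed_subspace_projection[of "range M" y] by metis
  \<comment> \<open>The residual is tested against its own image \<open>M (y - p)\<close>, which
    lies in the range.\<close>
  have "r * (norm (y - p))\<^sup>2 \<le> 0" using r(2)[of "y - p"] p(2)[of "M (y - p)"] by (simp add: inner_commute)
  then have "y = p" using r(1) by (simp add: mult_le_0_iff)
  with p(1) that show ?thesis by blast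
qed

lemma metric_on_0:
  assumes "metric_on S M" "subspace S" shows "M 0 = 0"
proof -
  have "\<forall>c. \<forall>x\<in>S. M (c *\<^sub>R x) = c *\<^sub>R M x" "0 \<in> S"
    using assms by (auto simp: metric_on_def subspace_0)
  then have "M (0 *\<^sub>R 0) = 0 *\<^sub>R M 0" by blast
  then show ?thesis by simp
qed

lemma metric_on_add: "metric_on S M \<Longrightarrow> x \<in> S \<Longrightarrow> y \<in> S \<Longrightarrow> M (x + y) = M x + M y"
  by (simp add: metric_on_def)

lemma metric_on_scaleR: "metric_on S M \<Longrightarrow> x \<in> S \<Longrightarrow> M (c *\<^sub>R x) = c *\<^sub>R M x"
  by (simp add: metric_on_def)

lemma metric_on_diff:
  assumes "metric_on S M" "subspace S" "x \<in> S" "y \<in> S" shows "M (x - y) = M x - M y"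
  using metric_on_add[OF assms(1,3), of "(-1) *\<^sub>R y"] metric_on_scaleR[OF assms(1,4), of "-1"]
    subspace_neg[OF assms(2,4)] by simp

lemma metric_on_selfadjoint: "metric_on S M \<Longrightarrow> x \<in> S \<Longrightarrow> y \<in> S \<Longrightarrow> M x \<bullet> y = x \<bullet> M y"
  by (simp add: metric_on_def)

lemma metric_on_pos:
  assumes "metric_on S M"
  obtains r where "0 < r" "\<And>x. x \<in> S \<Longrightarrow> r * (norm x)\<^sup>2 \<le> M x \<bullet> x"
  using assms by (auto simp: metric_on_def bounded_below_on_def)

lemma metric_on_nonneg: "metric_on S M \<Longrightarrow> x \<in> S \<Longrightarrow> 0 \<le> M x \<bullet> x"
  by (erule metric_on_pos) (meson dual_order.trans less_imp_le mult_nonneg_nonneg zero_le_power2)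

lemma metric_on_eq_0:
  assumes "metric_on S M" "x \<in> S" "M x \<bullet> x \<le> 0" shows "x = 0"
proof -
  obtain r where r: "0 < r" "r * (norm x)\<^sup>2 \<le> M x \<bullet> x" using metric_on_pos[OF assms(1)] assms(2) by metis
  then have "r * (norm x)\<^sup>2 \<le> 0" using assms(3) by linarith
  then show ?thesis using r(1) by (simp add: mult_le_0_iff)
qed

lemma metric_on_tendsto_0:
  assumes "metric_on S M" "\<And>k. X k \<in> S" "(X \<longlongrightarrow> 0) F"
  shows "((\<lambda>k. M (X k)) \<longlongrightarrow> 0) F"
proof -
  obtain B where "\<And>x. x \<in> S \<Longrightarrow> norm (M x) \<le> B * norm x" using assms(1) unfolding metric_on_def by metis
  then show ?thesis
    using assms(2) by (intro Lim_null_comparison[OF _ tendsto_mult_right_zero[OF tendsto_norm_zero[OF assms(3)]]])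
      (auto intro!: always_eventually)
qed

section \<open>Maximal monotonicity expressed through pairs of the graph\<close>

lemma maximally_monotone_on_monotoneD:
  "maximally_monotone_on S A \<Longrightarrow> v \<in> A x \<Longrightarrow> w \<in> A y \<Longrightarrow> 0 \<le> (x - y) \<bullet> (v - w)"
  by (auto simp: maximally_monotone_on_def monotone_operator_def)

lemma maximally_monotone_on_carrierD:
  assumes "maximally_monotone_on S A" "v \<in> A x" shows "x \<in> S" "v \<in> S"
  using assms by (auto simp: maximally_monotone_on_def operator_on_def)

text \<open>Adding the pair \<open>(x, v)\<close> to the graph keeps it monotone and inside the
  carrier, so by maximality the pair was there already.\<close>

lemma maximally_monotone_onI:
  assumes A: "maximally_monotone_on S A" and "x \<in> S" "v \<in> S"
    and mono: "\<And>y w. w \<in> A y \<Longrightarrow> 0 \<le> (x - y) \<bullet> (v - w)"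
  shows "v \<in> A x"
proof -
  define A' where "A' = A(x := insert v (A x))"
  have "0 \<le> (y - x) \<bullet> (w - v)" if "w \<in> A y" for y w
    using mono[OF that] by (simp add: inner_diff_left inner_diff_right algebra_simps)
  then have "monotone_operator A'" using A mono
    by (auto simp: A'_def maximally_monotone_on_def monotone_operator_def)
  moreover have "operator_on S A'"
    using A assms(2,3) by (auto simp: A'_def maximally_monotone_on_def operator_on_def)
  moreover have "\<forall>y. A y \<subseteq> A' y" by (auto simp: A'_def)
  ultimately have "A' = A" using A unfolding maximally_monotone_on_def by blast
  then have "A' x = A x" by simp
  then show ?thesis unfolding A'_def by auto
qed

text \<open>The signs are arranged for summation: a sum of such products over several operators can
  vanish only if every pair lies on its graph. For a pair on the graph the pair itself is the
  witness.\<close>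

lemma maximally_monotone_on_witness:
  assumes A: "maximally_monotone_on S A" and "x \<in> S" "v \<in> S"
  obtains y w where "w \<in> A y" "(x - y) \<bullet> (v - w) \<le> 0" "v \<notin> A x \<Longrightarrow> (x - y) \<bullet> (v - w) < 0"
proof (cases "v \<in> A x")
  case True
  then show ?thesis using that[of v x] by simp
next
  case False
  then show ?thesis using maximally_monotone_onI[OF assms] that by (metis less_imp_le not_le)
qed

text \<open>Dividing by the relaxation parameter gives the cross term the coefficient
  \<open>2\<close> whatever \<open>c\<close> is. This is the reason for the weights
  \<open>1 / \<theta> i\<close> and \<open>1 / \<zeta> j\<close> in the Lyapunov function.\<close>

lemma metric_on_relaxed_square:
  assumes "metric_on V G" "subspace V" "x \<in> V" "y \<in> V" "0 < c"
  shows "G (x + c *\<^sub>R y) \<bullet> (x + c *\<^sub>R y) / c = G x \<bullet> x / c + 2 * (G x \<bullet> y) + c * (G y \<bullet> y)"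
proof -
  have "G (x + c *\<^sub>R y) = G x + c *\<^sub>R G y"
    using metric_on_add[OF assms(1,3) subspace_scale[OF assms(2,4)]] metric_on_scaleR[OF assms(1,4)]
    by simp
  moreover have "G y \<bullet> x = G x \<bullet> y" using metric_on_selfadjoint[OF assms(1,4,3)] by (simp add: inner_commute)
  ultimately show ?thesis using assms(5) by (simp add: inner_add_left inner_add_right field_simps)
qed

text \<open>Here \<open>x\<close> is the displacement at the point where the cocoercive map is
  evaluated, and \<open>x + y\<close> the one against which its value is tested in the energy
  balance. The mismatch \<open>y\<close> costs \<open>1 / (2 * b)\<close> times its squared norm.
  The square is kept rather than dropped, since it later yields strong convergence of the values
  \<open>g\<close>.\<close>

lemma cocoercive_square:
  fixes x y g :: "'b::real_inner"
  assumes "0 < b" "b * (norm g)\<^sup>2 \<le> x \<bullet> g"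
  shows "- 2 * ((x + y) \<bullet> g) \<le> (norm y)\<^sup>2 / (2 * b) - 2 * b * (norm (g + (1 / (2 * b)) *\<^sub>R y))\<^sup>2"
proof -
  have "2 * b * (norm (g + (1 / (2 * b)) *\<^sub>R y))\<^sup>2 =
      2 * b * (norm g)\<^sup>2 + 2 * (y \<bullet> g) + (norm y)\<^sup>2 / (2 * b)"
    unfolding power2_norm_eq_inner inner_add_left inner_add_right using assms(1)
    by (simp add: inner_commute field_simps)
  then show ?thesis using assms(2) by (simp add: inner_add_left)
qed

text \<open>This is the maximality of the product operator: comparing each component with a witness whose
  duality product is nonpositive, and negative off the graph, makes the limit inequality an equality.\<close>

lemma maximally_monotone_family_demiclosed:
  fixes x a :: "'i \<Rightarrow> 'a::real_inner" and y b :: "'j \<Rightarrow> 'b::real_inner"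
  assumes fin: "finite I" "finite J" and F: "F \<noteq> bot"
    and A: "\<And>i. i \<in> I \<Longrightarrow> maximally_monotone_on (V i) (A i)"
    and B: "\<And>j. j \<in> J \<Longrightarrow> maximally_monotone_on (W j) (B j)"
    and V: "\<And>i. i \<in> I \<Longrightarrow> x i \<in> V i \<and> a i \<in> V i" and W: "\<And>j. j \<in> J \<Longrightarrow> y j \<in> W j \<and> b j \<in> W j"
    and graphA: "\<And>i k. i \<in> I \<Longrightarrow> a' i k \<in> A i (x' i k)"
    and graphB: "\<And>j k. j \<in> J \<Longrightarrow> b' j k \<in> B j (y' j k)"
    and limA: "\<And>i. i \<in> I \<Longrightarrow> weakly_tendsto (x' i) (x i) F \<and> weakly_tendsto (a' i) (a i) F"
    and limB: "\<And>j. j \<in> J \<Longrightarrow> weakly_tendsto (y' j) (y j) F \<and> weakly_tendsto (b' j) (b j) F"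
    and energy: "((\<lambda>k. (\<Sum>i\<in>I. (x' i k - x i) \<bullet> (a' i k - a i)) +
        (\<Sum>j\<in>J. (y' j k - y j) \<bullet> (b' j k - b j))) \<longlongrightarrow> 0) F"
  shows "\<And>i. i \<in> I \<Longrightarrow> a i \<in> A i (x i)" "\<And>j. j \<in> J \<Longrightarrow> b j \<in> B j (y j)"
proof -
  have "\<forall>i\<in>I. \<exists>p q. q \<in> A i p \<and> (x i - p) \<bullet> (a i - q) \<le> 0 \<and>
      (a i \<notin> A i (x i) \<longrightarrow> (x i - p) \<bullet> (a i - q) < 0)"
    using maximally_monotone_on_witness[OF A] V by metis
  then obtain p q where pq: "\<And>i. i \<in> I \<Longrightarrow> q i \<in> A i (p i)"
      "\<And>i. i \<in> I \<Longrightarrow> (x i - p i) \<bullet> (a i - q i) \<le> 0"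
      "\<And>i. i \<in> I \<Longrightarrow> a i \<notin> A i (x i) \<Longrightarrow> (x i - p i) \<bullet> (a i - q i) < 0"
    by metis
  have "\<forall>j\<in>J. \<exists>p q. q \<in> B j p \<and> (y j - p) \<bullet> (b j - q) \<le> 0 \<and>
      (b j \<notin> B j (y j) \<longrightarrow> (y j - p) \<bullet> (b j - q) < 0)"
    using maximally_monotone_on_witness[OF B] W by metis
  then obtain p' q' where pq': "\<And>j. j \<in> J \<Longrightarrow> q' j \<in> B j (p' j)"
      "\<And>j. j \<in> J \<Longrightarrow> (y j - p' j) \<bullet> (b j - q' j) \<le> 0"
      "\<And>j. j \<in> J \<Longrightarrow> b j \<notin> B j (y j) \<Longrightarrow> (y j - p' j) \<bullet> (b j - q' j) < 0"
    by metis
  define P where "P = (\<Sum>i\<in>I. (x i - p i) \<bullet> (a i - q i))"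
  define Q where "Q = (\<Sum>j\<in>J. (y j - p' j) \<bullet> (b j - q' j))"
  define f where "f k = (\<Sum>i\<in>I. (x' i k - p i) \<bullet> (a' i k - q i)) +
      (\<Sum>j\<in>J. (y' j k - p' j) \<bullet> (b' j k - q' j))" for k
  define g where "g k = (\<Sum>i\<in>I. (x' i k - x i) \<bullet> (a' i k - a i)) +
      (\<Sum>j\<in>J. (y' j k - y j) \<bullet> (b' j k - b j))" for k
  \<comment> \<open>Only the total \<open>g\<close> of the residual products is known to vanish, so
    the expansion is applied summand by summand and the residuals are removed afterwards in one go.
    Then \<open>f\<close>, nonnegative by monotonicity, tends to \<open>P + Q\<close>, while the
    witnesses make \<open>P\<close> and \<open>Q\<close> nonpositive.\<close>
  have "((\<lambda>k. (\<Sum>i\<in>I. (x' i k - p i) \<bullet> (a' i k - q i) - (x' i k - x i) \<bullet> (a' i k - a i)) +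
      (\<Sum>j\<in>J. (y' j k - p' j) \<bullet> (b' j k - q' j) - (y' j k - y j) \<bullet> (b' j k - b j))) \<longlongrightarrow> P + Q) F"
    unfolding P_def Q_def
    by (intro tendsto_add tendsto_sum weakly_tendsto_inner_expand) (use limA limB in auto)
  then have "((\<lambda>k. f k - g k) \<longlongrightarrow> P + Q) F"
    by (simp add: f_def g_def sum_subtractf add_diff_add)
  moreover have "(g \<longlongrightarrow> 0) F" using energy by (simp add: g_def[abs_def])
  ultimately have "((\<lambda>k. f k - g k + g k) \<longlongrightarrow> P + Q + 0) F" by (rule tendsto_add)
  then have lim: "(f \<longlongrightarrow> P + Q) F" by simp
  have "0 \<le> f k" for k
    unfolding f_def
    by (intro add_nonneg_nonneg sum_nonneg maximally_monotone_on_monotoneD[OF A graphA pq(1)]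
        maximally_monotone_on_monotoneD[OF B graphB pq'(1)])
  then have "0 \<le> P + Q" by (intro tendsto_lowerbound[OF lim _ F]) simp
  moreover have le: "P \<le> 0" "Q \<le> 0"
    unfolding P_def Q_def using pq(2) pq'(2) by (auto intro: sum_nonpos)
  ultimately have "P = 0" "Q = 0" by auto
  then have "\<forall>i\<in>I. (x i - p i) \<bullet> (a i - q i) = 0" "\<forall>j\<in>J. (y j - p' j) \<bullet> (b j - q' j) = 0"
    using sum_nonneg_eq_0_iff[OF fin(1), of "\<lambda>i. - ((x i - p i) \<bullet> (a i - q i))"] pq(2)
      sum_nonneg_eq_0_iff[OF fin(2), of "\<lambda>j. - ((y j - p' j) \<bullet> (b j - q' j))"] pq'(2)
    by (simp_all add: P_def Q_def sum_negf)
  then show "\<And>i. i \<in> I \<Longrightarrow> a i \<in> A i (x i)" "\<And>j. j \<in> J \<Longrightarrow> b j \<in> B j (y j)"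
    using pq(3) pq'(3) by force+
qed

lemma zero_in_plus_singleton: "0 \<in> X + {x} \<longleftrightarrow> - x \<in> X" for x :: "'b::ab_group_add"
proof -
  have "0 = a + x \<longleftrightarrow> - x = a" for a by (metis add.commute neg_eq_iff_add_eq_0)
  then show ?thesis by (auto simp: set_plus_def)
qed

lemma zero_in_dual_sum:
  fixes x y :: "'b::ab_group_add"
  shows "0 \<in> X + {x} + Y + {y} \<longleftrightarrow> (\<exists>d\<in>Y. - y - x - d \<in> X)"
proof -
  have eq: "- y = a + x + d \<longleftrightarrow> a = - y - x - d" for a d
    unfolding eq_diff_eq by (auto simp only: ac_simps)
  have "- y \<in> X + {x} + Y \<longleftrightarrow> (\<exists>a\<in>X. \<exists>d\<in>Y. - y = a + x + d)"
    unfolding set_plus_def by blast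
  then show ?thesis unfolding eq zero_in_plus_singleton by blast
qed

section \<open>The tree and the prediction map\<close>

locale tree_problem =
  fixes S :: "('h::{real_inner,complete_space}, 'k::{real_inner,complete_space}, 'more)
    tree_splitting_scheme"
  assumes problem: "problem_data S" and tree: "tree_data S" and metrics: "metric_data S"
begin

abbreviation "n \<equiv> n_of S"
abbreviation "m \<equiv> m_of S"
abbreviation "K \<equiv> Ksp S"
abbreviation "A \<equiv> opA S"
abbreviation "B \<equiv> opB S"
abbreviation "D \<equiv> opD S"
abbreviation "C \<equiv> opC S"
abbreviation "L \<equiv> opL S"
abbreviation "Ls j \<equiv> adjoint (opL S j)"
abbreviation "M \<equiv> metM S"
abbreviation "N \<equiv> metN S"
abbreviation "pa \<equiv> parent S"

lemma n_ge_2: "2 \<le> n"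
  using problem by (simp add: problem_data_def)

lemma A_maximal: "i < n \<Longrightarrow> maximally_monotone_on UNIV (A i)"
  using problem by (simp add: problem_data_def)

lemma
  assumes "j \<in> {1..m}"
  shows K_subspace: "subspace (K j)" and K_closed: "closed (K j)"
    and B_maximal: "maximally_monotone_on (K j) (B j)"
    and D_maximal: "maximally_monotone_on (K j) (D j)"
    and L_bounded_linear: "bounded_linear (L j)"
    and L_in_K: "L j x \<in> K j" and b_in_K: "vec_b S j \<in> K j"
proof -
  have "subspace (K j) \<and> closed (K j) \<and> maximally_monotone_on (K j) (B j) \<and>
      maximally_monotone_on (K j) (D j) \<and> bounded_linear (L j) \<and> range (L j) \<subseteq> K j \<and> vec_b S j \<in> K j"
    using problem assms by (simp add: problem_data_def del: One_nat_def)
  then show "subspace (K j)" "closed (K j)" "maximally_monotone_on (K j) (B j)"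
      "maximally_monotone_on (K j) (D j)" "bounded_linear (L j)" "L j x \<in> K j" "vec_b S j \<in> K j"
    by auto
qed

lemma beta_pos: "l \<in> {1..p_of S} \<Longrightarrow> 0 < beta S l"
  and C_cocoercive: "l \<in> {1..p_of S} \<Longrightarrow> cocoercive (beta S l) (C l)"
  using problem by (auto simp: problem_data_def)

text \<open>Replaces \<open>nu S j\<close> by a finite modulus \<open>r\<close> while a strict bound
  survives, so that the value infinity does not occur in the estimates.\<close>

lemma D_strongly_monotone:
  assumes j: "j \<in> {1..m}" and q: "real_of_ereal (1 / (2 * nu S j)) < q"
  obtains r where "0 < r" "strongly_monotone r (D j)" "1 / (2 * r) < q"
proof (cases "D j = normal_cone_on (K j) {0}")
  case True
  then have "nu S j = \<infinity>" using problem j by (simp add: problem_data_def)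
  then have "0 < q" using q by simp
  \<comment> \<open>The normal cone of \<open>{0}\<close> has a one-point domain and is strongly
    monotone with any modulus. With \<open>1 / q\<close> the quantity to be bounded becomes
    \<open>q / 2\<close>.\<close>
  moreover have "strongly_monotone (1 / q) (D j)"
    by (simp add: True strongly_monotone_def normal_cone_on_def)
  ultimately show ?thesis using that[of "1 / q"] by simp
next
  case False
  then obtain r where r: "0 < r" "nu S j = ereal r" "strongly_monotone r (D j)"
    using problem j unfolding problem_data_def by metis
  have "1 / (2 * nu S j) = ereal (1 / (2 * r))"
    using r(1) unfolding r(2) one_ereal_def numeral_eq_ereal times_ereal.simps ereal_divide by simp
  then show ?thesis using that[OF r(1,3)] q by simp
qed

lemma D_inverse_single_valued:
  assumes "j \<in> {1..m}" "s \<in> D j d" "s \<in> D j d'"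
  shows "d = d'"
proof -
  obtain r where r: "0 < r" "strongly_monotone r (D j)"
    using D_strongly_monotone[OF assms(1) less_add_one] by metis
  then have "r * (norm (d - d'))\<^sup>2 \<le> (d - d') \<bullet> (s - s)"
    using assms(2,3) unfolding strongly_monotone_def by blast
  then show ?thesis using r(1) by (simp add: mult_le_0_iff)
qed

lemma M_metric: "i \<in> {1..<n} \<Longrightarrow> metric_on UNIV (M i)"
  and N_metric: "j \<in> {1..m} \<Longrightarrow> metric_on (K j) (N j)"
  using metrics by (auto simp: metric_data_def)

lemma M_bounded_linear: "i \<in> {1..<n} \<Longrightarrow> bounded_linear (M i)"
  by (rule metric_on_UNIV_bounded_linear[OF M_metric])

section \<open>Induction on the tree, and sums over its edges and cells\<close>

lemma pa_less: "i \<in> {1..<n} \<Longrightarrow> pa i < n"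
  using tree by (auto simp: tree_data_def rooted_tree_def)

lemma iterated_parent: "i < n \<Longrightarrow> \<exists>k. (pa ^^ k) i = 0"
  using tree by (auto simp: tree_data_def rooted_tree_def)

text \<open>Node numbers need not increase along edges, so the induction runs on the number of
  parent steps that lead to the root.\<close>

lemma node_induct [consumes 1, case_names root child]:
  assumes "i < n" "P 0" "\<And>i. i \<in> {1..<n} \<Longrightarrow> P (pa i) \<Longrightarrow> P i"
  shows "P i"
proof -
  obtain k where "(pa ^^ k) i = 0" using iterated_parent[OF assms(1)] by blast
  then show ?thesis using assms(1)
  proof (induction k arbitrary: i)
    case 0
    then show ?case using assms(2) by simp
  next
    case (Suc k)
    show ?case
    \<comment> \<open>\<open>pa 0\<close> is arbitrary, so an iterate of \<open>pa\<close> may also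
      return from \<open>0\<close> to \<open>0\<close>; the root is therefore split off in the
      inductive step as well.\<close>
    proof (cases "i = 0")
      case False
      then have "i \<in> {1..<n}" using Suc.prems by auto
      moreover have "(pa ^^ k) (pa i) = 0" using Suc.prems(1) by (simp add: funpow_swap1)
      ultimately show ?thesis using Suc.IH pa_less assms(3) by blast
    qed (use assms(2) in simp)
  qed
qed

lemma nodes_eq: "{..<n} = insert 0 {1..<n}"
  using n_ge_2 by auto

lemma sum_nodes: "(\<Sum>i<n. f i) = f 0 + (\<Sum>i\<in>{1..<n}. f i)"
  unfolding nodes_eq by simp

lemma finite_ch [simp]: "finite (ch S i)"
  by (simp add: ch_def)

lemma ch_iff: "c \<in> ch S i \<longleftrightarrow> c \<in> {1..<n} \<and> pa c = i"
  by (simp add: ch_def)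

text \<open>The root inclusion has no metric of its own, only those of the children of
  \<open>0\<close>. One child is what makes it strongly monotone, which is used for uniqueness, for
  the resolvent and for boundedness of \<open>u\<close>.\<close>

lemma ch_root_nonempty: "ch S 0 \<noteq> {}"
proof
  assume empty: "ch S 0 = {}"
  have "i = 0" if "i < n" for i
    using that by (induction i rule: node_induct) (use empty in \<open>auto simp: ch_def\<close>)
  from this[of 1] n_ge_2 show False by simp
qed

text \<open>Every edge is identified with its lower end, and each non-root node is a child of
  exactly one node.\<close>

lemma sum_ch:
  fixes f :: "nat \<Rightarrow> nat \<Rightarrow> 'b::comm_monoid_add"
  shows "(\<Sum>i<n. \<Sum>c\<in>ch S i. f i c) = (\<Sum>c\<in>{1..<n}. f (pa c) c)"
proof -
  have "(\<Sum>i<n. \<Sum>c\<in>ch S i. f i c) = (\<Sum>i<n. \<Sum>c\<in>{c \<in> {1..<n}. pa c = i}. f (pa c) c)"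
    by (intro sum.cong refl) (auto simp: ch_def)
  also have "\<dots> = (\<Sum>c\<in>{1..<n}. f (pa c) c)"
    by (rule sum.group) (use pa_less in auto)
  finally show ?thesis .
qed

lemma cellJ_partition: "partition_family {..<n} (cellJ S) {1..m}"
  using tree by (simp add: tree_data_def)

lemma cellJ_subset: "i < n \<Longrightarrow> cellJ S i \<subseteq> {1..m}"
  using cellJ_partition by (auto simp: partition_family_def)

lemma cellJ_finite [simp]: "i < n \<Longrightarrow> finite (cellJ S i)"
  using cellJ_subset finite_subset by blast

text \<open>Inverts the partition \<open>cellJ\<close>: it turns double sums over nodes and their
  cells into single sums over the dual indices.\<close>

definition own :: "nat \<Rightarrow> nat" where
  "own j = (THE i. i < n \<and> j \<in> cellJ S i)"

lemma own_eq:
  assumes "i < n" "j \<in> cellJ S i" shows "own j = i"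
  unfolding own_def
proof (rule the_equality)
  fix i' assume "i' < n \<and> j \<in> cellJ S i'"
  then show "i' = i" using assms cellJ_partition
    by (auto simp: partition_family_def disjoint_family_on_def)
qed (use assms in simp)

lemma own_cell:
  assumes "j \<in> {1..m}" shows "own j < n" "j \<in> cellJ S (own j)"
proof -
  obtain i where "i < n" "j \<in> cellJ S i"
    using assms cellJ_partition unfolding partition_family_def by blast
  with own_eq show "own j < n" "j \<in> cellJ S (own j)" by auto
qed

lemma ball_cellJ: "(\<forall>i<n. \<forall>j\<in>cellJ S i. P i j) \<longleftrightarrow> (\<forall>j\<in>{1..m}. P (own j) j)"
proof
  show "\<forall>j\<in>{1..m}. P (own j) j" if "\<forall>i<n. \<forall>j\<in>cellJ S i. P i j"
    using that[rule_format, OF own_cell] by simp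
  show "\<forall>i<n. \<forall>j\<in>cellJ S i. P i j" if *: "\<forall>j\<in>{1..m}. P (own j) j"
  proof (intro allI impI ballI)
    fix i j assume ij: "i < n" "j \<in> cellJ S i"
    have "P (own j) j" by (rule *[rule_format, OF subsetD[OF cellJ_subset[OF ij(1)] ij(2)]])
    then show "P i j" by (simp only: own_eq[OF ij])
  qed
qed

lemma sum_cellJ: "(\<Sum>i<n. \<Sum>j\<in>cellJ S i. f i j) = (\<Sum>j\<in>{1..m}. f (own j) j)"
proof -
  have P: "(\<Union>i<n. cellJ S i) = {1..m}" "disjoint_family_on (cellJ S) {..<n}"
    using cellJ_partition unfolding partition_family_def by blast+
  have "(\<Sum>j\<in>cellJ S i. f i j) = (\<Sum>j\<in>cellJ S i. f (own j) j)" if "i \<in> {..<n}" for i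
    using that by (intro sum.cong refl) (simp add: own_eq)
  then have "(\<Sum>i<n. \<Sum>j\<in>cellJ S i. f i j) = (\<Sum>i<n. \<Sum>j\<in>cellJ S i. f (own j) j)"
    by (rule sum.cong[OF refl])
  also have "\<dots> = (\<Sum>j\<in>(\<Union>i<n. cellJ S i). f (own j) j)"
    by (rule sum.UNION_disjoint_family[symmetric, OF finite_lessThan _ P(2)]) simp
  finally show ?thesis unfolding P(1) .
qed

lemma cellJc_partition:
  "i < n \<Longrightarrow> ch S i \<noteq> {} \<Longrightarrow> partition_family (ch S i) (cellJc S) (cellJ S i)"
  using tree by (simp add: tree_data_def)

lemma cellJc_subset: "c \<in> {1..<n} \<Longrightarrow> cellJc S c \<subseteq> cellJ S (pa c)"
  using cellJc_partition[OF pa_less, of c] unfolding partition_family_def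
  by (metis UN_upper ch_iff empty_iff)

lemma cellJc_subset': "c \<in> {1..<n} \<Longrightarrow> cellJc S c \<subseteq> {1..m}"
  using cellJc_subset cellJ_subset pa_less by blast

lemma cellJc_finite [simp]: "c \<in> {1..<n} \<Longrightarrow> finite (cellJc S c)"
  using cellJc_subset' finite_subset by blast

text \<open>The owner of a dual index hands it to exactly one of its children. A leaf has no child
  to hand anything to; there the emptiness of its cell enters.\<close>

lemma sum_cellJc:
  "(\<Sum>c\<in>{1..<n}. \<Sum>j\<in>cellJc S c. f (pa c) j) = (\<Sum>j\<in>{1..m}. f (own j) j)"
proof -
  have "(\<Sum>j\<in>cellJ S i. f i j) = (\<Sum>c\<in>ch S i. \<Sum>j\<in>cellJc S c. f i j)" if i: "i < n" for i
  proof (cases "ch S i = {}")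
    case True
    then have "cellJ S i = {}" using tree i by (simp add: tree_data_def)
    with True show ?thesis by simp
  next
    case False
    then have P: "(\<Union>c\<in>ch S i. cellJc S c) = cellJ S i" "disjoint_family_on (cellJc S) (ch S i)"
      using cellJc_partition[OF i] by (auto simp: partition_family_def)
    show ?thesis unfolding P(1)[symmetric]
      by (rule sum.UNION_disjoint_family) (use P(2) in \<open>auto simp: ch_iff\<close>)
  qed
  then have "(\<Sum>i<n. \<Sum>j\<in>cellJ S i. f i j) = (\<Sum>i<n. \<Sum>c\<in>ch S i. \<Sum>j\<in>cellJc S c. f i j)"
    by simp
  also have "\<dots> = (\<Sum>c\<in>{1..<n}. \<Sum>j\<in>cellJc S c. f (pa c) j)" by (rule sum_ch)
  finally show ?thesis by (simp only: sum_cellJ)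
qed

lemma cellP_subset: "i < n \<Longrightarrow> cellP S i \<subseteq> {1..p_of S}"
  using tree by (auto simp: tree_data_def partition_family_def)

lemma cellP_finite [simp]: "i < n \<Longrightarrow> finite (cellP S i)"
  using cellP_subset finite_subset by blast

lemma sum_cellP: "(\<Sum>i\<in>{1..<n}. \<Sum>l\<in>cellP S i. f l) = (\<Sum>l\<in>{1..p_of S}. f l)"
proof -
  have P: "(\<Union>i<n. cellP S i) = {1..p_of S}" "disjoint_family_on (cellP S) {..<n}" "cellP S 0 = {}"
    using tree by (auto simp: tree_data_def partition_family_def)
  have "(\<Sum>l\<in>(\<Union>i<n. cellP S i). f l) = (\<Sum>i<n. \<Sum>l\<in>cellP S i. f l)"
    by (rule sum.UNION_disjoint_family) (use P(2) in auto)
  then show ?thesis using P by (simp add: sum_nodes)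
qed

text \<open>The prediction step asks that \<open>selA i \<in> A i (u i)\<close> and \<open>t j \<in> B j (selB j)\<close>, with
  \<open>d j \<in> (D j)\<^sup>-\<^sup>1 (s j)\<close>.\<close>

definition selA :: "(nat \<Rightarrow> 'h) \<Rightarrow> (nat \<Rightarrow> 'k) \<Rightarrow> (nat \<Rightarrow> 'h) \<Rightarrow> (nat \<Rightarrow> 'k) \<Rightarrow> nat \<Rightarrow> 'h" where
  "selA z s u t i =
     (if i = 0 then vec_a S
      else - (M i (u i + z i - 2 *\<^sub>R u (pa i)) + (\<Sum>l\<in>cellP S i. C l (u (pa i))) +
              (\<Sum>j\<in>cellJc S i. Ls j (t j - s j)))) -
     (\<Sum>c\<in>ch S i. M c (u i - z c)) - (\<Sum>j\<in>cellJ S i. Ls j (s j))"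

definition selB :: "(nat \<Rightarrow> 'k) \<Rightarrow> (nat \<Rightarrow> 'h) \<Rightarrow> (nat \<Rightarrow> 'k) \<Rightarrow> (nat \<Rightarrow> 'k) \<Rightarrow> nat \<Rightarrow> 'k" where
  "selB s u t d j = L j (u (own j)) - vec_b S j - N j (t j - s j) - d j"

text \<open>Solving each inclusion for an element of a graph puts the step into a form to which
  monotonicity applies directly; the selections in the inverses of \<open>D j\<close> are merged
  into one function \<open>d\<close> by choice.\<close>

lemma prediction_iff:
  "prediction S (z, s) u (zt, st) \<longleftrightarrow>
     (zt, st) \<in> state_space S \<and> (\<forall>i<n. selA z s u st i \<in> A i (u i)) \<and>
     (\<exists>d. \<forall>j\<in>{1..m}. s j \<in> D j (d j) \<and> st j \<in> B j (selB s u st d j)) \<and>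
     (\<forall>i\<in>{1..<n}. zt i = z i + u i - u (pa i))"
proof -
  have A0: "(\<forall>i<n. selA z s u st i \<in> A i (u i)) \<longleftrightarrow>
      selA z s u st 0 \<in> A 0 (u 0) \<and> (\<forall>i\<in>{1..<n}. selA z s u st i \<in> A i (u i))"
    using nodes_eq by (metis insert_iff lessThan_iff)
  have sel0: "selA z s u st 0 = - ((\<Sum>c\<in>ch S 0. metM S c (u 0 - z c)) +
      (\<Sum>j\<in>cellJ S 0. Ls j (s j)) - vec_a S)"
    by (simp add: selA_def)
  have seli: "selA z s u st i = - (M i (u i + z i - 2 *\<^sub>R u (pa i)) + (\<Sum>c\<in>ch S i. M c (u i - z c)) +
      (\<Sum>l\<in>cellP S i. C l (u (pa i))) + (\<Sum>j\<in>cellJ S i. Ls j (s j)) +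
      (\<Sum>j\<in>cellJc S i. Ls j (st j - s j)))" if "i \<in> {1..<n}" for i
    using that by (simp add: selA_def algebra_simps)
  have Ai: "(\<forall>i\<in>{1..<n}. selA z s u st i \<in> A i (u i)) \<longleftrightarrow>
      (\<forall>i\<in>{1..<n}. - (M i (u i + z i - 2 *\<^sub>R u (pa i)) + (\<Sum>c\<in>ch S i. M c (u i - z c)) +
      (\<Sum>l\<in>cellP S i. C l (u (pa i))) + (\<Sum>j\<in>cellJ S i. Ls j (s j)) +
      (\<Sum>j\<in>cellJc S i. Ls j (st j - s j))) \<in> A i (u i))"
    by (intro ball_cong refl) (simp only: seli)
  have dual: "(\<exists>d\<in>inverse_operator (D j) (s j).
      - (- L j (u (own j)) + vec_b S j) - N j (st j - s j) - d \<in> inverse_operator (B j) (st j)) \<longleftrightarrow>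
      (\<exists>d. s j \<in> D j d \<and> st j \<in> B j (selB s u st (\<lambda>_. d) j))" for j
    by (auto simp: inverse_operator_def selB_def)
  have choice: "(\<forall>j\<in>{1..m}. \<exists>d. s j \<in> D j d \<and> st j \<in> B j (selB s u st (\<lambda>_. d) j)) \<longleftrightarrow>
      (\<exists>d. \<forall>j\<in>{1..m}. s j \<in> D j (d j) \<and> st j \<in> B j (selB s u st d j))"
    unfolding bchoice_iff by (simp add: selB_def)
  show ?thesis
    unfolding prediction.simps zero_in_dual_sum unfolding zero_in_plus_singleton ball_cellJ
      dual choice A0 sel0 Ai
    by blast
qed

text \<open>From the root downwards everything entering the inclusion at a node except its own
  \<open>u i\<close> is already determined. The difference of two solutions is then annihilated by
  monotonicity together with a positive definite metric: \<open>M i\<close> at a node, a child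
  metric at the root.\<close>

lemma prediction_unique:
  assumes "prediction S x u xt" "prediction S x u' xt'"
  shows "xt = xt'" "\<And>i. i < n \<Longrightarrow> u i = u' i"
proof -
  obtain z s zt st zt' st' where x: "x = (z, s)" "xt = (zt, st)" "xt' = (zt', st')"
    by (metis surj_pair)
  obtain d d' where
      p: "(zt, st) \<in> state_space S" "\<And>i. i < n \<Longrightarrow> selA z s u st i \<in> A i (u i)"
        "\<And>j. j \<in> {1..m} \<Longrightarrow> s j \<in> D j (d j)" "\<And>j. j \<in> {1..m} \<Longrightarrow> st j \<in> B j (selB s u st d j)"
        "\<And>i. i \<in> {1..<n} \<Longrightarrow> zt i = z i + u i - u (pa i)"
    and p': "(zt', st') \<in> state_space S" "\<And>i. i < n \<Longrightarrow> selA z s u' st' i \<in> A i (u' i)"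
        "\<And>j. j \<in> {1..m} \<Longrightarrow> s j \<in> D j (d' j)" "\<And>j. j \<in> {1..m} \<Longrightarrow> st' j \<in> B j (selB s u' st' d' j)"
        "\<And>i. i \<in> {1..<n} \<Longrightarrow> zt' i = z i + u' i - u' (pa i)"
    using assms unfolding x prediction_iff by blast
  have M_diff: "M i (v - w) = M i v - M i w" if "i \<in> {1..<n}" for i v w
    using bounded_linear.linear[OF M_bounded_linear[OF that]] by (rule linear_diff)
  have mono: "0 \<le> (u i - u' i) \<bullet> (selA z s u st i - selA z s u' st' i)" if "i < n" for i
    using maximally_monotone_on_monotoneD[OF A_maximal] p(2) p'(2) that by blast
  have chM: "(\<Sum>c\<in>ch S i. M c (u i - z c)) - (\<Sum>c\<in>ch S i. M c (u' i - z c)) =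
      (\<Sum>c\<in>ch S i. M c (u i - u' i))" for i
    unfolding sum_subtractf[symmetric] by (intro sum.cong refl) (simp add: ch_iff M_diff)
  have nonneg: "0 \<le> M c v \<bullet> v" if "c \<in> {1..<n}" for c v
    using metric_on_nonneg[OF M_metric[OF that]] by simp
  \<comment> \<open>The dual values of the cell at \<open>i\<close> depend on \<open>u\<close>
    through \<open>u i\<close> only, so they are fixed as soon as \<open>u i\<close> is.\<close>
  have st_eq: "st j = st' j" if j: "j \<in> cellJ S i" and i: "i < n" and u: "u i = u' i" for i j
  proof -
    have jm: "j \<in> {1..m}" using j i cellJ_subset by blast
    have stK: "st j \<in> K j" "st' j \<in> K j" "s j \<in> K j"
      using p(3,4)[OF jm] p'(4)[OF jm] B_maximal[OF jm] D_maximal[OF jm]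
        maximally_monotone_on_carrierD(2) by blast+
    note sub = subspace_diff[OF K_subspace[OF jm]]
    have "d j = d' j" using D_inverse_single_valued[OF jm p(3)[OF jm] p'(3)[OF jm]] .
    moreover have "own j = i" using own_eq[OF i j] .
    ultimately have "selB s u st d j - selB s u' st' d' j = N j (st' j - s j) - N j (st j - s j)"
      using u by (simp add: selB_def)
    also have "\<dots> = - N j (st j - st' j)"
      by (simp add: metric_on_diff[OF N_metric[OF jm] K_subspace[OF jm]] stK)
    finally have "N j (st j - st' j) \<bullet> (st j - st' j) \<le> 0"
      using maximally_monotone_on_monotoneD[OF B_maximal[OF jm] p(4)[OF jm] p'(4)[OF jm]] by simp
    then have "st j - st' j = 0" by (rule metric_on_eq_0[OF N_metric[OF jm] sub[OF stK(1,2)]])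
    then show ?thesis by simp
  qed
  have u_eq: "u i = u' i" if "i < n" for i
    using that
  proof (induction i rule: node_induct)
    case root
    have n: "0 < n" using n_ge_2 by simp
    have "selA z s u st 0 - selA z s u' st' 0 = - (\<Sum>c\<in>ch S 0. M c (u 0 - u' 0))"
      unfolding chM[symmetric] by (simp add: selA_def)
    then have le: "(\<Sum>c\<in>ch S 0. M c (u 0 - u' 0) \<bullet> (u 0 - u' 0)) \<le> 0"
      using mono[OF n] by (simp add: inner_sum_left inner_sum_right inner_commute)
    obtain c where c: "c \<in> ch S 0" using ch_root_nonempty by blast
    have "M c (u 0 - u' 0) \<bullet> (u 0 - u' 0) \<le> (\<Sum>c\<in>ch S 0. M c (u 0 - u' 0) \<bullet> (u 0 - u' 0))"
      using c by (intro member_le_sum nonneg) (auto simp: ch_iff)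
    then have "M c (u 0 - u' 0) \<bullet> (u 0 - u' 0) \<le> 0" using le by linarith
    then have "u 0 - u' 0 = 0" using metric_on_eq_0[OF M_metric UNIV_I] c ch_iff by blast
    then show ?case by simp
  next
    case (child i)
    have i: "i < n" using child by simp
    \<comment> \<open>The corrections at a child use dual indices of its parent's cell only, and
      these were fixed together with the parent.\<close>
    have "(\<Sum>j\<in>cellJc S i. Ls j (st j - s j)) = (\<Sum>j\<in>cellJc S i. Ls j (st' j - s j))"
      using cellJc_subset[OF child(1)] st_eq[OF _ pa_less[OF child(1)] child(2)]
      by (intro sum.cong) auto
    then have "selA z s u st i - selA z s u' st' i =
        - M i (u i - u' i) - (\<Sum>c\<in>ch S i. M c (u i - u' i))"
      unfolding chM[symmetric] using child M_diff[OF child(1), of "u i + z i - 2 *\<^sub>R u' (pa i)"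
        "u' i + z i - 2 *\<^sub>R u' (pa i)"]
      by (simp add: selA_def)
    then have "M i (u i - u' i) \<bullet> (u i - u' i) + (\<Sum>c\<in>ch S i. M c (u i - u' i) \<bullet> (u i - u' i)) \<le> 0"
      using mono[OF i] by (simp add: inner_sum_left inner_sum_right inner_commute inner_diff_right)
    moreover have "0 \<le> (\<Sum>c\<in>ch S i. M c (u i - u' i) \<bullet> (u i - u' i))"
      by (intro sum_nonneg nonneg) (simp add: ch_iff)
    ultimately have "M i (u i - u' i) \<bullet> (u i - u' i) \<le> 0" by linarith
    then have "u i - u' i = 0" by (rule metric_on_eq_0[OF M_metric[OF child(1)] UNIV_I])
    then show ?case by simp
  qed
  then show "\<And>i. i < n \<Longrightarrow> u i = u' i" .
  have "st = st'"
  proof (rule PiE_ext)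
    show "st \<in> (\<Pi>\<^sub>E j\<in>{1..m}. K j)" "st' \<in> (\<Pi>\<^sub>E j\<in>{1..m}. K j)"
      using p(1) p'(1) by (auto simp: state_space_def)
    show "st j = st' j" if "j \<in> {1..m}" for j
      using st_eq[OF own_cell(2)[OF that] own_cell(1)[OF that] u_eq[OF own_cell(1)[OF that]]] .
  qed
  moreover have "zt = zt'"
  proof (rule PiE_ext)
    show "zt \<in> {1..<n} \<rightarrow>\<^sub>E UNIV" "zt' \<in> {1..<n} \<rightarrow>\<^sub>E UNIV"
      using p(1) p'(1) by (auto simp: state_space_def)
    show "zt i = zt' i" if "i \<in> {1..<n}" for i
      using p(5)[OF that] p'(5)[OF that] u_eq[OF pa_less[OF that]] u_eq[of i] that by simp
  qed
  ultimately show "xt = xt'" by (simp add: x)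
qed

lemma T_zs_eq: "prediction S x u xt \<Longrightarrow> T_zs S x = xt"
  unfolding T_zs_def using prediction_unique(1) by blast

section \<open>The energy balance\<close>

text \<open>The cross terms in \<open>z\<close> telescope along the edges of the tree, and those in \<open>s\<close>
  cancel up to \<open>w j \<bullet> L j (U i - U (pa i))\<close>.\<close>

lemma energy_identity:
  fixes U Z a :: "nat \<Rightarrow> 'h" and Y w b \<eta> v :: "nat \<Rightarrow> 'k" and g :: "nat \<Rightarrow> nat \<Rightarrow> 'h"
  assumes a: "\<And>i. i < n \<Longrightarrow> a i =
      (if i = 0 then 0
       else - (M i (U i + Z i - 2 *\<^sub>R U (pa i)) + (\<Sum>l\<in>cellP S i. g i l) +
               (\<Sum>j\<in>cellJc S i. Ls j (w j)))) -
      (\<Sum>c\<in>ch S i. M c (U i - Z c)) - (\<Sum>j\<in>cellJ S i. Ls j (Y j))"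
    and b: "\<And>j. j \<in> {1..m} \<Longrightarrow> b j = L j (U (own j)) - v j - \<eta> j"
  shows "(\<Sum>i<n. U i \<bullet> a i) + (\<Sum>j\<in>{1..m}. (Y j + w j) \<bullet> b j) =
    - (\<Sum>i\<in>{1..<n}. M i (U i - U (pa i)) \<bullet> (U i - U (pa i)) + M i (Z i) \<bullet> (U i - U (pa i)) +
        (\<Sum>l\<in>cellP S i. U i \<bullet> g i l) + (\<Sum>j\<in>cellJc S i. w j \<bullet> L j (U i - U (pa i))))
    - (\<Sum>j\<in>{1..m}. w j \<bullet> v j + Y j \<bullet> v j + (Y j + w j) \<bullet> \<eta> j)"
proof -
  define T where "T i = U i \<bullet> M i (U i + Z i - 2 *\<^sub>R U (pa i)) + (\<Sum>l\<in>cellP S i. U i \<bullet> g i l) +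
      (\<Sum>j\<in>cellJc S i. w j \<bullet> L j (U i))" for i
  have adj: "x \<bullet> Ls j y = y \<bullet> L j x" if "j \<in> {1..m}" for j x y
    using adjoint_hilbert[OF L_bounded_linear[OF that]] by (simp add: inner_commute)
  have L_diff: "L j (x - y) = L j x - L j y" if "j \<in> {1..m}" for j x y
    using bounded_linear.linear[OF L_bounded_linear[OF that]] by (rule linear_diff)
  have eq1: "U i \<bullet> a i = (if i = 0 then 0 else - T i) - (\<Sum>c\<in>ch S i. U i \<bullet> M c (U i - Z c)) -
      (\<Sum>j\<in>cellJ S i. Y j \<bullet> L j (U i))" if i: "i < n" for i
  proof -
    have "(\<Sum>j\<in>cellJ S i. U i \<bullet> Ls j (Y j)) = (\<Sum>j\<in>cellJ S i. Y j \<bullet> L j (U i))"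
      using cellJ_subset[OF i] by (intro sum.cong refl adj) auto
    moreover have "(\<Sum>j\<in>cellJc S i. U i \<bullet> Ls j (w j)) = (\<Sum>j\<in>cellJc S i. w j \<bullet> L j (U i))" if "i \<noteq> 0"
      using cellJc_subset'[of i] i that by (intro sum.cong refl adj) auto
    ultimately show ?thesis unfolding a[OF i] T_def
      by (simp add: inner_diff_right inner_sum_right inner_add_right)
  qed
  have "(\<Sum>i<n. U i \<bullet> a i) = (\<Sum>i<n. if i = 0 then 0 else - T i) -
      (\<Sum>i<n. \<Sum>c\<in>ch S i. U i \<bullet> M c (U i - Z c)) - (\<Sum>i<n. \<Sum>j\<in>cellJ S i. Y j \<bullet> L j (U i))"
    using eq1 by (simp add: sum_subtractf)
  also have "(\<Sum>i<n. if i = 0 then 0 else - T i) = - (\<Sum>i\<in>{1..<n}. T i)"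
    by (simp add: sum_nodes sum_negf)
  also have "(\<Sum>i<n. \<Sum>c\<in>ch S i. U i \<bullet> M c (U i - Z c)) =
      (\<Sum>c\<in>{1..<n}. U (pa c) \<bullet> M c (U (pa c) - Z c))"
    by (rule sum_ch)
  also have "(\<Sum>i<n. \<Sum>j\<in>cellJ S i. Y j \<bullet> L j (U i)) = (\<Sum>j\<in>{1..m}. Y j \<bullet> L j (U (own j)))"
    by (rule sum_cellJ)
  finally have Ua: "(\<Sum>i<n. U i \<bullet> a i) =
      - (\<Sum>i\<in>{1..<n}. T i + U (pa i) \<bullet> M i (U (pa i) - Z i)) - (\<Sum>j\<in>{1..m}. Y j \<bullet> L j (U (own j)))"
    by (simp add: sum.distrib)
  have "(\<Sum>j\<in>{1..m}. (Y j + w j) \<bullet> b j) = (\<Sum>j\<in>{1..m}. Y j \<bullet> L j (U (own j))) +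
      (\<Sum>j\<in>{1..m}. w j \<bullet> L j (U (own j))) - (\<Sum>j\<in>{1..m}. w j \<bullet> v j + Y j \<bullet> v j + (Y j + w j) \<bullet> \<eta> j)"
    unfolding sum.distrib[symmetric] sum_subtractf[symmetric]
    by (intro sum.cong refl) (simp add: b inner_add_left inner_diff_right)
  \<comment> \<open>The dual step at the owner is charged to the edge towards the child that carries
    \<open>j\<close>. Together with the correction term of that child it forms
    \<open>L j (U i - U (pa i))\<close>.\<close>
  also have "(\<Sum>j\<in>{1..m}. w j \<bullet> L j (U (own j))) =
      (\<Sum>i\<in>{1..<n}. \<Sum>j\<in>cellJc S i. w j \<bullet> L j (U (pa i)))"
    by (rule sum_cellJc[symmetric])
  finally have "(\<Sum>i<n. U i \<bullet> a i) + (\<Sum>j\<in>{1..m}. (Y j + w j) \<bullet> b j) =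
      - (\<Sum>i\<in>{1..<n}. T i + U (pa i) \<bullet> M i (U (pa i) - Z i) -
            (\<Sum>j\<in>cellJc S i. w j \<bullet> L j (U (pa i))))
      - (\<Sum>j\<in>{1..m}. w j \<bullet> v j + Y j \<bullet> v j + (Y j + w j) \<bullet> \<eta> j)"
    unfolding Ua by (simp add: sum_subtractf)
  \<comment> \<open>Both ends of the edge above \<open>i\<close> contribute a term with
    \<open>M i\<close>. The doubled parent value in the node inclusion supplies exactly the mixed
    term that completes the square of \<open>U i - U (pa i)\<close>.\<close>
  also have "(\<Sum>i\<in>{1..<n}. T i + U (pa i) \<bullet> M i (U (pa i) - Z i) -
        (\<Sum>j\<in>cellJc S i. w j \<bullet> L j (U (pa i)))) =
      (\<Sum>i\<in>{1..<n}. M i (U i - U (pa i)) \<bullet> (U i - U (pa i)) + M i (Z i) \<bullet> (U i - U (pa i)) +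
        (\<Sum>l\<in>cellP S i. U i \<bullet> g i l) + (\<Sum>j\<in>cellJc S i. w j \<bullet> L j (U i - U (pa i))))"
  proof (rule sum.cong[OF refl])
    fix i assume i: "i \<in> {1..<n}"
    interpret Mi: bounded_linear "M i" by (rule M_bounded_linear[OF i])
    have sa: "x \<bullet> M i y = y \<bullet> M i x" for x y
      using metric_on_selfadjoint[OF M_metric[OF i]] by (simp add: inner_commute)
    have "(\<Sum>j\<in>cellJc S i. w j \<bullet> L j (U i - U (pa i))) =
        (\<Sum>j\<in>cellJc S i. w j \<bullet> L j (U i)) - (\<Sum>j\<in>cellJc S i. w j \<bullet> L j (U (pa i)))"
      unfolding sum_subtractf[symmetric] using cellJc_subset'[OF i]
      by (intro sum.cong refl) (auto simp: L_diff inner_diff_right subset_iff)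
    then show "T i + U (pa i) \<bullet> M i (U (pa i) - Z i) - (\<Sum>j\<in>cellJc S i. w j \<bullet> L j (U (pa i))) =
      M i (U i - U (pa i)) \<bullet> (U i - U (pa i)) + M i (Z i) \<bullet> (U i - U (pa i)) +
        (\<Sum>l\<in>cellP S i. U i \<bullet> g i l) + (\<Sum>j\<in>cellJc S i. w j \<bullet> L j (U i - U (pa i)))"
      using sa[of "U i" "U (pa i)"] sa[of "U i" "Z i"] sa[of "U (pa i)" "Z i"]
      by (simp add: T_def Mi.add Mi.diff Mi.scaleR inner_add_left inner_add_right inner_diff_left
          inner_diff_right inner_commute)
  qed
  finally show ?thesis .
qed

text \<open>A fixed point of the prediction step, at which all \<open>u i\<close> coincide. The
  common point \<open>v\<close> and the selections \<open>d\<close> are parameters because the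
  descent estimate refers to both.\<close>

definition equilibrium :: "(nat \<Rightarrow> 'h) \<Rightarrow> (nat \<Rightarrow> 'k) \<Rightarrow> 'h \<Rightarrow> (nat \<Rightarrow> 'k) \<Rightarrow> bool" where
  "equilibrium z s v d \<longleftrightarrow> (z, s) \<in> state_space S \<and>
     (\<forall>i<n. selA z s (\<lambda>_. v) s i \<in> A i v) \<and>
     (\<forall>j\<in>{1..m}. s j \<in> D j (d j) \<and> s j \<in> B j (selB s (\<lambda>_. v) s d j))"

lemma equilibrium_prediction: "equilibrium z s v d \<Longrightarrow> prediction S (z, s) (\<lambda>_. v) (z, s)"
  unfolding equilibrium_def prediction_iff by auto

lemma Ls_0: "j \<in> {1..m} \<Longrightarrow> Ls j 0 = 0"
  using linear_0[OF linear_adjoint_hilbert[OF L_bounded_linear]] .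

text \<open>Subtracting an equilibrium removes \<open>vec_a\<close> and the doubled
  \<open>v\<close>, leaving only displacements and differences of \<open>C l\<close>, as
  \<open>energy_identity\<close> expects.\<close>

lemma selA_diff:
  assumes i: "i < n"
  shows "selA z s u t i - selA z' s' (\<lambda>_. v) s' i =
    (if i = 0 then 0
     else - (M i ((u i - v) + (z i - z' i) - 2 *\<^sub>R (u (pa i) - v)) +
             (\<Sum>l\<in>cellP S i. C l (u (pa i)) - C l v) + (\<Sum>j\<in>cellJc S i. Ls j (t j - s j)))) -
    (\<Sum>c\<in>ch S i. M c ((u i - v) - (z c - z' c))) - (\<Sum>j\<in>cellJ S i. Ls j (s j - s' j))"
proof -
  have M_diff: "M c (x - y) = M c x - M c y" if "c \<in> {1..<n}" for c x y
    using bounded_linear.linear[OF M_bounded_linear[OF that]] by (rule linear_diff)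
  have "(\<Sum>c\<in>ch S i. M c ((u i - v) - (z c - z' c))) =
      (\<Sum>c\<in>ch S i. M c (u i - z c)) - (\<Sum>c\<in>ch S i. M c (v - z' c))"
    unfolding sum_subtractf[symmetric] by (intro sum.cong refl) (simp add: ch_iff M_diff)
  moreover have "(\<Sum>j\<in>cellJ S i. Ls j (s j - s' j)) =
      (\<Sum>j\<in>cellJ S i. Ls j (s j)) - (\<Sum>j\<in>cellJ S i. Ls j (s' j))"
    unfolding sum_subtractf[symmetric] using cellJ_subset[OF i]
    by (intro sum.cong refl linear_diff linear_adjoint_hilbert L_bounded_linear) auto
  moreover have "M i ((u i - v) + (z i - z' i) - 2 *\<^sub>R (u (pa i) - v)) =
      M i (u i + z i - 2 *\<^sub>R u (pa i)) - M i (v + z' i - 2 *\<^sub>R v)" if "i \<noteq> 0"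
    using i that by (subst M_diff[symmetric]) (auto simp: algebra_simps)
  moreover have "(\<Sum>j\<in>cellJc S i. Ls j (s' j - s' j)) = 0" if "i \<noteq> 0"
    using i that cellJc_subset'[of i] by (intro sum.neutral) (auto simp: Ls_0 subset_iff)
  ultimately show ?thesis by (simp add: selA_def sum_subtractf)
qed

lemma selB_diff:
  assumes j: "j \<in> {1..m}"
  shows "selB s u t d j - selB s' (\<lambda>_. v) s' d' j =
    L j (u (own j) - v) - N j (t j - s j) - (d j - d' j)"
  using metric_on_0[OF N_metric[OF j] K_subspace[OF j]]
    linear_diff[OF bounded_linear.linear[OF L_bounded_linear[OF j]]]
  by (simp add: selB_def)

lemma energy_balance:
  fixes z z' u :: "nat \<Rightarrow> 'h" and s s' t d d' :: "nat \<Rightarrow> 'k" and v :: 'h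
  defines "e \<equiv> \<lambda>i. u i - u (pa i)" and "w \<equiv> \<lambda>j. t j - s j"
  shows "(\<Sum>i<n. (u i - v) \<bullet> (selA z s u t i - selA z' s' (\<lambda>_. v) s' i)) +
     (\<Sum>j\<in>{1..m}. (t j - s' j) \<bullet> (selB s u t d j - selB s' (\<lambda>_. v) s' d' j)) =
    - (\<Sum>i\<in>{1..<n}. M i (e i) \<bullet> e i + M i (z i - z' i) \<bullet> e i +
        (\<Sum>l\<in>cellP S i. (u i - v) \<bullet> (C l (u (pa i)) - C l v)) + (\<Sum>j\<in>cellJc S i. w j \<bullet> L j (e i)))
    - (\<Sum>j\<in>{1..m}. w j \<bullet> N j (w j) + (s j - s' j) \<bullet> N j (w j) + (t j - s' j) \<bullet> (d j - d' j))"
proof -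
  have eq: "(u i - v) - (u (pa i) - v) = e i" "(s j - s' j) + w j = t j - s' j" for i j
    by (simp_all add: e_def w_def)
  note id = energy_identity[where U = "\<lambda>i. u i - v" and Z = "\<lambda>i. z i - z' i" and
      a = "\<lambda>i. selA z s u t i - selA z' s' (\<lambda>_. v) s' i" and
      b = "\<lambda>j. selB s u t d j - selB s' (\<lambda>_. v) s' d' j" and
      Y = "\<lambda>j. s j - s' j" and w = w and v = "\<lambda>j. N j (w j)" and \<eta> = "\<lambda>j. d j - d' j" and
      g = "\<lambda>i l. C l (u (pa i)) - C l v", unfolded eq]
  show ?thesis
    by (rule id) (simp_all add: selA_diff selB_diff w_def)
qed

section \<open>Equilibria and solutions\<close>

text \<open>Each term \<open>M c (v - z c)\<close> occurs once at \<open>c\<close> and once, with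
  the opposite sign, at its parent. The flow \<open>z\<close> thus cancels in the sum, and what is
  left is the inclusion (P).\<close>

lemma sum_selA_equilibrium:
  "(\<Sum>i<n. selA z s (\<lambda>_. v) s i) =
    vec_a S - (\<Sum>l\<in>{1..p_of S}. C l v) - (\<Sum>j\<in>{1..m}. Ls j (s j))"
proof -
  have "selA z s (\<lambda>_. v) s i = (if i = 0 then vec_a S else M i (v - z i) - (\<Sum>l\<in>cellP S i. C l v)) -
      (\<Sum>c\<in>ch S i. M c (v - z c)) - (\<Sum>j\<in>cellJ S i. Ls j (s j))" if i: "i < n" for i
  proof -
    have "M i (v + z i - 2 *\<^sub>R v) = - M i (v - z i)" if "i \<noteq> 0"
      using i that linear_neg[OF bounded_linear.linear[OF M_bounded_linear], of i "v - z i"]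
      by (simp add: scaleR_2)
    moreover have "(\<Sum>j\<in>cellJc S i. Ls j (s j - s j)) = 0" if "i \<noteq> 0"
      using i that cellJc_subset'[of i] by (intro sum.neutral) (auto simp: Ls_0 subset_iff)
    ultimately show ?thesis by (simp add: selA_def)
  qed
  then have "(\<Sum>i<n. selA z s (\<lambda>_. v) s i) =
      (\<Sum>i<n. if i = 0 then vec_a S else M i (v - z i) - (\<Sum>l\<in>cellP S i. C l v)) -
      (\<Sum>i<n. \<Sum>c\<in>ch S i. M c (v - z c)) - (\<Sum>i<n. \<Sum>j\<in>cellJ S i. Ls j (s j))"
    by (simp add: sum_subtractf)
  also have "(\<Sum>i<n. if i = 0 then vec_a S else M i (v - z i) - (\<Sum>l\<in>cellP S i. C l v)) =
      vec_a S + (\<Sum>i\<in>{1..<n}. M i (v - z i)) - (\<Sum>l\<in>{1..p_of S}. C l v)"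
    unfolding sum_cellP[symmetric] by (simp add: sum_nodes sum_subtractf)
  also have "(\<Sum>i<n. \<Sum>c\<in>ch S i. M c (v - z c)) = (\<Sum>i\<in>{1..<n}. M i (v - z i))"
    by (rule sum_ch)
  also have "(\<Sum>i<n. \<Sum>j\<in>cellJ S i. Ls j (s j)) = (\<Sum>j\<in>{1..m}. Ls j (s j))"
    by (rule sum_cellJ)
  finally show ?thesis by simp
qed

lemma selB_equilibrium:
  "j \<in> {1..m} \<Longrightarrow> selB s (\<lambda>_. v) s d j = L j v - vec_b S j - d j"
  using metric_on_0[OF N_metric K_subspace] by (simp add: selB_def)

lemma equilibrium_solves_P:
  assumes "equilibrium z s v d"
  shows "solves_P S v"
proof -
  have "(\<Sum>i<n. selA z s (\<lambda>_. v) s i) \<in> (\<Sum>i<n. A i v)"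
    unfolding set_sum_alt[OF finite_lessThan] using assms by (auto simp: equilibrium_def)
  moreover have "s j \<in> parallel_sum (B j) (D j) (L j v - vec_b S j)" if j: "j \<in> {1..m}" for j
  proof -
    have "s j \<in> B j (L j v - vec_b S j - d j)" "s j \<in> D j (d j)"
      using assms j selB_equilibrium[OF j, of s v d] unfolding equilibrium_def by metis+
    moreover have "L j v - vec_b S j = (L j v - vec_b S j - d j) + d j" by simp
    ultimately show ?thesis unfolding parallel_sum_def inverse_operator_def set_plus_def by blast
  qed
  then have "(\<Sum>j\<in>{1..m}. Ls j (s j)) \<in>
      (\<Sum>j\<in>{1..m}. Ls j ` parallel_sum (B j) (D j) (L j v - vec_b S j))"
    unfolding set_sum_alt[OF finite_atLeastAtMost] by auto
  ultimately have "(\<Sum>i<n. selA z s (\<lambda>_. v) s i) + (\<Sum>j\<in>{1..m}. Ls j (s j)) + (\<Sum>l\<in>{1..p_of S}. C l v) \<in>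
      (\<Sum>i<n. A i v) + (\<Sum>j\<in>{1..m}. Ls j ` parallel_sum (B j) (D j) (L j v - vec_b S j)) +
      {\<Sum>l\<in>{1..p_of S}. C l v}"
    by (intro set_plus_intro) auto
  then show ?thesis unfolding solves_P_def sum_selA_equilibrium by simp
qed

text \<open>Since \<open>pa 0\<close> is arbitrary, several iterates may hit \<open>0\<close>; the
  least one is the distance from the root.\<close>

definition depth :: "nat \<Rightarrow> nat" where
  "depth i = (LEAST k. (pa ^^ k) i = 0)"

lemma depth_child:
  assumes "i \<in> {1..<n}" shows "depth i = Suc (depth (pa i))"
proof -
  obtain k where "(pa ^^ k) i = 0" using iterated_parent[of i] assms by auto
  moreover have "\<not> (pa ^^ 0) i = 0" using assms by simp
  ultimately show ?thesis
    unfolding depth_def using Least_Suc[of "\<lambda>k. (pa ^^ k) i = 0" k] by (simp add: funpow_swap1)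
qed

text \<open>The equation at a node involves only nodes one level deeper, so the levels can be
  satisfied one after another from the bottom.\<close>

lemma tree_flow:
  fixes g :: "nat \<Rightarrow> 'h"
  obtains w where "\<And>i. i \<in> {1..<n} \<Longrightarrow> w i = (\<Sum>c\<in>ch S i. w c) - g i"
proof -
  \<comment> \<open>Strictly larger than every depth: at stage \<open>0\<close> no equation is
    demanded, and at stage \<open>h\<close> all of them are.\<close>
  define h where "h = Suc (Max (depth ` {..<n}))"
  have h: "depth i < h" if "i < n" for i using that by (simp add: h_def less_Suc_eq_le)
  have "\<exists>w. \<forall>i\<in>{1..<n}. h \<le> depth i + k \<longrightarrow> w i = (\<Sum>c\<in>ch S i. w c) - g i" for k
  proof (induction k)
    case 0
    show ?case using h by (metis add_0_right atLeastLessThan_iff not_le)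
  next
    case (Suc k)
    then obtain w where w: "\<forall>i\<in>{1..<n}. h \<le> depth i + k \<longrightarrow> w i = (\<Sum>c\<in>ch S i. w c) - g i" by blast
    define w' where "w' i = (if h \<le> depth i + k then w i else (\<Sum>c\<in>ch S i. w c) - g i)" for i
    have "w' i = (\<Sum>c\<in>ch S i. w' c) - g i" if i: "i \<in> {1..<n}" "h \<le> depth i + Suc k" for i
    proof -
      have "h \<le> depth c + k" if "c \<in> ch S i" for c
        using that i(2) depth_child[of c] by (simp add: ch_iff)
      then have "(\<Sum>c\<in>ch S i. w' c) = (\<Sum>c\<in>ch S i. w c)" by (intro sum.cong) (auto simp: w'_def)
      then show ?thesis using w i(1) by (auto simp: w'_def)
    qed
    then show ?case by blast
  qed
  from this[of h] that show ?thesis by (metis le_add2)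
qed

lemma solves_P_equilibrium:
  assumes "solves_P S v"
  obtains z s d where "equilibrium z s v d"
proof -
  obtain x y where x: "x \<in> (\<Sum>i<n. A i v)"
      and y: "y \<in> (\<Sum>j\<in>{1..m}. Ls j ` parallel_sum (B j) (D j) (L j v - vec_b S j))"
      and xy: "vec_a S = x + y + (\<Sum>l\<in>{1..p_of S}. C l v)"
    using assms unfolding solves_P_def by (auto elim!: set_plus_elim)
  obtain a where a: "x = (\<Sum>i<n. a i)" "\<forall>i\<in>{..<n}. a i \<in> A i v"
    using x unfolding set_sum_alt[OF finite_lessThan] by blast
  obtain q where q: "y = (\<Sum>j\<in>{1..m}. q j)"
      "\<forall>j\<in>{1..m}. q j \<in> Ls j ` parallel_sum (B j) (D j) (L j v - vec_b S j)"
    using y unfolding set_sum_alt[OF finite_atLeastAtMost] by blast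
  have "\<forall>j\<in>{1..m}. \<exists>s d. q j = Ls j s \<and> s \<in> D j d \<and> s \<in> B j (L j v - vec_b S j - d)"
  proof
    fix j assume "j \<in> {1..m}"
    then obtain s where s: "q j = Ls j s" "s \<in> parallel_sum (B j) (D j) (L j v - vec_b S j)"
      using q(2) by blast
    then obtain b d where "L j v - vec_b S j = b + d" "s \<in> B j b" "s \<in> D j d"
      by (auto simp: parallel_sum_def inverse_operator_def elim!: set_plus_elim)
    then show "\<exists>s d. q j = Ls j s \<and> s \<in> D j d \<and> s \<in> B j (L j v - vec_b S j - d)"
      using s(1) by (metis add_diff_cancel_right')
  qed
  then obtain s0 d where sd: "\<And>j. j \<in> {1..m} \<Longrightarrow>
      q j = Ls j (s0 j) \<and> s0 j \<in> D j (d j) \<and> s0 j \<in> B j (L j v - vec_b S j - d j)"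
    by metis
  define s where "s = restrict s0 {1..m}"
  have s: "q j = Ls j (s j)" "s j \<in> D j (d j)" "s j \<in> B j (L j v - vec_b S j - d j)"
    if "j \<in> {1..m}" for j
    using sd[OF that] that unfolding s_def by (simp_all del: One_nat_def)
  \<comment> \<open>With \<open>w i = M i (z i - v)\<close> this is the requirement
    \<open>selA z s (\<lambda>_. v) s i = a i\<close> solved for \<open>w i\<close>.\<close>
  obtain w where w: "\<And>i. i \<in> {1..<n} \<Longrightarrow> w i = (\<Sum>c\<in>ch S i. w c) -
      (a i + (\<Sum>l\<in>cellP S i. C l v) + (\<Sum>j\<in>cellJ S i. Ls j (s j)))"
    by (rule tree_flow[of "\<lambda>i. a i + (\<Sum>l\<in>cellP S i. C l v) + (\<Sum>j\<in>cellJ S i. Ls j (s j))"]) blast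
  have "\<exists>y. M i y = w i" if "i \<in> {1..<n}" for i using metric_on_UNIV_surj[OF M_metric[OF that]] by metis
  then obtain y where y: "\<And>i. i \<in> {1..<n} \<Longrightarrow> M i (y i) = w i" by metis
  define z where "z = restrict (\<lambda>i. v + y i) {1..<n}"
  have Mz: "M i (v - z i) = - w i" "M i (v + z i - 2 *\<^sub>R v) = w i" if "i \<in> {1..<n}" for i
    using y[OF that] that linear_neg[OF bounded_linear.linear[OF M_bounded_linear[OF that]], of "y i"]
    by (simp_all add: z_def scaleR_2)
  have sel: "selA z s (\<lambda>_. v) s i = a i" if i: "i \<in> {1..<n}" for i
  proof -
    have "(\<Sum>j\<in>cellJc S i. Ls j (s j - s j)) = 0"
      using cellJc_subset'[OF i] by (intro sum.neutral) (auto simp: Ls_0 subset_iff)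
    moreover have "(\<Sum>c\<in>ch S i. M c (v - z c)) = - (\<Sum>c\<in>ch S i. w c)"
      unfolding sum_negf[symmetric] by (intro sum.cong refl Mz) (simp add: ch_iff)
    ultimately show ?thesis using i w[OF i] Mz(2)[OF i] by (simp add: selA_def)
  qed
  \<comment> \<open>The flow equations cover the nodes other than the root. The root equation
    follows because the totals agree by (P) and all other summands already match.\<close>
  have "(\<Sum>i<n. selA z s (\<lambda>_. v) s i) = (\<Sum>i<n. a i)"
    unfolding sum_selA_equilibrium using xy a(1) q(1) s(1) by simp
  moreover have "(\<Sum>i\<in>{1..<n}. selA z s (\<lambda>_. v) s i) = (\<Sum>i\<in>{1..<n}. a i)"
    by (intro sum.cong refl sel)
  ultimately have sel0: "selA z s (\<lambda>_. v) s 0 = a 0" by (simp add: sum_nodes)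
  have "selA z s (\<lambda>_. v) s i \<in> A i v" if "i < n" for i
    using that a(2) sel0 sel[of i] by (cases "i = 0") auto
  moreover have "s j \<in> K j" if "j \<in> {1..m}" for j
    using maximally_monotone_on_carrierD(2)[OF D_maximal[OF that] s(2)[OF that]] .
  then have "(z, s) \<in> state_space S"
    by (auto simp: state_space_def z_def s_def simp del: One_nat_def)
  ultimately have "equilibrium z s v d"
    using s(2,3) by (simp add: equilibrium_def selB_equilibrium)
  then show ?thesis by (rule that)
qed

section \<open>Equilibria as fixed points, the root resolvent, and the steps of the scheme\<close>

lemma equilibrium_Fix_relaxed:
  assumes eq: "equilibrium z s v d"
  shows "(z, s) \<in> Fix_relaxed S \<theta> \<zeta>"
proof -
  have "T_zs S (z, s) = (z, s)" by (rule T_zs_eq[OF equilibrium_prediction[OF eq]])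
  moreover have st: "(z, s) \<in> state_space S" using eq by (simp add: equilibrium_def)
  then have "restrict z {1..<n} = z" "restrict s {1..m} = s"
    unfolding state_space_def PiE_def by (auto intro: extensional_restrict)
  ultimately show ?thesis using st by (simp add: Fix_relaxed_def)
qed

text \<open>The root inclusion is the resolvent equation. For \<open>the_elem\<close> its solution
  must also be unique, which follows from monotonicity of \<open>A 0\<close> and positive
  definiteness of one child metric.\<close>

lemma equilibrium_warped_resolvent:
  assumes eq: "equilibrium z s v d"
  shows "warped_resolvent (\<lambda>x. \<Sum>c\<in>ch S 0. M c x) (A 0)
    ((\<Sum>c\<in>ch S 0. M c (z c)) - (\<Sum>j\<in>cellJ S 0. Ls j (s j)) + vec_a S) = v"
proof -
  define x where "x = (\<Sum>c\<in>ch S 0. M c (z c)) - (\<Sum>j\<in>cellJ S 0. Ls j (s j)) + vec_a S"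
  have n: "0 < n" using n_ge_2 by simp
  have M_diff: "M c (v - w) = M c v - M c w" if "c \<in> ch S 0" for c v w
    using linear_diff[OF bounded_linear.linear[OF M_bounded_linear]] that by (simp add: ch_iff)
  have "(\<Sum>c\<in>ch S 0. M c (v - z c)) = (\<Sum>c\<in>ch S 0. M c v) - (\<Sum>c\<in>ch S 0. M c (z c))"
    unfolding sum_subtractf[symmetric] by (intro sum.cong refl M_diff)
  then have "x - (\<Sum>c\<in>ch S 0. M c v) = selA z s (\<lambda>_. v) s 0" by (simp add: x_def selA_def)
  then have v: "x - (\<Sum>c\<in>ch S 0. M c v) \<in> A 0 v" using eq n by (simp add: equilibrium_def)
  have mem: "x \<in> {y} + X \<longleftrightarrow> x - y \<in> X" for y X
    by (auto simp: set_plus_def) (metis add.commute diff_add_cancel)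
  have "w = v" if w: "x - (\<Sum>c\<in>ch S 0. M c w) \<in> A 0 w" for w
  proof -
    obtain c where c: "c \<in> ch S 0" using ch_root_nonempty by blast
    have nonneg: "0 \<le> M c (w - v) \<bullet> (w - v)" if "c \<in> ch S 0" for c
      using that metric_on_nonneg[OF M_metric UNIV_I] by (simp add: ch_iff)
    have "0 \<le> (w - v) \<bullet> ((x - (\<Sum>c\<in>ch S 0. M c w)) - (x - (\<Sum>c\<in>ch S 0. M c v)))"
      by (rule maximally_monotone_on_monotoneD[OF A_maximal[OF n] w v])
    also have "(x - (\<Sum>c\<in>ch S 0. M c w)) - (x - (\<Sum>c\<in>ch S 0. M c v)) = - (\<Sum>c\<in>ch S 0. M c (w - v))"
      by (simp add: sum_subtractf M_diff)
    finally have "(\<Sum>c\<in>ch S 0. M c (w - v) \<bullet> (w - v)) \<le> 0"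
      by (simp add: inner_sum_left inner_sum_right inner_commute)
    moreover have "M c (w - v) \<bullet> (w - v) \<le> (\<Sum>c\<in>ch S 0. M c (w - v) \<bullet> (w - v))"
      using c nonneg by (intro member_le_sum) auto
    ultimately have "M c (w - v) \<bullet> (w - v) \<le> 0" by linarith
    then have "w - v = 0" using metric_on_eq_0[OF M_metric UNIV_I] c ch_iff by blast
    then show "w = v" by simp
  qed
  with v have "inverse_operator (\<lambda>u. {\<Sum>c\<in>ch S 0. M c u} + A 0 u) x = {v}"
    unfolding inverse_operator_def mem by blast
  then show ?thesis unfolding warped_resolvent_def x_def[symmetric] by simp
qed

text \<open>By uniqueness of the prediction, the value of \<open>T_zs\<close> in the relaxed step is
  the one belonging to the given \<open>u (Suc k)\<close>. Afterwards the iteration is described by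
  graph inclusions alone.\<close>

lemma relaxed_sequence_steps:
  assumes "relaxed_sequence S \<theta> \<zeta> u z s"
  obtains t d where
    "\<And>k i. i < n \<Longrightarrow> selA (z k) (s k) (u (Suc k)) (t k) i \<in> A i (u (Suc k) i)"
    "\<And>k j. j \<in> {1..m} \<Longrightarrow> s k j \<in> D j (d k j)"
    "\<And>k j. j \<in> {1..m} \<Longrightarrow> t k j \<in> B j (selB (s k) (u (Suc k)) (t k) (d k) j)"
    "\<And>k i. i \<in> {1..<n} \<Longrightarrow> z (Suc k) i = z k i + \<theta> i *\<^sub>R (u (Suc k) i - u (Suc k) (pa i))"
    "\<And>k j. j \<in> {1..m} \<Longrightarrow> s (Suc k) j = s k j + \<zeta> j *\<^sub>R (t k j - s k j)"
proof -
  have "\<forall>k. \<exists>t d. (\<forall>i<n. selA (z k) (s k) (u (Suc k)) t i \<in> A i (u (Suc k) i)) \<and>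
      (\<forall>j\<in>{1..m}. s k j \<in> D j (d j) \<and> t j \<in> B j (selB (s k) (u (Suc k)) t d j)) \<and>
      (\<forall>i\<in>{1..<n}. z (Suc k) i = z k i + \<theta> i *\<^sub>R (u (Suc k) i - u (Suc k) (pa i))) \<and>
      (\<forall>j\<in>{1..m}. s (Suc k) j = s k j + \<zeta> j *\<^sub>R (t j - s k j))"
  proof
    fix k
    obtain zt t where p: "prediction S (z k, s k) (u (Suc k)) (zt, t)"
      using assms unfolding relaxed_sequence_def by (metis surj_pair)
    have "(z (Suc k), s (Suc k)) = T_relaxed S \<theta> \<zeta> (z k, s k)"
      using assms by (simp add: relaxed_sequence_def)
    then have zs: "z (Suc k) = (\<lambda>i\<in>{1..<n}. z k i + \<theta> i *\<^sub>R (zt i - z k i))"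
        "s (Suc k) = (\<lambda>j\<in>{1..m}. s k j + \<zeta> j *\<^sub>R (t j - s k j))"
      using T_zs_eq[OF p] by simp_all
    obtain d where pd: "\<forall>i<n. selA (z k) (s k) (u (Suc k)) t i \<in> A i (u (Suc k) i)"
        "\<forall>j\<in>{1..m}. s k j \<in> D j (d j) \<and> t j \<in> B j (selB (s k) (u (Suc k)) t d j)"
        "\<forall>i\<in>{1..<n}. zt i = z k i + u (Suc k) i - u (Suc k) (pa i)"
      using p unfolding prediction_iff by blast
    have "z (Suc k) i = z k i + \<theta> i *\<^sub>R (u (Suc k) i - u (Suc k) (pa i))" if "i \<in> {1..<n}" for i
      using pd(3) that unfolding zs by (simp del: One_nat_def)
    moreover have "s (Suc k) j = s k j + \<zeta> j *\<^sub>R (t j - s k j)" if "j \<in> {1..m}" for j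
      using that unfolding zs by (simp del: One_nat_def)
    ultimately show "\<exists>t d. (\<forall>i<n. selA (z k) (s k) (u (Suc k)) t i \<in> A i (u (Suc k) i)) \<and>
      (\<forall>j\<in>{1..m}. s k j \<in> D j (d j) \<and> t j \<in> B j (selB (s k) (u (Suc k)) t d j)) \<and>
      (\<forall>i\<in>{1..<n}. z (Suc k) i = z k i + \<theta> i *\<^sub>R (u (Suc k) i - u (Suc k) (pa i))) \<and>
      (\<forall>j\<in>{1..m}. s (Suc k) j = s k j + \<zeta> j *\<^sub>R (t j - s k j))"
      using pd(1,2) by blast
  qed
  from choice[OF this] obtain t where "\<forall>k. \<exists>d. (\<forall>i<n. selA (z k) (s k) (u (Suc k)) (t k) i \<in> A i (u (Suc k) i)) \<and>
      (\<forall>j\<in>{1..m}. s k j \<in> D j (d j) \<and> t k j \<in> B j (selB (s k) (u (Suc k)) (t k) d j)) \<and>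
      (\<forall>i\<in>{1..<n}. z (Suc k) i = z k i + \<theta> i *\<^sub>R (u (Suc k) i - u (Suc k) (pa i))) \<and>
      (\<forall>j\<in>{1..m}. s (Suc k) j = s k j + \<zeta> j *\<^sub>R (t k j - s k j))" ..
  from choice[OF this] show ?thesis using that by blast
qed

lemma weakly_convergesI:
  assumes "\<And>i. i \<in> {1..<n} \<Longrightarrow> weakly_tendsto (\<lambda>k. z k i) (z' i) sequentially"
    and "\<And>j. j \<in> {1..m} \<Longrightarrow> weakly_tendsto (\<lambda>k. s k j) (s' j) sequentially"
  shows "weakly_converges S (\<lambda>k. (z k, s k)) (z', s')"
  unfolding weakly_converges_def
proof
  fix y assume "y \<in> state_space S"
  obtain y\<^sub>1 y\<^sub>2 where y: "y = (y\<^sub>1, y\<^sub>2)" by (cases y)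
  show "(\<lambda>k. state_inner S (z k, s k) y) \<longlonglongrightarrow> state_inner S (z', s') y"
    unfolding y state_inner.simps using assms unfolding weakly_tendsto_def
    by (intro tendsto_add tendsto_sum) blast+
qed

end

section \<open>The Lyapunov function\<close>

text \<open>The \<open>\<rho> j\<close> are finite moduli standing in for \<open>nu S j\<close>, and
  the lower bounds on \<open>\<alpha> i\<close> and \<open>\<sigma> j\<close> are multiplied out, so
  that the slacks below are differences of the two sides.\<close>

locale relaxed_problem = tree_problem S
  for S :: "('h::{real_inner,complete_space}, 'k::{real_inner,complete_space}, 'more)
    tree_splitting_scheme" +
  fixes \<theta> \<zeta> \<alpha> \<sigma> \<tau> \<rho> :: "nat \<Rightarrow> real"
  assumes \<theta>: "i \<in> {1..<n} \<Longrightarrow> 0 < \<theta> i \<and> \<theta> i < 2"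
    and \<zeta>: "j \<in> {1..m} \<Longrightarrow> 0 < \<zeta> j \<and> \<zeta> j < 2"
    and \<tau>: "j \<in> {1..m} \<Longrightarrow> 0 < \<tau> j"
    and \<alpha>: "i \<in> {1..<n} \<Longrightarrow> bounded_below_on UNIV (M i) (\<alpha> i)"
    and \<alpha>_large: "i \<in> {1..<n} \<Longrightarrow>
      2 * (\<Sum>j\<in>cellJc S i. \<tau> j) + (\<Sum>l\<in>cellP S i. 1 / (2 * beta S l)) < (2 - \<theta> i) * \<alpha> i"
    and \<sigma>: "j \<in> {1..m} \<Longrightarrow> bounded_below_on (K j) (N j) (\<sigma> j)"
    and \<sigma>_large: "j \<in> {1..m} \<Longrightarrow>
      (onorm (L j))\<^sup>2 / (2 * \<tau> j) + 1 / (2 * \<rho> j) < (2 - \<zeta> j) * \<sigma> j"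
    and \<rho>: "j \<in> {1..m} \<Longrightarrow> 0 < \<rho> j \<and> strongly_monotone (\<rho> j) (D j)"
begin

definition slackA :: "nat \<Rightarrow> real" where
  "slackA i = (2 - \<theta> i) * \<alpha> i - 2 * (\<Sum>j\<in>cellJc S i. \<tau> j) - (\<Sum>l\<in>cellP S i. 1 / (2 * beta S l))"

definition slackB :: "nat \<Rightarrow> real" where
  "slackB j = (2 - \<zeta> j) * \<sigma> j - (onorm (L j))\<^sup>2 / (2 * \<tau> j) - 1 / (2 * \<rho> j)"

lemma slackA_pos: "i \<in> {1..<n} \<Longrightarrow> 0 < slackA i"
  using \<alpha>_large[of i] unfolding slackA_def by linarith

lemma slackB_pos: "j \<in> {1..m} \<Longrightarrow> 0 < slackB j"
  using \<sigma>_large[of j] unfolding slackB_def by linarith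

text \<open>A bilinear form rather than a norm, because Opial's argument also pairs the iterate with
  the difference of two equilibria.\<close>

definition ip :: "(nat \<Rightarrow> 'h) \<Rightarrow> (nat \<Rightarrow> 'k) \<Rightarrow> (nat \<Rightarrow> 'h) \<Rightarrow> (nat \<Rightarrow> 'k) \<Rightarrow> real" where
  "ip z s z' s' = (\<Sum>i\<in>{1..<n}. M i (z i) \<bullet> z' i / \<theta> i) + (\<Sum>j\<in>{1..m}. N j (s j) \<bullet> s' j / \<zeta> j)"

abbreviation lyap :: "(nat \<Rightarrow> 'h) \<Rightarrow> (nat \<Rightarrow> 'k) \<Rightarrow> (nat \<Rightarrow> 'h) \<Rightarrow> (nat \<Rightarrow> 'k) \<Rightarrow> real" where
  "lyap z s z' s' \<equiv> ip (\<lambda>i. z i - z' i) (\<lambda>j. s j - s' j) (\<lambda>i. z i - z' i) (\<lambda>j. s j - s' j)"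

text \<open>Cauchy-Schwarz followed by Young's inequality with weight \<open>2 * \<tau> j\<close>:
  the first term is charged to the primal edge, the second to the dual step. This is the origin of
  \<open>2 * \<tau> j\<close> in (b) and of the operator norm in (c).\<close>

lemma coupling_bound:
  assumes j: "j \<in> {1..m}"
  shows "- 2 * (w \<bullet> L j e) \<le> 2 * \<tau> j * (norm e)\<^sup>2 + (onorm (L j))\<^sup>2 / (2 * \<tau> j) * (norm w)\<^sup>2"
proof -
  have t: "0 < \<tau> j" using \<tau>[OF j] .
  have "- (w \<bullet> L j e) \<le> norm w * norm (L j e)" using Cauchy_Schwarz_ineq2[of w "L j e"] by linarith
  also have "\<dots> \<le> norm w * (onorm (L j) * norm e)"
    by (intro mult_left_mono onorm[OF L_bounded_linear[OF j]] norm_ge_zero)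
  finally have le: "- (w \<bullet> L j e) \<le> norm w * (onorm (L j) * norm e)" .
  define q where "q = onorm (L j) * norm w"
  define x where "x = norm e"
  have "0 \<le> 2 * \<tau> j * (x - q / (2 * \<tau> j))\<^sup>2" using t by (intro mult_nonneg_nonneg) auto
  also have "\<dots> = 2 * \<tau> j * x\<^sup>2 - 2 * (q * x) + q\<^sup>2 / (2 * \<tau> j)"
    using t by (simp add: power2_eq_square field_simps)
  finally have "2 * (q * x) \<le> 2 * \<tau> j * x\<^sup>2 + q\<^sup>2 / (2 * \<tau> j)" by simp
  moreover have "q * x = norm w * (onorm (L j) * norm e)" by (simp add: q_def x_def)
  moreover have "q\<^sup>2 / (2 * \<tau> j) = (onorm (L j))\<^sup>2 / (2 * \<tau> j) * (norm w)\<^sup>2"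
    by (simp add: q_def power_mult_distrib)
  ultimately show ?thesis using le unfolding x_def by linarith
qed

text \<open>Expanding the relaxed squares produces cross terms, which twice the energy inequality
  \<open>bal\<close> cancels. The remaining multiples \<open>2 - \<theta> i\<close> and
  \<open>2 - \<zeta> j\<close> of the metric squares pay for the coupling and the cocoercive terms;
  the slack of the step-size conditions is what is left over.\<close>

lemma lyap_descent:
  fixes z z' u :: "nat \<Rightarrow> 'h" and s s' t d d' :: "nat \<Rightarrow> 'k" and v :: 'h
  defines "e \<equiv> \<lambda>i. u i - u (pa i)" and "w \<equiv> \<lambda>j. t j - s j"
  assumes A: "\<And>i. i < n \<Longrightarrow> selA z s u t i \<in> A i (u i)"
    and D: "\<And>j. j \<in> {1..m} \<Longrightarrow> s j \<in> D j (d j)"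
    and B: "\<And>j. j \<in> {1..m} \<Longrightarrow> t j \<in> B j (selB s u t d j)"
    and eq: "equilibrium z' s' v d'"
  shows "lyap (\<lambda>i. z i + \<theta> i *\<^sub>R e i) (\<lambda>j. s j + \<zeta> j *\<^sub>R w j) z' s' +
      (\<Sum>i\<in>{1..<n}. slackA i * (norm (e i))\<^sup>2) + (\<Sum>j\<in>{1..m}. slackB j * (norm (w j))\<^sup>2) +
      (\<Sum>i\<in>{1..<n}. \<Sum>l\<in>cellP S i. 2 * beta S l *
         (norm (C l (u (pa i)) - C l v + (1 / (2 * beta S l)) *\<^sub>R e i))\<^sup>2) +
      (\<Sum>j\<in>{1..m}. 2 * \<rho> j * (norm (d j - d' j + (1 / (2 * \<rho> j)) *\<^sub>R w j))\<^sup>2)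
    \<le> lyap z s z' s'"
proof -
  define Z where "Z i = z i - z' i" for i
  define Y where "Y j = s j - s' j" for j
  define g where "g i l = C l (u (pa i)) - C l v" for i l
  define \<eta> where "\<eta> j = d j - d' j" for j
  have A': "selA z' s' (\<lambda>_. v) s' i \<in> A i v" if "i < n" for i using eq that by (simp add: equilibrium_def)
  have D': "s' j \<in> D j (d' j)" and B': "s' j \<in> B j (selB s' (\<lambda>_. v) s' d' j)" if "j \<in> {1..m}" for j
    using eq that by (auto simp: equilibrium_def)
  have K: "s j \<in> K j" "t j \<in> K j" "s' j \<in> K j" if "j \<in> {1..m}" for j
    using D[OF that] B[OF that] D'[OF that] maximally_monotone_on_carrierD(2)
      B_maximal[OF that] D_maximal[OF that] by blast+
  have K': "Y j \<in> K j" "w j \<in> K j" if "j \<in> {1..m}" for j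
    using K[OF that] by (auto simp: Y_def w_def intro: subspace_diff[OF K_subspace[OF that]])
  have "0 \<le> (\<Sum>i<n. (u i - v) \<bullet> (selA z s u t i - selA z' s' (\<lambda>_. v) s' i)) +
     (\<Sum>j\<in>{1..m}. (t j - s' j) \<bullet> (selB s u t d j - selB s' (\<lambda>_. v) s' d' j))"
  proof (intro add_nonneg_nonneg sum_nonneg)
    show "0 \<le> (u i - v) \<bullet> (selA z s u t i - selA z' s' (\<lambda>_. v) s' i)" if "i \<in> {..<n}" for i
      using maximally_monotone_on_monotoneD[OF A_maximal A A'] that by simp
    show "0 \<le> (t j - s' j) \<bullet> (selB s u t d j - selB s' (\<lambda>_. v) s' d' j)" if "j \<in> {1..m}" for j
      using maximally_monotone_on_monotoneD[OF B_maximal B B'] that by (simp add: inner_commute)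
  qed
  then have bal: "(\<Sum>i\<in>{1..<n}. M i (e i) \<bullet> e i + M i (Z i) \<bullet> e i +
        (\<Sum>l\<in>cellP S i. (u i - v) \<bullet> g i l) + (\<Sum>j\<in>cellJc S i. w j \<bullet> L j (e i))) +
      (\<Sum>j\<in>{1..m}. w j \<bullet> N j (w j) + Y j \<bullet> N j (w j) + (t j - s' j) \<bullet> \<eta> j) \<le> 0"
    unfolding energy_balance e_def w_def Z_def Y_def g_def \<eta>_def by simp
  \<comment> \<open>The last sum on the right is the dual share of the coupling bound. It is a debt
    of the nodes here and appears with the opposite sign in \<open>dual\<close>.\<close>
  have node: "(\<Sum>i\<in>{1..<n}. M i (Z i + \<theta> i *\<^sub>R e i) \<bullet> (Z i + \<theta> i *\<^sub>R e i) / \<theta> i + slackA i * (norm (e i))\<^sup>2 +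
      (\<Sum>l\<in>cellP S i. 2 * beta S l * (norm (g i l + (1 / (2 * beta S l)) *\<^sub>R e i))\<^sup>2))
    \<le> (\<Sum>i\<in>{1..<n}. M i (Z i) \<bullet> Z i / \<theta> i + 2 * (M i (e i) \<bullet> e i + M i (Z i) \<bullet> e i +
        (\<Sum>l\<in>cellP S i. (u i - v) \<bullet> g i l) + (\<Sum>j\<in>cellJc S i. w j \<bullet> L j (e i))) +
      (\<Sum>j\<in>cellJc S i. (onorm (L j))\<^sup>2 / (2 * \<tau> j) * (norm (w j))\<^sup>2))"
  proof (rule sum_mono)
    fix i assume i: "i \<in> {1..<n}"
    have sq: "M i (Z i + \<theta> i *\<^sub>R e i) \<bullet> (Z i + \<theta> i *\<^sub>R e i) / \<theta> i =
        M i (Z i) \<bullet> Z i / \<theta> i + 2 * (M i (Z i) \<bullet> e i) + \<theta> i * (M i (e i) \<bullet> e i)"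
      using \<theta>[OF i] by (intro metric_on_relaxed_square[OF M_metric[OF i]]) auto
    have "(2 - \<theta> i) * (\<alpha> i * (norm (e i))\<^sup>2) \<le> (2 - \<theta> i) * (M i (e i) \<bullet> e i)"
      using \<alpha>[OF i] \<theta>[OF i] by (intro mult_left_mono) (auto simp: bounded_below_on_def)
    then have alpha: "(2 - \<theta> i) * \<alpha> i * (norm (e i))\<^sup>2 \<le> 2 * (M i (e i) \<bullet> e i) - \<theta> i * (M i (e i) \<bullet> e i)"
      by (simp add: algebra_simps)
    have "- 2 * ((u i - v) \<bullet> g i l) \<le> 1 / (2 * beta S l) * (norm (e i))\<^sup>2 -
        2 * beta S l * (norm (g i l + (1 / (2 * beta S l)) *\<^sub>R e i))\<^sup>2" if "l \<in> cellP S i" for l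
    proof -
      have l: "l \<in> {1..p_of S}" using cellP_subset[of i] i that by auto
      have "beta S l * (norm (g i l))\<^sup>2 \<le> (u (pa i) - v) \<bullet> g i l"
        using C_cocoercive[OF l] by (simp add: cocoercive_def g_def)
      from cocoercive_square[OF beta_pos[OF l] this, of "e i"] show ?thesis by (simp add: e_def)
    qed
    then have "(\<Sum>l\<in>cellP S i. - 2 * ((u i - v) \<bullet> g i l)) \<le> (\<Sum>l\<in>cellP S i.
        1 / (2 * beta S l) * (norm (e i))\<^sup>2 -
        2 * beta S l * (norm (g i l + (1 / (2 * beta S l)) *\<^sub>R e i))\<^sup>2)"
      by (rule sum_mono)
    then have Cl: "- 2 * (\<Sum>l\<in>cellP S i. (u i - v) \<bullet> g i l) \<le>
        (\<Sum>l\<in>cellP S i. 1 / (2 * beta S l)) * (norm (e i))\<^sup>2 -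
        (\<Sum>l\<in>cellP S i. 2 * beta S l * (norm (g i l + (1 / (2 * beta S l)) *\<^sub>R e i))\<^sup>2)"
      by (simp only: sum_subtractf sum_distrib_left sum_distrib_right)
    have "(\<Sum>j\<in>cellJc S i. - 2 * (w j \<bullet> L j (e i))) \<le> (\<Sum>j\<in>cellJc S i.
        2 * \<tau> j * (norm (e i))\<^sup>2 + (onorm (L j))\<^sup>2 / (2 * \<tau> j) * (norm (w j))\<^sup>2)"
      using cellJc_subset'[OF i] by (intro sum_mono coupling_bound) auto
    then have Jc: "- 2 * (\<Sum>j\<in>cellJc S i. w j \<bullet> L j (e i)) \<le>
        2 * (\<Sum>j\<in>cellJc S i. \<tau> j) * (norm (e i))\<^sup>2 +
        (\<Sum>j\<in>cellJc S i. (onorm (L j))\<^sup>2 / (2 * \<tau> j) * (norm (w j))\<^sup>2)"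
      by (simp only: sum.distrib sum_distrib_left sum_distrib_right)
    have "slackA i * (norm (e i))\<^sup>2 = (2 - \<theta> i) * \<alpha> i * (norm (e i))\<^sup>2 -
        2 * (\<Sum>j\<in>cellJc S i. \<tau> j) * (norm (e i))\<^sup>2 -
        (\<Sum>l\<in>cellP S i. 1 / (2 * beta S l)) * (norm (e i))\<^sup>2"
      by (simp only: slackA_def left_diff_distrib)
    with alpha Cl Jc show "M i (Z i + \<theta> i *\<^sub>R e i) \<bullet> (Z i + \<theta> i *\<^sub>R e i) / \<theta> i + slackA i * (norm (e i))\<^sup>2 +
      (\<Sum>l\<in>cellP S i. 2 * beta S l * (norm (g i l + (1 / (2 * beta S l)) *\<^sub>R e i))\<^sup>2)
    \<le> M i (Z i) \<bullet> Z i / \<theta> i + 2 * (M i (e i) \<bullet> e i + M i (Z i) \<bullet> e i +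
        (\<Sum>l\<in>cellP S i. (u i - v) \<bullet> g i l) + (\<Sum>j\<in>cellJc S i. w j \<bullet> L j (e i))) +
      (\<Sum>j\<in>cellJc S i. (onorm (L j))\<^sup>2 / (2 * \<tau> j) * (norm (w j))\<^sup>2)" unfolding sq by argo
  qed
  have dual: "(\<Sum>j\<in>{1..m}. N j (Y j + \<zeta> j *\<^sub>R w j) \<bullet> (Y j + \<zeta> j *\<^sub>R w j) / \<zeta> j + slackB j * (norm (w j))\<^sup>2 +
      2 * \<rho> j * (norm (\<eta> j + (1 / (2 * \<rho> j)) *\<^sub>R w j))\<^sup>2)
    \<le> (\<Sum>j\<in>{1..m}. N j (Y j) \<bullet> Y j / \<zeta> j + 2 * (w j \<bullet> N j (w j) + Y j \<bullet> N j (w j) + (t j - s' j) \<bullet> \<eta> j) -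
      (onorm (L j))\<^sup>2 / (2 * \<tau> j) * (norm (w j))\<^sup>2)"
  proof (rule sum_mono)
    fix j assume j: "j \<in> {1..m}"
    have sa: "N j (Y j) \<bullet> w j = Y j \<bullet> N j (w j)"
      by (rule metric_on_selfadjoint[OF N_metric[OF j] K'[OF j]])
    have sq: "N j (Y j + \<zeta> j *\<^sub>R w j) \<bullet> (Y j + \<zeta> j *\<^sub>R w j) / \<zeta> j =
        N j (Y j) \<bullet> Y j / \<zeta> j + 2 * (Y j \<bullet> N j (w j)) + \<zeta> j * (w j \<bullet> N j (w j))"
      using metric_on_relaxed_square[OF N_metric[OF j] K_subspace[OF j] K'[OF j]] \<zeta>[OF j]
      unfolding sa[symmetric] inner_commute[of "w j"] by blast
    have "(2 - \<zeta> j) * (\<sigma> j * (norm (w j))\<^sup>2) \<le> (2 - \<zeta> j) * (w j \<bullet> N j (w j))"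
      using \<sigma>[OF j] \<zeta>[OF j] K'(2)[OF j]
      by (intro mult_left_mono) (auto simp: bounded_below_on_def inner_commute)
    then have sigma: "(2 - \<zeta> j) * \<sigma> j * (norm (w j))\<^sup>2 \<le> 2 * (w j \<bullet> N j (w j)) - \<zeta> j * (w j \<bullet> N j (w j))"
      by (simp add: algebra_simps)
    have "\<rho> j * (norm (\<eta> j))\<^sup>2 \<le> Y j \<bullet> \<eta> j"
      using \<rho>[OF j] D[OF j] D'[OF j] by (auto simp: strongly_monotone_def \<eta>_def Y_def inner_commute)
    from cocoercive_square[OF _ this, of "w j"] \<rho>[OF j]
    have "- 2 * ((t j - s' j) \<bullet> \<eta> j) \<le> 1 / (2 * \<rho> j) * (norm (w j))\<^sup>2 -
        2 * \<rho> j * (norm (\<eta> j + (1 / (2 * \<rho> j)) *\<^sub>R w j))\<^sup>2"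
      by (simp add: Y_def w_def)
    moreover have "slackB j * (norm (w j))\<^sup>2 = (2 - \<zeta> j) * \<sigma> j * (norm (w j))\<^sup>2 -
        (onorm (L j))\<^sup>2 / (2 * \<tau> j) * (norm (w j))\<^sup>2 - 1 / (2 * \<rho> j) * (norm (w j))\<^sup>2"
      by (simp only: slackB_def left_diff_distrib)
    ultimately show "N j (Y j + \<zeta> j *\<^sub>R w j) \<bullet> (Y j + \<zeta> j *\<^sub>R w j) / \<zeta> j + slackB j * (norm (w j))\<^sup>2 +
      2 * \<rho> j * (norm (\<eta> j + (1 / (2 * \<rho> j)) *\<^sub>R w j))\<^sup>2
    \<le> N j (Y j) \<bullet> Y j / \<zeta> j + 2 * (w j \<bullet> N j (w j) + Y j \<bullet> N j (w j) + (t j - s' j) \<bullet> \<eta> j) -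
      (onorm (L j))\<^sup>2 / (2 * \<tau> j) * (norm (w j))\<^sup>2" using sigma unfolding sq by argo
  qed
  \<comment> \<open>Each dual index occurs in exactly one \<open>cellJc S i\<close>, so the debts of
    the nodes match the payments of the duals.\<close>
  have onorm_sum: "(\<Sum>i\<in>{1..<n}. \<Sum>j\<in>cellJc S i. (onorm (L j))\<^sup>2 / (2 * \<tau> j) * (norm (w j))\<^sup>2) =
      (\<Sum>j\<in>{1..m}. (onorm (L j))\<^sup>2 / (2 * \<tau> j) * (norm (w j))\<^sup>2)"
    by (rule sum_cellJc[where f = "\<lambda>_ j. (onorm (L j))\<^sup>2 / (2 * \<tau> j) * (norm (w j))\<^sup>2"])
  have "lyap (\<lambda>i. z i + \<theta> i *\<^sub>R e i) (\<lambda>j. s j + \<zeta> j *\<^sub>R w j) z' s' =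
      (\<Sum>i\<in>{1..<n}. M i (Z i + \<theta> i *\<^sub>R e i) \<bullet> (Z i + \<theta> i *\<^sub>R e i) / \<theta> i) +
      (\<Sum>j\<in>{1..m}. N j (Y j + \<zeta> j *\<^sub>R w j) \<bullet> (Y j + \<zeta> j *\<^sub>R w j) / \<zeta> j)"
    unfolding ip_def Z_def Y_def by (simp add: add_diff_eq diff_add_eq)
  moreover have "lyap z s z' s' = (\<Sum>i\<in>{1..<n}. M i (Z i) \<bullet> Z i / \<theta> i) +
      (\<Sum>j\<in>{1..m}. N j (Y j) \<bullet> Y j / \<zeta> j)"
    unfolding ip_def Z_def Y_def by simp
  moreover note node[unfolded sum.distrib sum_distrib_left[symmetric]]
    dual[unfolded sum.distrib sum_subtractf sum_distrib_left[symmetric]] bal onorm_sum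
  ultimately show ?thesis unfolding sum.distrib g_def[symmetric] \<eta>_def[symmetric] by argo
qed

end

section \<open>Weak convergence of the relaxed iteration\<close>

text \<open>Here \<open>u k\<close> is computed from \<open>(z k, s k)\<close>, so its index is one
  below that of the scheme. One reference equilibrium is fixed; it supplies the bounds and the
  strong limits.\<close>

locale relaxed_iteration = relaxed_problem S \<theta> \<zeta> \<alpha> \<sigma> \<tau> \<rho>
  for S :: "('h::{real_inner,complete_space}, 'k::{real_inner,complete_space}, 'more)
    tree_splitting_scheme" and \<theta> \<zeta> \<alpha> \<sigma> \<tau> \<rho> +
  fixes u z :: "nat \<Rightarrow> nat \<Rightarrow> 'h" and s t d :: "nat \<Rightarrow> nat \<Rightarrow> 'k"
    and z\<^sub>r :: "nat \<Rightarrow> 'h" and s\<^sub>r :: "nat \<Rightarrow> 'k" and v\<^sub>r :: 'h and d\<^sub>r :: "nat \<Rightarrow> 'k"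
  assumes step_A: "i < n \<Longrightarrow> selA (z k) (s k) (u k) (t k) i \<in> A i (u k i)"
    and step_D: "j \<in> {1..m} \<Longrightarrow> s k j \<in> D j (d k j)"
    and step_B: "j \<in> {1..m} \<Longrightarrow> t k j \<in> B j (selB (s k) (u k) (t k) (d k) j)"
    and step_z: "i \<in> {1..<n} \<Longrightarrow> z (Suc k) i = z k i + \<theta> i *\<^sub>R (u k i - u k (pa i))"
    and step_s: "j \<in> {1..m} \<Longrightarrow> s (Suc k) j = s k j + \<zeta> j *\<^sub>R (t k j - s k j)"
    and reference: "equilibrium z\<^sub>r s\<^sub>r v\<^sub>r d\<^sub>r"
begin

section \<open>Decrease of the Lyapunov function and the strong limits it gives\<close>

lemma s_in_K: "j \<in> {1..m} \<Longrightarrow> s k j \<in> K j" and t_in_K: "j \<in> {1..m} \<Longrightarrow> t k j \<in> K j"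
  using maximally_monotone_on_carrierD(2)[OF D_maximal step_D]
    maximally_monotone_on_carrierD(2)[OF B_maximal step_B] by blast+

lemma equilibrium_in_K: "equilibrium z' s' v d' \<Longrightarrow> j \<in> {1..m} \<Longrightarrow> s' j \<in> K j"
  using maximally_monotone_on_carrierD(2)[OF D_maximal] unfolding equilibrium_def by blast

lemma ip_node_nonneg: "i \<in> {1..<n} \<Longrightarrow> 0 \<le> M i x \<bullet> x / \<theta> i"
  using metric_on_nonneg[OF M_metric UNIV_I] \<theta>[of i] by (simp add: less_imp_le)

lemma ip_dual_nonneg: "j \<in> {1..m} \<Longrightarrow> y \<in> K j \<Longrightarrow> 0 \<le> N j y \<bullet> y / \<zeta> j"
  using metric_on_nonneg[OF N_metric] \<zeta>[of j] by (simp add: less_imp_le)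

lemma ip_nonneg: "(\<And>j. j \<in> {1..m} \<Longrightarrow> y j \<in> K j) \<Longrightarrow> 0 \<le> ip x y x y"
  unfolding ip_def by (intro add_nonneg_nonneg sum_nonneg ip_node_nonneg ip_dual_nonneg)

lemma lyap_nonneg: "equilibrium z' s' v d' \<Longrightarrow> 0 \<le> lyap (z k) (s k) z' s'"
  by (intro ip_nonneg subspace_diff K_subspace s_in_K equilibrium_in_K)

definition decrease :: "nat \<Rightarrow> (nat \<Rightarrow> 'h) \<Rightarrow> (nat \<Rightarrow> 'k) \<Rightarrow> real" where
  "decrease k z' s' = lyap (z k) (s k) z' s' - lyap (z (Suc k)) (s (Suc k)) z' s'"

lemma decrease_bound:
  assumes "equilibrium z' s' v d'"
  shows "(\<Sum>i\<in>{1..<n}. slackA i * (norm (u k i - u k (pa i)))\<^sup>2) +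
      (\<Sum>j\<in>{1..m}. slackB j * (norm (t k j - s k j))\<^sup>2) +
      (\<Sum>i\<in>{1..<n}. \<Sum>l\<in>cellP S i. 2 * beta S l *
         (norm (C l (u k (pa i)) - C l v + (1 / (2 * beta S l)) *\<^sub>R (u k i - u k (pa i))))\<^sup>2) +
      (\<Sum>j\<in>{1..m}. 2 * \<rho> j * (norm (d k j - d' j + (1 / (2 * \<rho> j)) *\<^sub>R (t k j - s k j)))\<^sup>2)
    \<le> decrease k z' s'"
proof -
  have "lyap (z (Suc k)) (s (Suc k)) z' s' = lyap (\<lambda>i. z k i + \<theta> i *\<^sub>R (u k i - u k (pa i)))
      (\<lambda>j. s k j + \<zeta> j *\<^sub>R (t k j - s k j)) z' s'"
    unfolding ip_def using step_z step_s
    by (intro arg_cong2[where f = "(+)"] sum.cong refl) simp_all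
  then show ?thesis
    using lyap_descent[where z = "z k" and s = "s k" and u = "u k" and t = "t k" and d = "d k",
        OF step_A step_D step_B assms]
    unfolding decrease_def by simp
qed

lemma
  shows slackA_term_nonneg: "i \<in> {1..<n} \<Longrightarrow> 0 \<le> slackA i * x\<^sup>2"
    and slackB_term_nonneg: "j \<in> {1..m} \<Longrightarrow> 0 \<le> slackB j * x\<^sup>2"
    and beta_term_nonneg: "i \<in> {1..<n} \<Longrightarrow> l \<in> cellP S i \<Longrightarrow> 0 \<le> 2 * beta S l * x\<^sup>2"
    and rho_term_nonneg: "j \<in> {1..m} \<Longrightarrow> 0 \<le> 2 * \<rho> j * x\<^sup>2"
proof -
  show "i \<in> {1..<n} \<Longrightarrow> 0 \<le> slackA i * x\<^sup>2" using slackA_pos[of i] by (simp add: less_imp_le)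
  show "j \<in> {1..m} \<Longrightarrow> 0 \<le> slackB j * x\<^sup>2" using slackB_pos[of j] by (simp add: less_imp_le)
  show "i \<in> {1..<n} \<Longrightarrow> l \<in> cellP S i \<Longrightarrow> 0 \<le> 2 * beta S l * x\<^sup>2"
    using cellP_subset[of i] beta_pos[of l] by (auto intro!: mult_nonneg_nonneg simp: less_imp_le)
  show "j \<in> {1..m} \<Longrightarrow> 0 \<le> 2 * \<rho> j * x\<^sup>2" using \<rho>[of j] by (simp add: less_imp_le)
qed

lemma
  assumes eq: "equilibrium z' s' v d'"
  shows decrease_A: "i \<in> {1..<n} \<Longrightarrow> slackA i * (norm (u k i - u k (pa i)))\<^sup>2 \<le> decrease k z' s'"
    and decrease_B: "j \<in> {1..m} \<Longrightarrow> slackB j * (norm (t k j - s k j))\<^sup>2 \<le> decrease k z' s'"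
    and decrease_C: "i \<in> {1..<n} \<Longrightarrow> l \<in> cellP S i \<Longrightarrow> 2 * beta S l *
         (norm (C l (u k (pa i)) - C l v + (1 / (2 * beta S l)) *\<^sub>R (u k i - u k (pa i))))\<^sup>2
         \<le> decrease k z' s'"
    and decrease_D: "j \<in> {1..m} \<Longrightarrow>
        2 * \<rho> j * (norm (d k j - d' j + (1 / (2 * \<rho> j)) *\<^sub>R (t k j - s k j)))\<^sup>2 \<le> decrease k z' s'"
    and decrease_nonneg: "0 \<le> decrease k z' s'"
proof -
  define eA where "eA i = slackA i * (norm (u k i - u k (pa i)))\<^sup>2" for i
  define eB where "eB j = slackB j * (norm (t k j - s k j))\<^sup>2" for j
  define eC where "eC i l = 2 * beta S l *
      (norm (C l (u k (pa i)) - C l v + (1 / (2 * beta S l)) *\<^sub>R (u k i - u k (pa i))))\<^sup>2" for i l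
  define eD where "eD j = 2 * \<rho> j * (norm (d k j - d' j + (1 / (2 * \<rho> j)) *\<^sub>R (t k j - s k j)))\<^sup>2" for j
  have nonneg: "\<And>i. i \<in> {1..<n} \<Longrightarrow> 0 \<le> eA i" "\<And>j. j \<in> {1..m} \<Longrightarrow> 0 \<le> eB j"
      "\<And>i l. i \<in> {1..<n} \<Longrightarrow> l \<in> cellP S i \<Longrightarrow> 0 \<le> eC i l" "\<And>j. j \<in> {1..m} \<Longrightarrow> 0 \<le> eD j"
    unfolding eA_def eB_def eC_def eD_def
    using slackA_term_nonneg slackB_term_nonneg beta_term_nonneg rho_term_nonneg by blast+
  have sums: "0 \<le> (\<Sum>i\<in>{1..<n}. eA i)" "0 \<le> (\<Sum>j\<in>{1..m}. eB j)"
      "0 \<le> (\<Sum>i\<in>{1..<n}. \<Sum>l\<in>cellP S i. eC i l)" "0 \<le> (\<Sum>j\<in>{1..m}. eD j)"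
    using nonneg by (auto intro!: sum_nonneg simp del: One_nat_def)
  note bound = decrease_bound[OF eq, of k, folded eA_def eB_def eC_def eD_def]
  show "0 \<le> decrease k z' s'" using bound sums by linarith
  show "i \<in> {1..<n} \<Longrightarrow> eA i \<le> decrease k z' s'"
    using member_le_sum[of i "{1..<n}" eA] nonneg(1) bound sums by fastforce
  show "j \<in> {1..m} \<Longrightarrow> eB j \<le> decrease k z' s'"
    using member_le_sum[of j "{1..m}" eB] nonneg(2) bound sums by fastforce
  show "j \<in> {1..m} \<Longrightarrow> eD j \<le> decrease k z' s'"
    using member_le_sum[of j "{1..m}" eD] nonneg(4) bound sums by fastforce
  show "eC i l \<le> decrease k z' s'" if "i \<in> {1..<n}" "l \<in> cellP S i"
  proof -
    have "eC i l \<le> (\<Sum>l\<in>cellP S i. eC i l)"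
      using that nonneg(3) by (intro member_le_sum) auto
    also have "\<dots> \<le> (\<Sum>i\<in>{1..<n}. \<Sum>l\<in>cellP S i. eC i l)"
      using that nonneg(3) by (intro member_le_sum[where f = "\<lambda>i. \<Sum>l\<in>cellP S i. eC i l"])
        (auto intro!: sum_nonneg)
    finally show ?thesis using bound sums by linarith
  qed
qed

lemma lyap_convergent:
  assumes "equilibrium z' s' v d'"
  shows "convergent (\<lambda>k. lyap (z k) (s k) z' s')"
proof (rule decseq_convergent[THEN exE])
  show "decseq (\<lambda>k. lyap (z k) (s k) z' s')"
    using decrease_nonneg[OF assms] by (intro decseq_SucI) (simp add: decrease_def)
qed (use lyap_nonneg[OF assms] in \<open>auto simp: convergent_def\<close>)

lemma lyap_le_initial:
  assumes "equilibrium z' s' v d'"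
  shows "lyap (z k) (s k) z' s' \<le> lyap (z 0) (s 0) z' s'"
  using decrease_nonneg[OF assms] by (induction k) (auto simp: decrease_def intro: order_trans)

lemma decrease_tendsto_0:
  assumes "equilibrium z' s' v d'"
  shows "(\<lambda>k. decrease k z' s') \<longlonglongrightarrow> 0"
proof -
  obtain l where l: "(\<lambda>k. lyap (z k) (s k) z' s') \<longlonglongrightarrow> l"
    using lyap_convergent[OF assms] by (auto simp: convergent_def)
  show ?thesis using tendsto_diff[OF l LIMSEQ_Suc[OF l]] by (simp add: decrease_def)
qed

lemma edge_null: "i \<in> {1..<n} \<Longrightarrow> (\<lambda>k. u k i - u k (pa i)) \<longlonglongrightarrow> 0"
  using tendsto_0_of_square_bound[OF slackA_pos decrease_A[OF reference] decrease_tendsto_0[OF reference]] .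

lemma dual_null: "j \<in> {1..m} \<Longrightarrow> (\<lambda>k. t k j - s k j) \<longlonglongrightarrow> 0"
  using tendsto_0_of_square_bound[OF slackB_pos decrease_B[OF reference] decrease_tendsto_0[OF reference]] .

text \<open>The completed square controls the difference of values only up to a multiple of the edge
  step, and that step is already known to be null. The same reasoning gives
  \<open>d_tendsto\<close>.\<close>

lemma C_tendsto:
  assumes i: "i \<in> {1..<n}" and l: "l \<in> cellP S i"
  shows "(\<lambda>k. C l (u k (pa i))) \<longlonglongrightarrow> C l v\<^sub>r"
proof -
  have "0 < 2 * beta S l" using cellP_subset[of i] i l beta_pos[of l] by auto
  from tendsto_0_of_square_bound[OF this decrease_C[OF reference i l] decrease_tendsto_0[OF reference]]
  have "(\<lambda>k. C l (u k (pa i)) - C l v\<^sub>r + (1 / (2 * beta S l)) *\<^sub>R (u k i - u k (pa i))) \<longlonglongrightarrow> 0" .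
  from tendsto_diff[OF this tendsto_scaleR[OF tendsto_const edge_null[OF i], of "1 / (2 * beta S l)"]]
  show ?thesis by (simp add: LIM_zero_iff)
qed

lemma d_tendsto:
  assumes j: "j \<in> {1..m}"
  shows "(\<lambda>k. d k j) \<longlonglongrightarrow> d\<^sub>r j"
proof -
  have "0 < 2 * \<rho> j" using \<rho>[OF j] by simp
  from tendsto_0_of_square_bound[OF this decrease_D[OF reference j] decrease_tendsto_0[OF reference]]
  have "(\<lambda>k. d k j - d\<^sub>r j + (1 / (2 * \<rho> j)) *\<^sub>R (t k j - s k j)) \<longlonglongrightarrow> 0" .
  from tendsto_diff[OF this tendsto_scaleR[OF tendsto_const dual_null[OF j], of "1 / (2 * \<rho> j)"]]
  show ?thesis by (simp add: LIM_zero_iff)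
qed

section \<open>Boundedness of the iterates\<close>

lemma z_bounded:
  assumes i: "i \<in> {1..<n}"
  shows "\<exists>b. \<forall>k. norm (z k i) \<le> b"
proof -
  obtain r where r: "0 < r" "\<And>x. r * (norm x)\<^sup>2 \<le> M i x \<bullet> x"
    using metric_on_pos[OF M_metric[OF i]] UNIV_I by metis
  define c where "c = lyap (z 0) (s 0) z\<^sub>r s\<^sub>r * \<theta> i / r"
  have "norm (z k i) \<le> norm (z\<^sub>r i) + sqrt c" for k
  proof -
    have "M i (z k i - z\<^sub>r i) \<bullet> (z k i - z\<^sub>r i) / \<theta> i \<le>
        (\<Sum>i\<in>{1..<n}. M i (z k i - z\<^sub>r i) \<bullet> (z k i - z\<^sub>r i) / \<theta> i)"
      using i by (intro member_le_sum[where f = "\<lambda>i. M i (z k i - z\<^sub>r i) \<bullet> (z k i - z\<^sub>r i) / \<theta> i"]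
          ip_node_nonneg) auto
    moreover have "0 \<le> (\<Sum>j\<in>{1..m}. N j (s k j - s\<^sub>r j) \<bullet> (s k j - s\<^sub>r j) / \<zeta> j)"
      by (intro sum_nonneg ip_dual_nonneg subspace_diff K_subspace s_in_K
          equilibrium_in_K[OF reference])
    ultimately have "M i (z k i - z\<^sub>r i) \<bullet> (z k i - z\<^sub>r i) / \<theta> i \<le> lyap (z 0) (s 0) z\<^sub>r s\<^sub>r"
      using lyap_le_initial[OF reference, of k] unfolding ip_def by linarith
    then have "r * (norm (z k i - z\<^sub>r i))\<^sup>2 \<le> lyap (z 0) (s 0) z\<^sub>r s\<^sub>r * \<theta> i"
      using r(2)[of "z k i - z\<^sub>r i"] \<theta>[OF i] by (simp add: divide_le_eq)
    then have "(norm (z k i - z\<^sub>r i))\<^sup>2 \<le> c"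
      using r(1) by (simp add: c_def le_divide_eq mult.commute)
    then have "norm (z k i - z\<^sub>r i) \<le> sqrt c" by (rule real_le_rsqrt)
    then show ?thesis using norm_triangle_sub[of "z k i" "z\<^sub>r i"] by linarith
  qed
  then show ?thesis by blast
qed

lemma s_bounded:
  assumes j: "j \<in> {1..m}"
  shows "\<exists>b. \<forall>k. norm (s k j) \<le> b"
proof -
  obtain r where r: "0 < r" "\<And>x. x \<in> K j \<Longrightarrow> r * (norm x)\<^sup>2 \<le> N j x \<bullet> x"
    using metric_on_pos[OF N_metric[OF j]] by metis
  define c where "c = lyap (z 0) (s 0) z\<^sub>r s\<^sub>r * \<zeta> j / r"
  have diff: "s k j - s\<^sub>r j \<in> K j" if "j \<in> {1..m}" for j k
    using that by (intro subspace_diff K_subspace s_in_K equilibrium_in_K[OF reference])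
  have "norm (s k j) \<le> norm (s\<^sub>r j) + sqrt c" for k
  proof -
    have "N j (s k j - s\<^sub>r j) \<bullet> (s k j - s\<^sub>r j) / \<zeta> j \<le>
        (\<Sum>j\<in>{1..m}. N j (s k j - s\<^sub>r j) \<bullet> (s k j - s\<^sub>r j) / \<zeta> j)"
      using j by (intro member_le_sum[where f = "\<lambda>j. N j (s k j - s\<^sub>r j) \<bullet> (s k j - s\<^sub>r j) / \<zeta> j"]
          ip_dual_nonneg diff) auto
    moreover have "0 \<le> (\<Sum>i\<in>{1..<n}. M i (z k i - z\<^sub>r i) \<bullet> (z k i - z\<^sub>r i) / \<theta> i)"
      by (intro sum_nonneg ip_node_nonneg)
    ultimately have "N j (s k j - s\<^sub>r j) \<bullet> (s k j - s\<^sub>r j) / \<zeta> j \<le> lyap (z 0) (s 0) z\<^sub>r s\<^sub>r"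
      using lyap_le_initial[OF reference, of k] unfolding ip_def by linarith
    then have "r * (norm (s k j - s\<^sub>r j))\<^sup>2 \<le> lyap (z 0) (s 0) z\<^sub>r s\<^sub>r * \<zeta> j"
      using r(2)[OF diff[OF j, of k]] \<zeta>[OF j] by (simp add: divide_le_eq)
    then have "(norm (s k j - s\<^sub>r j))\<^sup>2 \<le> c"
      using r(1) by (simp add: c_def le_divide_eq mult.commute)
    then have "norm (s k j - s\<^sub>r j) \<le> sqrt c" by (rule real_le_rsqrt)
    then show ?thesis using norm_triangle_sub[of "s k j" "s\<^sub>r j"] by linarith
  qed
  then show ?thesis by blast
qed

text \<open>The Lyapunov function does not involve \<open>u\<close>. At the root, monotonicity of
  \<open>A 0\<close> against the reference and coercivity of a child metric give
  \<open>r * (norm U)\<^sup>2 \<le> norm U * q\<close>.\<close>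

lemma u_root_bounded: "\<exists>b. \<forall>k. norm (u k 0) \<le> b"
proof -
  have "\<forall>i\<in>{1..<n}. \<exists>b. \<forall>k. norm (z k i - z\<^sub>r i) \<le> b"
    by (intro ballI bounded_diff_const z_bounded)
  then obtain bz where bz: "\<And>i k. i \<in> {1..<n} \<Longrightarrow> norm (z k i - z\<^sub>r i) \<le> bz i" by metis
  have "\<forall>j\<in>{1..m}. \<exists>b. \<forall>k. norm (s k j - s\<^sub>r j) \<le> b"
    by (intro ballI bounded_diff_const s_bounded)
  then obtain bs where bs: "\<And>j k. j \<in> {1..m} \<Longrightarrow> norm (s k j - s\<^sub>r j) \<le> bs j" by metis
  obtain c where c: "c \<in> ch S 0" using ch_root_nonempty by blast
  then obtain r where r: "0 < r" "\<And>x. r * (norm x)\<^sup>2 \<le> M c x \<bullet> x"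
    using metric_on_pos[OF M_metric, of c] unfolding ch_iff by (metis UNIV_I)
  \<comment> \<open>Bounds the displacement of the data of the root inclusion from that of the
    reference, uniformly in \<open>k\<close>.\<close>
  define q where "q = (\<Sum>c\<in>ch S 0. onorm (M c) * bz c) + (\<Sum>j\<in>cellJ S 0. onorm (L j) * bs j)"
  have n0: "0 < n" using n_ge_2 by simp
  have "norm (u k 0) \<le> norm v\<^sub>r + q / r" for k
  proof -
    define U where "U = u k 0 - v\<^sub>r"
    have "0 \<le> U \<bullet> (selA (z k) (s k) (u k) (t k) 0 - selA z\<^sub>r s\<^sub>r (\<lambda>_. v\<^sub>r) s\<^sub>r 0)"
      unfolding U_def using step_A[OF n0] reference n0
      by (intro maximally_monotone_on_monotoneD[OF A_maximal[OF n0]]) (auto simp: equilibrium_def)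
    then have "0 \<le> - (\<Sum>c\<in>ch S 0. U \<bullet> M c (U - (z k c - z\<^sub>r c))) -
        (\<Sum>j\<in>cellJ S 0. U \<bullet> Ls j (s k j - s\<^sub>r j))"
      unfolding selA_diff[OF n0] U_def by (simp add: inner_sum_right inner_diff_right)
    moreover have "(\<Sum>c\<in>ch S 0. U \<bullet> M c (U - (z k c - z\<^sub>r c))) =
        (\<Sum>c\<in>ch S 0. M c U \<bullet> U) - (\<Sum>c\<in>ch S 0. U \<bullet> M c (z k c - z\<^sub>r c))"
      unfolding sum_subtractf[symmetric]
    proof (rule sum.cong[OF refl])
      fix c assume "c \<in> ch S 0"
      then have "M c (U - (z k c - z\<^sub>r c)) = M c U - M c (z k c - z\<^sub>r c)"
        using linear_diff[OF bounded_linear.linear[OF M_bounded_linear]] by (simp add: ch_iff)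
      then show "U \<bullet> M c (U - (z k c - z\<^sub>r c)) = M c U \<bullet> U - U \<bullet> M c (z k c - z\<^sub>r c)"
        by (simp add: inner_diff_right inner_commute)
    qed
    moreover have "M c U \<bullet> U \<le> (\<Sum>c\<in>ch S 0. M c U \<bullet> U)"
      using c by (intro member_le_sum[where f = "\<lambda>c. M c U \<bullet> U"]) (auto simp: ch_iff metric_on_nonneg[OF M_metric])
    moreover have "(\<Sum>c\<in>ch S 0. U \<bullet> M c (z k c - z\<^sub>r c)) \<le> (\<Sum>c\<in>ch S 0. norm U * (onorm (M c) * bz c))"
    proof (rule sum_mono)
      fix c assume "c \<in> ch S 0"
      then have c: "c \<in> {1..<n}" by (simp add: ch_iff)
      have "U \<bullet> M c (z k c - z\<^sub>r c) \<le> norm U * norm (M c (z k c - z\<^sub>r c))" by (rule norm_cauchy_schwarz)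
      also have "norm (M c (z k c - z\<^sub>r c)) \<le> onorm (M c) * norm (z k c - z\<^sub>r c)"
        by (rule onorm[OF M_bounded_linear[OF c]])
      also have "\<dots> \<le> onorm (M c) * bz c"
        by (intro mult_left_mono bz c onorm_pos_le M_bounded_linear)
      finally show "U \<bullet> M c (z k c - z\<^sub>r c) \<le> norm U * (onorm (M c) * bz c)"
        by (simp add: mult_left_mono)
    qed
    moreover have "(\<Sum>j\<in>cellJ S 0. - (U \<bullet> Ls j (s k j - s\<^sub>r j))) \<le>
        (\<Sum>j\<in>cellJ S 0. norm U * (onorm (L j) * bs j))"
    proof (rule sum_mono)
      fix j assume "j \<in> cellJ S 0"
      then have j: "j \<in> {1..m}" using cellJ_subset[OF n0] by blast
      have "- (U \<bullet> Ls j (s k j - s\<^sub>r j)) \<le> norm (L j U) * norm (s k j - s\<^sub>r j)"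
        unfolding adjoint_hilbert[OF L_bounded_linear[OF j]]
        using Cauchy_Schwarz_ineq2[of "L j U" "s k j - s\<^sub>r j"] by linarith
      also have "\<dots> \<le> (onorm (L j) * norm U) * bs j"
        by (intro mult_mono onorm[OF L_bounded_linear[OF j]] bs j norm_ge_zero mult_nonneg_nonneg
            onorm_pos_le[OF L_bounded_linear[OF j]])
      finally show "- (U \<bullet> Ls j (s k j - s\<^sub>r j)) \<le> norm U * (onorm (L j) * bs j)" by (simp add: mult_ac)
    qed
    ultimately have "r * (norm U)\<^sup>2 \<le> norm U * q"
      using r(2)[of U] unfolding q_def distrib_left sum_distrib_left[symmetric] sum_negf by linarith
    have "0 \<le> bz i" if "i \<in> {1..<n}" for i by (rule order_trans[OF norm_ge_zero bz[OF that]])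
    moreover have "0 \<le> bs j" if "j \<in> cellJ S 0" for j
      by (rule order_trans[OF norm_ge_zero bs]) (use cellJ_subset[OF n0] that in blast)
    ultimately have q: "0 \<le> q"
      unfolding q_def using cellJ_subset[OF n0]
      by (intro add_nonneg_nonneg sum_nonneg mult_nonneg_nonneg onorm_pos_le M_bounded_linear L_bounded_linear)
         (auto simp: ch_iff)
    have "norm U \<le> q / r"
    proof (cases "U = 0")
      case False
      with \<open>r * (norm U)\<^sup>2 \<le> norm U * q\<close> have "r * norm U \<le> q" by (simp add: power2_eq_square)
      then show ?thesis using r(1) by (simp add: le_divide_eq mult.commute)
    qed (use q r(1) in simp)
    then show ?thesis using norm_triangle_sub[of "u k 0" v\<^sub>r] unfolding U_def by linarith
  qed
  then show ?thesis by blast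
qed

text \<open>Boundedness spreads from the root along the edges, since the edge steps form convergent
  sequences.\<close>

lemma u_bounded:
  assumes "i < n"
  shows "\<exists>b. \<forall>k. norm (u k i) \<le> b"
  using assms
proof (induction i rule: node_induct)
  case root
  show ?case by (rule u_root_bounded)
next
  case (child i)
  then obtain b where b: "\<And>k. norm (u k (pa i)) \<le> b" by blast
  have "Bseq (\<lambda>k. u k i - u k (pa i))"
    using edge_null[OF child(1)] by (intro convergent_imp_Bseq convergentI)
  then obtain c where c: "\<And>k. norm (u k i - u k (pa i)) \<le> c" by (auto simp: Bseq_def)
  have "norm (u k i) \<le> b + c" for k
    using norm_triangle_sub[of "u k i" "u k (pa i)"] b[of k] c[of k] by linarith
  then show ?case by blast
qed

lemma t_bounded:
  assumes j: "j \<in> {1..m}"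
  shows "\<exists>b. \<forall>k. norm (t k j) \<le> b"
proof -
  obtain b where b: "\<And>k. norm (s k j) \<le> b" using s_bounded[OF j] by blast
  have "Bseq (\<lambda>k. t k j - s k j)"
    using dual_null[OF j] by (intro convergent_imp_Bseq convergentI)
  then obtain c where c: "\<And>k. norm (t k j - s k j) \<le> c" by (auto simp: Bseq_def)
  have "norm (t k j) \<le> b + c" for k
    using norm_triangle_sub[of "t k j" "s k j"] b[of k] c[of k] by linarith
  then show ?thesis by blast
qed

text \<open>Edge and dual steps vanish, so all \<open>u k i\<close> share one weak limit and
  \<open>t k j\<close> has that of \<open>s k j\<close>. The strongly convergent values settle
  \<open>C l\<close> and \<open>D j\<close>; then all \<open>A i\<close> and \<open>B j\<close> are
  handled together through their total duality product.\<close>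

lemma cluster_equilibrium:
  assumes G: "G \<noteq> bot" "G \<le> sequentially"
    and z': "\<And>i. i \<in> {1..<n} \<Longrightarrow> weakly_tendsto (\<lambda>k. z k i) (z' i) G"
    and s': "\<And>j. j \<in> {1..m} \<Longrightarrow> weakly_tendsto (\<lambda>k. s k j) (s' j) G"
    and root: "weakly_tendsto (\<lambda>k. u k 0) v G"
    and ext: "z' \<in> extensional {1..<n}" "s' \<in> extensional {1..m}"
  shows "equilibrium z' s' v d\<^sub>r"
proof -
  define e where "e i k = u k i - u k (pa i)" for i k
  define w where "w j k = t k j - s k j" for j k
  have e: "(e i \<longlongrightarrow> 0) G" if "i \<in> {1..<n}" for i
    unfolding e_def[abs_def] by (rule tendsto_mono[OF G(2) edge_null[OF that]])
  have w: "(w j \<longlongrightarrow> 0) G" if "j \<in> {1..m}" for j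
    unfolding w_def[abs_def] by (rule tendsto_mono[OF G(2) dual_null[OF that]])
  have Clim: "((\<lambda>k. C l (u k (pa i))) \<longlongrightarrow> C l v\<^sub>r) G" if "i \<in> {1..<n}" "l \<in> cellP S i" for i l
    by (rule tendsto_mono[OF G(2) C_tendsto[OF that]])
  have dlim: "((\<lambda>k. d k j) \<longlongrightarrow> d\<^sub>r j) G" if "j \<in> {1..m}" for j
    by (rule tendsto_mono[OF G(2) d_tendsto[OF that]])
  have u: "weakly_tendsto (\<lambda>k. u k i) v G" if "i < n" for i
    using that
  proof (induction i rule: node_induct)
    case (child i)
    show ?case using weakly_tendsto_add[OF weakly_tendsto_of_tendsto[OF e[OF child(1)]] child(2)]
      by (simp add: e_def)
  qed (rule root)
  have t: "weakly_tendsto (\<lambda>k. t k j) (s' j) G" if "j \<in> {1..m}" for j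
    using weakly_tendsto_add[OF weakly_tendsto_of_tendsto[OF w[OF that]] s'[OF that]] by (simp add: w_def)
  have s'K: "s' j \<in> K j" if "j \<in> {1..m}" for j
    using weakly_tendsto_closed_subspace[OF K_subspace K_closed s' s_in_K G(1)] that by blast
  have d\<^sub>rK: "d\<^sub>r j \<in> K j" if "j \<in> {1..m}" for j
    using maximally_monotone_on_carrierD(1)[OF D_maximal[OF that]] reference that
    unfolding equilibrium_def by blast
  \<comment> \<open>Cocoercivity between \<open>u k (pa i)\<close> and \<open>v\<close> is passed to
    the limit: the right side is weakly null times strongly convergent, so the values at
    \<open>v\<^sub>r\<close> and at \<open>v\<close> coincide.\<close>
  have C_eq: "C l v\<^sub>r = C l v" if i: "i \<in> {1..<n}" and l: "l \<in> cellP S i" for i l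
  proof -
    have lp: "l \<in> {1..p_of S}" using cellP_subset[of i] i l by auto
    obtain b where b: "\<And>k. norm (u k (pa i) - v) \<le> b"
      using bounded_diff_const[OF u_bounded[OF pa_less[OF i]]] by blast
    have "weakly_tendsto (\<lambda>k. u k (pa i) - v) 0 G"
      using u[OF pa_less[OF i]] by (simp add: weakly_tendsto_diff_iff[symmetric])
    then have "((\<lambda>k. (u k (pa i) - v) \<bullet> (C l (u k (pa i)) - C l v)) \<longlongrightarrow> 0 \<bullet> (C l v\<^sub>r - C l v)) G"
      by (rule weakly_tendsto_inner_tendsto[OF _ b tendsto_diff[OF Clim[OF i l] tendsto_const]])
    moreover have "((\<lambda>k. beta S l * (norm (C l (u k (pa i)) - C l v))\<^sup>2) \<longlongrightarrow>
        beta S l * (norm (C l v\<^sub>r - C l v))\<^sup>2) G"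
      by (intro tendsto_mult tendsto_const tendsto_power tendsto_norm tendsto_diff Clim[OF i l])
    ultimately have "beta S l * (norm (C l v\<^sub>r - C l v))\<^sup>2 \<le> 0 \<bullet> (C l v\<^sub>r - C l v)"
      using C_cocoercive[OF lp] by (intro tendsto_le[OF G(1)]) (auto simp: cocoercive_def)
    then show ?thesis using beta_pos[OF lp] by (simp add: mult_le_0_iff)
  qed
  have g: "((\<lambda>k. C l (u k (pa i)) - C l v) \<longlongrightarrow> 0) G" if "i \<in> {1..<n}" "l \<in> cellP S i" for i l
    using LIM_zero[OF Clim[OF that]] C_eq[OF that] by simp
  have \<eta>: "((\<lambda>k. d k j - d\<^sub>r j) \<longlongrightarrow> 0) G" if "j \<in> {1..m}" for j
    by (rule LIM_zero[OF dlim[OF that]])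
  \<comment> \<open>Here one factor converges strongly, so the monotonicity inequality survives the
    limit and maximality of \<open>D j\<close> applies directly.\<close>
  have D_graph: "s' j \<in> D j (d\<^sub>r j)" if j: "j \<in> {1..m}" for j
  proof (rule maximally_monotone_onI[OF D_maximal[OF j] d\<^sub>rK[OF j] s'K[OF j]])
    fix y q assume q: "q \<in> D j y"
    obtain b where b: "\<And>k. norm (s k j - q) \<le> b" using bounded_diff_const[OF s_bounded[OF j]] by blast
    have lim: "((\<lambda>k. (s k j - q) \<bullet> (d k j - y)) \<longlongrightarrow> (s' j - q) \<bullet> (d\<^sub>r j - y)) G"
      by (rule weakly_tendsto_inner_tendsto[OF weakly_tendsto_diff[OF s'[OF j] weakly_tendsto_const] b
          tendsto_diff[OF dlim[OF j] tendsto_const]])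
    have "0 \<le> (s k j - q) \<bullet> (d k j - y)" for k
      using maximally_monotone_on_monotoneD[OF D_maximal[OF j] step_D[OF j] q] by (simp add: inner_commute)
    then have "0 \<le> (s' j - q) \<bullet> (d\<^sub>r j - y)" by (intro tendsto_lowerbound[OF lim _ G(1)]) simp
    then show "0 \<le> (d\<^sub>r j - y) \<bullet> (s' j - q)" by (simp add: inner_commute)
  qed
  have Nw: "((\<lambda>k. N j (w j k)) \<longlongrightarrow> 0) G" if j: "j \<in> {1..m}" for j
    using metric_on_tendsto_0[OF N_metric[OF j] _ w[OF j]] subspace_diff[OF K_subspace[OF j]]
      t_in_K[OF j] s_in_K[OF j] by (simp add: w_def)
  define a where "a i k = selA (z k) (s k) (u k) (t k) i" for i k
  define b where "b j k = selB (s k) (u k) (t k) (d k) j" for j k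
  define a' where "a' = selA z' s' (\<lambda>_. v) s'"
  define b' where "b' = selB s' (\<lambda>_. v) s' d\<^sub>r"
  have null: "weakly_tendsto (\<lambda>k. X k - x) 0 G" if "weakly_tendsto X x G" for X :: "nat \<Rightarrow> 'h" and x
    using that by (simp add: weakly_tendsto_diff_iff[symmetric])
  have nullK: "weakly_tendsto (\<lambda>k. X k - x) 0 G" if "weakly_tendsto X x G" for X :: "nat \<Rightarrow> 'k" and x
    using that by (simp add: weakly_tendsto_diff_iff[symmetric])
  have M_null: "weakly_tendsto (\<lambda>k. M i (X k)) 0 G"
    if "weakly_tendsto X 0 G" "i \<in> {1..<n}" for X i
    using weakly_tendsto_bounded_linear[OF M_bounded_linear[OF that(2)] that(1)]
      linear_0[OF bounded_linear.linear[OF M_bounded_linear[OF that(2)]]] by simp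
  have Ls_null: "weakly_tendsto (\<lambda>k. Ls j (X k)) 0 G" if "weakly_tendsto X 0 G" "j \<in> {1..m}" for X j
    using weakly_tendsto_adjoint[OF L_bounded_linear[OF that(2)] that(1)] Ls_0[OF that(2)] by simp
  have sum_null: "weakly_tendsto (\<lambda>k. \<Sum>x\<in>X. f x k) 0 G" if "\<And>x. x \<in> X \<Longrightarrow> weakly_tendsto (f x) 0 G"
    for X :: "nat set" and f :: "nat \<Rightarrow> nat \<Rightarrow> 'h"
    using weakly_tendsto_sum[OF that, of X] by simp
  have a_lim: "weakly_tendsto (a i) (a' i) G" if i: "i < n" for i
  proof -
    have ch: "weakly_tendsto (\<lambda>k. \<Sum>c\<in>ch S i. M c ((u k i - v) - (z k c - z' c))) 0 G"
      using weakly_tendsto_diff[OF null[OF u[OF i]] null[OF z']]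
      by (intro sum_null M_null) (simp_all add: ch_iff)
    have J: "weakly_tendsto (\<lambda>k. \<Sum>j\<in>cellJ S i. Ls j (s k j - s' j)) 0 G"
      using cellJ_subset[OF i] by (intro sum_null Ls_null nullK s') auto
    have tail: "weakly_tendsto (\<lambda>k. (\<Sum>c\<in>ch S i. M c ((u k i - v) - (z k c - z' c))) +
        (\<Sum>j\<in>cellJ S i. Ls j (s k j - s' j))) 0 G"
      using weakly_tendsto_add[OF ch J] by simp
    have "weakly_tendsto (\<lambda>k. a i k - a' i) 0 G"
    proof (cases "i = 0")
      case True
      have "a i k - a' i = (-1) *\<^sub>R ((\<Sum>c\<in>ch S i. M c ((u k i - v) - (z k c - z' c))) +
          (\<Sum>j\<in>cellJ S i. Ls j (s k j - s' j)))" for k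
        using True unfolding a_def a'_def selA_diff[OF i] by simp
      then show ?thesis using weakly_tendsto_scaleR[OF tail, of "-1"] by (simp only: scaleR_zero_right)
    next
      case False
      with i have i1: "i \<in> {1..<n}" by simp
      have "weakly_tendsto (\<lambda>k. (u k i - v) + (z k i - z' i) - 2 *\<^sub>R (u k (pa i) - v)) 0 G"
        using weakly_tendsto_diff[OF weakly_tendsto_add[OF null[OF u[OF i]] null[OF z'[OF i1]]]
            weakly_tendsto_scaleR[OF null[OF u[OF pa_less[OF i1]]], of 2]] by simp
      then have Mi: "weakly_tendsto (\<lambda>k. M i ((u k i - v) + (z k i - z' i) - 2 *\<^sub>R (u k (pa i) - v))) 0 G"
        by (rule M_null[OF _ i1])
      have P: "weakly_tendsto (\<lambda>k. \<Sum>l\<in>cellP S i. C l (u k (pa i)) - C l v) 0 G"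
        by (intro sum_null weakly_tendsto_of_tendsto g i1)
      have Jc: "weakly_tendsto (\<lambda>k. \<Sum>j\<in>cellJc S i. Ls j (t k j - s k j)) 0 G"
        using cellJc_subset'[OF i1] w
        by (intro sum_null Ls_null weakly_tendsto_of_tendsto) (auto simp: w_def[abs_def] subset_iff)
      have "a i k - a' i = (-1) *\<^sub>R (M i ((u k i - v) + (z k i - z' i) - 2 *\<^sub>R (u k (pa i) - v)) +
          (\<Sum>l\<in>cellP S i. C l (u k (pa i)) - C l v) + (\<Sum>j\<in>cellJc S i. Ls j (t k j - s k j)) +
          ((\<Sum>c\<in>ch S i. M c ((u k i - v) - (z k c - z' c))) +
            (\<Sum>j\<in>cellJ S i. Ls j (s k j - s' j))))" for k
        using False unfolding a_def a'_def selA_diff[OF i] by simp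
      then show ?thesis
        using weakly_tendsto_scaleR[OF weakly_tendsto_add[OF weakly_tendsto_add[OF
              weakly_tendsto_add[OF Mi P] Jc] tail], of "-1"]
        by (simp only: scaleR_zero_right add_0_left)
    qed
    then show ?thesis by (simp add: weakly_tendsto_diff_iff[symmetric])
  qed
  have b_lim: "weakly_tendsto (b j) (b' j) G" if j: "j \<in> {1..m}" for j
  proof -
    have "weakly_tendsto (\<lambda>k. L j (u k (own j) - v)) 0 G"
      using weakly_tendsto_bounded_linear[OF L_bounded_linear[OF j] null[OF u[OF own_cell(1)[OF j]]]]
        linear_0[OF bounded_linear.linear[OF L_bounded_linear[OF j]]] by simp
    from weakly_tendsto_diff[OF weakly_tendsto_diff[OF this weakly_tendsto_of_tendsto[OF Nw[OF j]]]
        weakly_tendsto_of_tendsto[OF \<eta>[OF j]]]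
    have "weakly_tendsto (\<lambda>k. b j k - b' j) 0 G"
      unfolding b_def b'_def selB_diff[OF j] by (simp add: w_def)
    then show ?thesis by (simp add: weakly_tendsto_diff_iff[symmetric])
  qed
  have prod: "((\<lambda>k. X k \<bullet> Y k) \<longlongrightarrow> 0) G" if "\<exists>b. \<forall>k. norm (X k) \<le> b" "(Y \<longlongrightarrow> 0) G"
    for X Y :: "nat \<Rightarrow> 'h" using tendsto_inner_bounded_null[OF _ that(2), of X] that(1) by blast
  have prodK: "((\<lambda>k. X k \<bullet> Y k) \<longlongrightarrow> 0) G" if "\<exists>b. \<forall>k. norm (X k) \<le> b" "(Y \<longlongrightarrow> 0) G"
    for X Y :: "nat \<Rightarrow> 'k" using tendsto_inner_bounded_null[OF _ that(2), of X] that(1) by blast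
  \<comment> \<open>\<open>energy_balance\<close> is an identity for arbitrary data, so there is no
    circularity in applying it before \<open>(z', s')\<close> is known to be an equilibrium. Every
    term on its right side is a product of a bounded and a null factor.\<close>
  have energy: "((\<lambda>k. (\<Sum>i\<in>{..<n}. (u k i - v) \<bullet> (a i k - a' i)) +
      (\<Sum>j\<in>{1..m}. (t k j - s' j) \<bullet> (b j k - b' j))) \<longlongrightarrow> 0) G"
  proof -
    have Me: "((\<lambda>k. M i (e i k)) \<longlongrightarrow> 0) G" if "i \<in> {1..<n}" for i
      by (rule metric_on_tendsto_0[OF M_metric[OF that] UNIV_I e[OF that]])
    have "((\<lambda>k. M i (e i k) \<bullet> e i k) \<longlongrightarrow> 0) G" if "i \<in> {1..<n}" for i
      using tendsto_inner[OF Me[OF that] e[OF that]] by simp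
    moreover have "((\<lambda>k. M i (z k i - z' i) \<bullet> e i k) \<longlongrightarrow> 0) G" if i: "i \<in> {1..<n}" for i
      unfolding metric_on_selfadjoint[OF M_metric[OF i] UNIV_I UNIV_I]
      by (intro prod Me[OF i] bounded_diff_const z_bounded i)
    moreover have "((\<lambda>k. (u k i - v) \<bullet> (C l (u k (pa i)) - C l v)) \<longlongrightarrow> 0) G"
      if i: "i \<in> {1..<n}" "l \<in> cellP S i" for i l
      using i by (intro prod g[OF i] bounded_diff_const u_bounded) simp
    moreover have "((\<lambda>k. w j k \<bullet> L j (e i k)) \<longlongrightarrow> 0) G" if "i \<in> {1..<n}" "j \<in> cellJc S i" for i j
    proof -
      have j: "j \<in> {1..m}" using cellJc_subset'[OF that(1)] that(2) by blast
      show ?thesis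
        using tendsto_inner[OF w[OF j] bounded_linear.tendsto[OF L_bounded_linear[OF j] e[OF that(1)]]]
        by simp
    qed
    moreover have "((\<lambda>k. w j k \<bullet> N j (w j k)) \<longlongrightarrow> 0) G" if "j \<in> {1..m}" for j
      using tendsto_inner[OF w[OF that] Nw[OF that]] by simp
    moreover have "((\<lambda>k. (s k j - s' j) \<bullet> N j (w j k)) \<longlongrightarrow> 0) G" if "j \<in> {1..m}" for j
      by (intro prodK Nw[OF that] bounded_diff_const s_bounded that)
    moreover have "((\<lambda>k. (t k j - s' j) \<bullet> (d k j - d\<^sub>r j)) \<longlongrightarrow> 0) G" if "j \<in> {1..m}" for j
      by (intro prodK \<eta>[OF that] bounded_diff_const t_bounded that)
    ultimately have "((\<lambda>k. - (\<Sum>i\<in>{1..<n}. M i (e i k) \<bullet> e i k + M i (z k i - z' i) \<bullet> e i k +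
        (\<Sum>l\<in>cellP S i. (u k i - v) \<bullet> (C l (u k (pa i)) - C l v)) + (\<Sum>j\<in>cellJc S i. w j k \<bullet> L j (e i k)))
      - (\<Sum>j\<in>{1..m}. w j k \<bullet> N j (w j k) + (s k j - s' j) \<bullet> N j (w j k) +
          (t k j - s' j) \<bullet> (d k j - d\<^sub>r j)))
      \<longlongrightarrow> - (\<Sum>i\<in>{1..<n}. 0 + 0 + (\<Sum>l\<in>cellP S i. 0) + (\<Sum>j\<in>cellJc S i. 0)) -
          (\<Sum>j\<in>{1..m}. 0 + 0 + 0)) G"
      by (intro tendsto_diff tendsto_minus tendsto_sum tendsto_add)
    then show ?thesis
      unfolding a_def a'_def b_def b'_def energy_balance by (simp add: e_def w_def)
  qed
  have b'K: "b' j \<in> K j" if "j \<in> {1..m}" for j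
    unfolding b'_def selB_equilibrium[OF that]
    by (intro subspace_diff K_subspace L_in_K b_in_K d\<^sub>rK that)
  have stepB': "t k j \<in> B j (b j k)" if "j \<in> {1..m}" for j k
    unfolding b_def by (rule step_B[OF that])
  have stepA': "a i k \<in> A i (u k i)" if "i \<in> {..<n}" for i k
    unfolding a_def using step_A that by simp
  \<comment> \<open>For \<open>B j\<close> the argument is \<open>b\<close> and the value is
    \<open>t\<close>, so the factors trade places.\<close>
  have energy': "((\<lambda>k. (\<Sum>i\<in>{..<n}. (u k i - v) \<bullet> (a i k - a' i)) +
      (\<Sum>j\<in>{1..m}. (b j k - b' j) \<bullet> (t k j - s' j))) \<longlongrightarrow> 0) G"
    using energy by (simp only: inner_commute[of "b _ _ - b' _"])
  note demiclosed = maximally_monotone_family_demiclosed[where I = "{..<n}" and J = "{1..m}" and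
      F = G and V = "\<lambda>_. UNIV" and W = K and A = A and B = B and x = "\<lambda>_. v" and a = a' and
      y = b' and b = s' and x' = "\<lambda>i k. u k i" and a' = a and y' = b and b' = "\<lambda>j k. t k j"]
  have lims: "\<And>i. i \<in> {..<n} \<Longrightarrow> weakly_tendsto (\<lambda>k. u k i) v G \<and> weakly_tendsto (a i) (a' i) G"
      "\<And>j. j \<in> {1..m} \<Longrightarrow> weakly_tendsto (b j) (b' j) G \<and> weakly_tendsto (\<lambda>k. t k j) (s' j) G"
      "\<And>j. j \<in> {1..m} \<Longrightarrow> b' j \<in> K j \<and> s' j \<in> K j"
      "\<And>i. i \<in> {..<n} \<Longrightarrow> maximally_monotone_on UNIV (A i)"
    using u a_lim b_lim t b'K s'K A_maximal by (simp_all del: One_nat_def)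
  note closed_graph = demiclosed[OF finite_lessThan finite_atLeastAtMost G(1) lims(4) B_maximal _ lims(3)
      stepA' stepB' lims(1,2) energy', simplified]
  have "(z', s') \<in> state_space S"
    using ext s'K by (auto simp: state_space_def PiE_iff simp del: One_nat_def)
  moreover have "a' i \<in> A i v" if "i < n" for i using closed_graph(1) that by simp
  moreover have "s' j \<in> B j (b' j)" if "j \<in> {1..m}" for j using closed_graph(2) that by simp
  ultimately show ?thesis
    using D_graph unfolding equilibrium_def a'_def b'_def by blast
qed

lemma exists_cluster:
  assumes F: "F \<noteq> bot" "F \<le> sequentially"
  obtains G z' s' v where "G \<noteq> bot" "G \<le> F" "equilibrium z' s' v d\<^sub>r"
    "\<And>i. i \<in> {1..<n} \<Longrightarrow> weakly_tendsto (\<lambda>k. z k i) (z' i) G"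
    "\<And>j. j \<in> {1..m} \<Longrightarrow> weakly_tendsto (\<lambda>k. s k j) (s' j) G"
proof -
  \<comment> \<open>Nodes of \<open>z\<close> start at \<open>1\<close>, so slot \<open>0\<close> is
    free to carry the root point \<open>u k 0\<close>; the other slots are padded with
    \<open>0\<close> to keep the whole family bounded.\<close>
  define X where "X i k = (if i = 0 then u k 0 else if i \<in> {1..<n} then z k i else 0)" for i k
  define Y where "Y j k = (if j \<in> {1..m} then s k j else 0)" for j k
  have "\<exists>b. \<forall>k. norm (X i k) \<le> b" for i
    using u_root_bounded z_bounded[of i] by (cases "i = 0"; cases "i \<in> {1..<n}") (auto simp: X_def)
  then obtain bX where bX: "\<And>i k. norm (X i k) \<le> bX i" by metis
  have "\<exists>b. \<forall>k. norm (Y j k) \<le> b" for j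
    using s_bounded[of j] by (cases "j \<in> {1..m}") (auto simp: Y_def)
  then obtain bY where bY: "\<And>j k. norm (Y j k) \<le> bY j" by metis
  obtain H x where H: "H \<noteq> bot" "H \<le> F" "\<And>i. weakly_tendsto (X i) (x i) H"
    using bounded_weak_cluster[of X bX F] bX F(1) by blast
  \<comment> \<open>A second extraction inside \<open>H\<close>, since the dual variables live in
    another type.\<close>
  obtain G y where G: "G \<noteq> bot" "G \<le> H" "\<And>j. weakly_tendsto (Y j) (y j) G"
    using bounded_weak_cluster[of Y bY H] bY H(1) by blast
  have x: "weakly_tendsto (X i) (x i) G" for i by (rule weakly_tendsto_mono[OF H(3) G(2)])
  define z' where "z' = restrict x {1..<n}"
  define s' where "s' = restrict y {1..m}"
  have z': "weakly_tendsto (\<lambda>k. z k i) (z' i) G" if i: "i \<in> {1..<n}" for i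
  proof -
    have "X i = (\<lambda>k. z k i)" "z' i = x i" using i unfolding X_def z'_def by auto
    then show ?thesis using x[of i] by simp
  qed
  have s': "weakly_tendsto (\<lambda>k. s k j) (s' j) G" if j: "j \<in> {1..m}" for j
  proof -
    have "Y j = (\<lambda>k. s k j)" "s' j = y j" using j unfolding Y_def s'_def by auto
    then show ?thesis using G(3)[of j] by simp
  qed
  have "X 0 = (\<lambda>k. u k 0)" by (auto simp: X_def)
  then have root: "weakly_tendsto (\<lambda>k. u k 0) (x 0) G" using x[of 0] by simp
  have "G \<le> F" using G(2) H(2) by simp
  moreover have "equilibrium z' s' (x 0) d\<^sub>r"
    using G(1) \<open>G \<le> F\<close> F(2) z' s' root
    by (intro cluster_equilibrium) (auto simp: z'_def s'_def simp del: One_nat_def)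
  ultimately show ?thesis using that G(1) z' s' by blast
qed

text \<open>Opial's argument: the Lyapunov functions of two equilibria both converge, hence so does
  their difference, which is affine in the iterate and therefore separates weak cluster points.\<close>

lemma cluster_unique:
  assumes eq: "equilibrium z\<^sub>1 s\<^sub>1 v\<^sub>1 d\<^sub>1" "equilibrium z\<^sub>2 s\<^sub>2 v\<^sub>2 d\<^sub>2"
    and G: "G\<^sub>1 \<noteq> bot" "G\<^sub>1 \<le> sequentially" "G\<^sub>2 \<noteq> bot" "G\<^sub>2 \<le> sequentially"
    and z\<^sub>1: "\<And>i. i \<in> {1..<n} \<Longrightarrow> weakly_tendsto (\<lambda>k. z k i) (z\<^sub>1 i) G\<^sub>1"
    and s\<^sub>1: "\<And>j. j \<in> {1..m} \<Longrightarrow> weakly_tendsto (\<lambda>k. s k j) (s\<^sub>1 j) G\<^sub>1"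
    and z\<^sub>2: "\<And>i. i \<in> {1..<n} \<Longrightarrow> weakly_tendsto (\<lambda>k. z k i) (z\<^sub>2 i) G\<^sub>2"
    and s\<^sub>2: "\<And>j. j \<in> {1..m} \<Longrightarrow> weakly_tendsto (\<lambda>k. s k j) (s\<^sub>2 j) G\<^sub>2"
  shows "z\<^sub>1 = z\<^sub>2" "s\<^sub>1 = s\<^sub>2"
proof -
  define \<delta> where "\<delta> i = z\<^sub>1 i - z\<^sub>2 i" for i
  define \<epsilon> where "\<epsilon> j = s\<^sub>1 j - s\<^sub>2 j" for j
  have K: "s\<^sub>1 j \<in> K j" "s\<^sub>2 j \<in> K j" "\<epsilon> j \<in> K j" if "j \<in> {1..m}" for j
    using equilibrium_in_K[OF eq(1) that] equilibrium_in_K[OF eq(2) that]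
    unfolding \<epsilon>_def by (auto intro: subspace_diff K_subspace that)
  have expand: "G' (x - x\<^sub>1) \<bullet> (x - x\<^sub>1) / c - G' (x - x\<^sub>2) \<bullet> (x - x\<^sub>2) / c =
      G' x\<^sub>1 \<bullet> x\<^sub>1 / c - G' x\<^sub>2 \<bullet> x\<^sub>2 / c - 2 * (G' x \<bullet> (x\<^sub>1 - x\<^sub>2) / c)"
    if G': "metric_on V G'" "subspace V" and V: "x \<in> V" "x\<^sub>1 \<in> V" "x\<^sub>2 \<in> V"
    for V :: "'b::real_inner set" and G' x x\<^sub>1 x\<^sub>2 and c :: real
  proof -
    have "G' x\<^sub>1 \<bullet> x = G' x \<bullet> x\<^sub>1" "G' x\<^sub>2 \<bullet> x = G' x \<bullet> x\<^sub>2"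
      using metric_on_selfadjoint[OF G'(1)] V by (metis inner_commute)+
    then show ?thesis unfolding metric_on_diff[OF G' V(1,2)] metric_on_diff[OF G' V(1,3)]
      by (simp add: inner_diff_left inner_diff_right diff_divide_distrib add_divide_distrib)
  qed
  define c where "c = ip z\<^sub>1 s\<^sub>1 z\<^sub>1 s\<^sub>1 - ip z\<^sub>2 s\<^sub>2 z\<^sub>2 s\<^sub>2"
  have "lyap (z k) (s k) z\<^sub>1 s\<^sub>1 - lyap (z k) (s k) z\<^sub>2 s\<^sub>2 = c - 2 * ip (z k) (s k) \<delta> \<epsilon>" for k
  proof -
    have "(\<Sum>i\<in>{1..<n}. M i (z k i - z\<^sub>1 i) \<bullet> (z k i - z\<^sub>1 i) / \<theta> i - M i (z k i - z\<^sub>2 i) \<bullet> (z k i - z\<^sub>2 i) / \<theta> i) =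
        (\<Sum>i\<in>{1..<n}. M i (z\<^sub>1 i) \<bullet> z\<^sub>1 i / \<theta> i - M i (z\<^sub>2 i) \<bullet> z\<^sub>2 i / \<theta> i - 2 * (M i (z k i) \<bullet> \<delta> i / \<theta> i))"
      unfolding \<delta>_def by (intro sum.cong refl expand[OF M_metric]) auto
    moreover have "(\<Sum>j\<in>{1..m}. N j (s k j - s\<^sub>1 j) \<bullet> (s k j - s\<^sub>1 j) / \<zeta> j - N j (s k j - s\<^sub>2 j) \<bullet> (s k j - s\<^sub>2 j) / \<zeta> j) =
        (\<Sum>j\<in>{1..m}. N j (s\<^sub>1 j) \<bullet> s\<^sub>1 j / \<zeta> j - N j (s\<^sub>2 j) \<bullet> s\<^sub>2 j / \<zeta> j - 2 * (N j (s k j) \<bullet> \<epsilon> j / \<zeta> j))"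
      unfolding \<epsilon>_def by (intro sum.cong refl expand[OF N_metric K_subspace] s_in_K K)
    ultimately show ?thesis
      unfolding ip_def c_def sum_subtractf sum_distrib_left[symmetric] by argo
  qed
  then have "ip (z k) (s k) \<delta> \<epsilon> = (c - (lyap (z k) (s k) z\<^sub>1 s\<^sub>1 - lyap (z k) (s k) z\<^sub>2 s\<^sub>2)) / 2" for k
    by (simp add: field_simps)
  moreover have "convergent (\<lambda>k. (c - (lyap (z k) (s k) z\<^sub>1 s\<^sub>1 - lyap (z k) (s k) z\<^sub>2 s\<^sub>2)) / 2)"
  proof -
    obtain l\<^sub>1 l\<^sub>2 where "(\<lambda>k. lyap (z k) (s k) z\<^sub>1 s\<^sub>1) \<longlonglongrightarrow> l\<^sub>1" "(\<lambda>k. lyap (z k) (s k) z\<^sub>2 s\<^sub>2) \<longlonglongrightarrow> l\<^sub>2"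
      using lyap_convergent[OF eq(1)] lyap_convergent[OF eq(2)] unfolding convergent_def by blast
    then have "(\<lambda>k. (c - (lyap (z k) (s k) z\<^sub>1 s\<^sub>1 - lyap (z k) (s k) z\<^sub>2 s\<^sub>2)) / 2) \<longlonglongrightarrow> (c - (l\<^sub>1 - l\<^sub>2)) / 2"
      by (intro tendsto_divide tendsto_diff tendsto_const) auto
    then show ?thesis by (rule convergentI)
  qed
  ultimately have "convergent (\<lambda>k. ip (z k) (s k) \<delta> \<epsilon>)" by presburger
  then obtain l where l: "(\<lambda>k. ip (z k) (s k) \<delta> \<epsilon>) \<longlonglongrightarrow> l" by (auto simp: convergent_def)
  \<comment> \<open>The limit of the whole sequence can be read off along any proper finer filter.
    Self-adjointness moves the metrics to the fixed side, so that only weak limits against fixed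
    vectors remain.\<close>
  have lim: "l = ip z' s' \<delta> \<epsilon>"
    if H: "H \<noteq> bot" "H \<le> sequentially"
      and z': "\<And>i. i \<in> {1..<n} \<Longrightarrow> weakly_tendsto (\<lambda>k. z k i) (z' i) H"
      and s': "\<And>j. j \<in> {1..m} \<Longrightarrow> weakly_tendsto (\<lambda>k. s k j) (s' j) H"
      and K': "\<And>j. j \<in> {1..m} \<Longrightarrow> s' j \<in> K j"
    for H z' s'
  proof (rule tendsto_unique[OF H(1) tendsto_mono[OF H(2) l]])
    have "((\<lambda>k. M i (z k i) \<bullet> \<delta> i / \<theta> i) \<longlongrightarrow> M i (z' i) \<bullet> \<delta> i / \<theta> i) H" if i: "i \<in> {1..<n}" for i
      unfolding metric_on_selfadjoint[OF M_metric[OF i] UNIV_I UNIV_I] divide_inverse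
      using z'[OF i] unfolding weakly_tendsto_def by (intro tendsto_mult_right) blast
    moreover have "((\<lambda>k. N j (s k j) \<bullet> \<epsilon> j / \<zeta> j) \<longlongrightarrow> N j (s' j) \<bullet> \<epsilon> j / \<zeta> j) H" if j: "j \<in> {1..m}" for j
      unfolding metric_on_selfadjoint[OF N_metric[OF j] s_in_K[OF j] K(3)[OF j]]
        metric_on_selfadjoint[OF N_metric[OF j] K'[OF j] K(3)[OF j]] divide_inverse
      using s'[OF j] unfolding weakly_tendsto_def by (intro tendsto_mult_right) blast
    ultimately show "((\<lambda>k. ip (z k) (s k) \<delta> \<epsilon>) \<longlongrightarrow> ip z' s' \<delta> \<epsilon>) H"
      unfolding ip_def by (intro tendsto_add tendsto_sum)
  qed
  have "ip z\<^sub>1 s\<^sub>1 \<delta> \<epsilon> = ip z\<^sub>2 s\<^sub>2 \<delta> \<epsilon>"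
    using lim[OF G(1,2) z\<^sub>1 s\<^sub>1 K(1)] lim[OF G(3,4) z\<^sub>2 s\<^sub>2 K(2)] by simp
  \<comment> \<open>The fixed direction is the difference of the two cluster points, so equality of
    the limits says that its weighted square is zero.\<close>
  moreover have "ip z\<^sub>1 s\<^sub>1 \<delta> \<epsilon> - ip z\<^sub>2 s\<^sub>2 \<delta> \<epsilon> = ip \<delta> \<epsilon> \<delta> \<epsilon>"
  proof -
    have "(\<Sum>i\<in>{1..<n}. M i (z\<^sub>1 i) \<bullet> \<delta> i / \<theta> i - M i (z\<^sub>2 i) \<bullet> \<delta> i / \<theta> i) = (\<Sum>i\<in>{1..<n}. M i (\<delta> i) \<bullet> \<delta> i / \<theta> i)"
    proof (rule sum.cong[OF refl])
      fix i assume i: "i \<in> {1..<n}"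
      have "M i (\<delta> i) = M i (z\<^sub>1 i) - M i (z\<^sub>2 i)"
        unfolding \<delta>_def by (rule metric_on_diff[OF M_metric[OF i] subspace_UNIV UNIV_I UNIV_I])
      then show "M i (z\<^sub>1 i) \<bullet> \<delta> i / \<theta> i - M i (z\<^sub>2 i) \<bullet> \<delta> i / \<theta> i = M i (\<delta> i) \<bullet> \<delta> i / \<theta> i"
        by (simp add: inner_diff_left diff_divide_distrib)
    qed
    moreover have "(\<Sum>j\<in>{1..m}. N j (s\<^sub>1 j) \<bullet> \<epsilon> j / \<zeta> j - N j (s\<^sub>2 j) \<bullet> \<epsilon> j / \<zeta> j) = (\<Sum>j\<in>{1..m}. N j (\<epsilon> j) \<bullet> \<epsilon> j / \<zeta> j)"
    proof (rule sum.cong[OF refl])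
      fix j assume j: "j \<in> {1..m}"
      have "N j (\<epsilon> j) = N j (s\<^sub>1 j) - N j (s\<^sub>2 j)"
        unfolding \<epsilon>_def by (rule metric_on_diff[OF N_metric[OF j] K_subspace[OF j] K(1,2)[OF j]])
      then show "N j (s\<^sub>1 j) \<bullet> \<epsilon> j / \<zeta> j - N j (s\<^sub>2 j) \<bullet> \<epsilon> j / \<zeta> j = N j (\<epsilon> j) \<bullet> \<epsilon> j / \<zeta> j"
        by (simp add: inner_diff_left diff_divide_distrib)
    qed
    ultimately show ?thesis unfolding ip_def sum_subtractf by linarith
  qed
  ultimately have "ip \<delta> \<epsilon> \<delta> \<epsilon> = 0" by simp
  moreover have "0 \<le> (\<Sum>i\<in>{1..<n}. M i (\<delta> i) \<bullet> \<delta> i / \<theta> i)" by (intro sum_nonneg ip_node_nonneg)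
  moreover have "0 \<le> (\<Sum>j\<in>{1..m}. N j (\<epsilon> j) \<bullet> \<epsilon> j / \<zeta> j)" by (intro sum_nonneg ip_dual_nonneg K)
  ultimately have zero: "(\<Sum>i\<in>{1..<n}. M i (\<delta> i) \<bullet> \<delta> i / \<theta> i) = 0" "(\<Sum>j\<in>{1..m}. N j (\<epsilon> j) \<bullet> \<epsilon> j / \<zeta> j) = 0"
    unfolding ip_def by linarith+
  have "\<delta> i = 0" if i: "i \<in> {1..<n}" for i
  proof (rule metric_on_eq_0[OF M_metric[OF i] UNIV_I])
    have "M i (\<delta> i) \<bullet> \<delta> i / \<theta> i \<le> (\<Sum>i\<in>{1..<n}. M i (\<delta> i) \<bullet> \<delta> i / \<theta> i)"
      using i by (intro member_le_sum[where f = "\<lambda>i. M i (\<delta> i) \<bullet> \<delta> i / \<theta> i"] ip_node_nonneg) auto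
    then show "M i (\<delta> i) \<bullet> \<delta> i \<le> 0" using \<theta>[OF i] zero(1) by (simp add: divide_le_0_iff)
  qed
  moreover have "\<epsilon> j = 0" if j: "j \<in> {1..m}" for j
  proof (rule metric_on_eq_0[OF N_metric[OF j] K(3)[OF j]])
    have "N j (\<epsilon> j) \<bullet> \<epsilon> j / \<zeta> j \<le> (\<Sum>j\<in>{1..m}. N j (\<epsilon> j) \<bullet> \<epsilon> j / \<zeta> j)"
      using j by (intro member_le_sum[where f = "\<lambda>j. N j (\<epsilon> j) \<bullet> \<epsilon> j / \<zeta> j"] ip_dual_nonneg K) auto
    then show "N j (\<epsilon> j) \<bullet> \<epsilon> j \<le> 0" using \<zeta>[OF j] zero(2) by (simp add: divide_le_0_iff)
  qed
  moreover have "z\<^sub>1 \<in> extensional {1..<n}" "z\<^sub>2 \<in> extensional {1..<n}"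
      "s\<^sub>1 \<in> extensional {1..m}" "s\<^sub>2 \<in> extensional {1..m}"
    using eq unfolding equilibrium_def state_space_def PiE_def by blast+
  ultimately show "z\<^sub>1 = z\<^sub>2" "s\<^sub>1 = s\<^sub>2"
    unfolding \<delta>_def \<epsilon>_def by (auto intro!: extensionalityI simp del: One_nat_def)
qed

text \<open>Existence and uniqueness of cluster points combine through the subsequence principle.
  The point \<open>v\<close> arises as a weak limit of \<open>u k 0\<close> along one filter; no
  convergence of \<open>u\<close> itself is claimed.\<close>

lemma weak_convergence:
  obtains z' s' v where "equilibrium z' s' v d\<^sub>r"
    "\<And>i. i \<in> {1..<n} \<Longrightarrow> weakly_tendsto (\<lambda>k. z k i) (z' i) sequentially"
    "\<And>j. j \<in> {1..m} \<Longrightarrow> weakly_tendsto (\<lambda>k. s k j) (s' j) sequentially"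
proof -
  obtain G z' s' v where G: "G \<noteq> bot" "G \<le> sequentially" and eq: "equilibrium z' s' v d\<^sub>r"
    and lim: "\<And>i. i \<in> {1..<n} \<Longrightarrow> weakly_tendsto (\<lambda>k. z k i) (z' i) G"
      "\<And>j. j \<in> {1..m} \<Longrightarrow> weakly_tendsto (\<lambda>k. s k j) (s' j) G"
    by (rule exists_cluster[OF sequentially_bot order_refl]) blast
  have cluster: "\<exists>H. H \<noteq> bot \<and> H \<le> F \<and> (\<forall>i\<in>{1..<n}. weakly_tendsto (\<lambda>k. z k i) (z' i) H) \<and>
      (\<forall>j\<in>{1..m}. weakly_tendsto (\<lambda>k. s k j) (s' j) H)" if F: "F \<noteq> bot" "F \<le> sequentially" for F
  proof -
    obtain H z'' s'' v' where H: "H \<noteq> bot" "H \<le> F" and eq': "equilibrium z'' s'' v' d\<^sub>r"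
      and lim': "\<And>i. i \<in> {1..<n} \<Longrightarrow> weakly_tendsto (\<lambda>k. z k i) (z'' i) H"
        "\<And>j. j \<in> {1..m} \<Longrightarrow> weakly_tendsto (\<lambda>k. s k j) (s'' j) H"
      by (rule exists_cluster[OF F]) blast
    have "H \<le> sequentially" using H(2) F(2) by simp
    then have "z' = z''" "s' = s''"
      using cluster_unique[OF eq eq' G H(1) _ lim lim'] by auto
    then show ?thesis using H lim' by blast
  qed
  have "weakly_tendsto (\<lambda>k. z k i) (z' i) sequentially" if i: "i \<in> {1..<n}" for i
    unfolding weakly_tendsto_def
  proof (intro allI tendsto_of_clusters)
    fix y and F :: "nat filter" assume "F \<noteq> bot" "F \<le> sequentially"
    from cluster[OF this] i show "\<exists>H. H \<noteq> bot \<and> H \<le> F \<and> ((\<lambda>k. z k i \<bullet> y) \<longlongrightarrow> z' i \<bullet> y) H"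
      unfolding weakly_tendsto_def by blast
  qed
  moreover have "weakly_tendsto (\<lambda>k. s k j) (s' j) sequentially" if j: "j \<in> {1..m}" for j
    unfolding weakly_tendsto_def
  proof (intro allI tendsto_of_clusters)
    fix y and F :: "nat filter" assume "F \<noteq> bot" "F \<le> sequentially"
    from cluster[OF this] j show "\<exists>H. H \<noteq> bot \<and> H \<le> F \<and> ((\<lambda>k. s k j \<bullet> y) \<longlongrightarrow> s' j \<bullet> y) H"
      unfolding weakly_tendsto_def by blast
  qed
  ultimately show ?thesis using that eq by blast
qed

end

theorem theorem4p6:
  fixes S :: "('h::{real_inner,complete_space}, 'k::{real_inner,complete_space}) tree_splitting"
    and \<theta> \<zeta> \<alpha> \<sigma> \<tau> :: "nat \<Rightarrow> real"
    and u z :: "nat \<Rightarrow> nat \<Rightarrow> 'h"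
    and s :: "nat \<Rightarrow> nat \<Rightarrow> 'k"
  assumes "problem_data S"
    and "\<exists>v. solves_P S v"
    and "tree_data S"
    and "metric_data S"
    and "relaxed_sequence S \<theta> \<zeta> u z s"
    and "\<forall>j\<in>{1..m_of S}. 0 < \<tau> j"
    and "\<forall>i\<in>{1..<n_of S}. \<theta> i \<in> {0<..<2}"
    and "\<forall>j\<in>{1..m_of S}. \<zeta> j \<in> {0<..<2}"
    and "\<forall>i\<in>{1..<n_of S}. bounded_below_on UNIV (metM S i) (\<alpha> i) \<and>
           \<alpha> i > 1 / (2 - \<theta> i) *
             (2 * (\<Sum>j\<in>cellJc S i. \<tau> j) + 1 / 2 * (\<Sum>l\<in>cellP S i. 1 / beta S l))"
    and "\<forall>j\<in>{1..m_of S}. bounded_below_on (Ksp S j) (metN S j) (\<sigma> j) \<and>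
           \<sigma> j > 1 / (2 - \<zeta> j) *
             ((onorm (opL S j))\<^sup>2 / (2 * \<tau> j) + real_of_ereal (1 / (2 * nu S j)))"
  shows "\<exists>zs ss. (zs, ss) \<in> Fix_relaxed S \<theta> \<zeta> \<and>
           weakly_converges S (\<lambda>k. (z k, s k)) (zs, ss) \<and>
           solves_P S
             (warped_resolvent (\<lambda>x. \<Sum>c\<in>ch S 0. metM S c x) (opA S 0)
                ((\<Sum>c\<in>ch S 0. metM S c (zs c)) -
                 (\<Sum>j\<in>cellJ S 0. adjoint (opL S j) (ss j)) + vec_a S))"
proof -
  interpret tree_problem S by unfold_locales (fact assms)+
  \<comment> \<open>Strictness of (c) leaves room to trade \<open>nu S j\<close> for a finite
    modulus.\<close>
  have "\<exists>\<rho>. 0 < \<rho> \<and> strongly_monotone \<rho> (D j) \<and>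
      (onorm (L j))\<^sup>2 / (2 * \<tau> j) + 1 / (2 * \<rho>) < (2 - \<zeta> j) * \<sigma> j" if j: "j \<in> {1..m}" for j
  proof -
    have "0 < 2 - \<zeta> j" using bspec[OF assms(8) j] by simp
    moreover have "1 / (2 - \<zeta> j) * ((onorm (L j))\<^sup>2 / (2 * \<tau> j) + real_of_ereal (1 / (2 * nu S j))) < \<sigma> j"
      using bspec[OF assms(10) j] by simp
    ultimately have "(onorm (L j))\<^sup>2 / (2 * \<tau> j) + real_of_ereal (1 / (2 * nu S j)) < (2 - \<zeta> j) * \<sigma> j"
      by (simp add: divide_less_eq mult.commute)
    then have "real_of_ereal (1 / (2 * nu S j)) < (2 - \<zeta> j) * \<sigma> j - (onorm (L j))\<^sup>2 / (2 * \<tau> j)" by linarith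
    from D_strongly_monotone[OF j this] show ?thesis by (metis add.commute less_diff_eq)
  qed
  then obtain \<rho> where \<rho>: "\<And>j. j \<in> {1..m} \<Longrightarrow> 0 < \<rho> j \<and> strongly_monotone (\<rho> j) (D j) \<and>
      (onorm (L j))\<^sup>2 / (2 * \<tau> j) + 1 / (2 * \<rho> j) < (2 - \<zeta> j) * \<sigma> j"
    by metis
  have \<alpha>: "2 * (\<Sum>j\<in>cellJc S i. \<tau> j) + (\<Sum>l\<in>cellP S i. 1 / (2 * beta S l)) < (2 - \<theta> i) * \<alpha> i"
    if i: "i \<in> {1..<n}" for i
  proof -
    have "0 < 2 - \<theta> i" using bspec[OF assms(7) i] by simp
    moreover have "1 / (2 - \<theta> i) * (2 * (\<Sum>j\<in>cellJc S i. \<tau> j) + 1 / 2 * (\<Sum>l\<in>cellP S i. 1 / beta S l)) < \<alpha> i"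
      using bspec[OF assms(9) i] by simp
    moreover have "1 / 2 * (\<Sum>l\<in>cellP S i. 1 / beta S l) = (\<Sum>l\<in>cellP S i. 1 / (2 * beta S l))"
      by (simp add: sum_distrib_left)
    ultimately show ?thesis by (simp add: divide_less_eq mult.commute)
  qed
  interpret relaxed_problem S \<theta> \<zeta> \<alpha> \<sigma> \<tau> \<rho>
    by unfold_locales (use assms \<alpha> \<rho> in \<open>simp_all del: One_nat_def\<close>)
  obtain v\<^sub>r where "solves_P S v\<^sub>r" using assms(2) by blast
  then obtain z\<^sub>r s\<^sub>r d\<^sub>r where reference: "equilibrium z\<^sub>r s\<^sub>r v\<^sub>r d\<^sub>r" by (rule solves_P_equilibrium)
  obtain t d where steps:
      "\<And>k i. i < n \<Longrightarrow> selA (z k) (s k) (u (Suc k)) (t k) i \<in> A i (u (Suc k) i)"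
      "\<And>k j. j \<in> {1..m} \<Longrightarrow> s k j \<in> D j (d k j)"
      "\<And>k j. j \<in> {1..m} \<Longrightarrow> t k j \<in> B j (selB (s k) (u (Suc k)) (t k) (d k) j)"
      "\<And>k i. i \<in> {1..<n} \<Longrightarrow> z (Suc k) i = z k i + \<theta> i *\<^sub>R (u (Suc k) i - u (Suc k) (pa i))"
      "\<And>k j. j \<in> {1..m} \<Longrightarrow> s (Suc k) j = s k j + \<zeta> j *\<^sub>R (t k j - s k j)"
    by (rule relaxed_sequence_steps[OF assms(5)]) blast
  interpret relaxed_iteration S \<theta> \<zeta> \<alpha> \<sigma> \<tau> \<rho> "\<lambda>k. u (Suc k)" z s t d z\<^sub>r s\<^sub>r v\<^sub>r d\<^sub>r
    by unfold_locales (fact steps reference)+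
  obtain zs ss v where eq: "equilibrium zs ss v d\<^sub>r"
    and lim: "\<And>i. i \<in> {1..<n} \<Longrightarrow> weakly_tendsto (\<lambda>k. z k i) (zs i) sequentially"
      "\<And>j. j \<in> {1..m} \<Longrightarrow> weakly_tendsto (\<lambda>k. s k j) (ss j) sequentially"
    by (rule weak_convergence) blast
  have "weakly_converges S (\<lambda>k. (z k, s k)) (zs, ss)"
    by (rule weakly_convergesI) (fact lim)+
  \<comment> \<open>The resolvent at the limit equals \<open>v\<close>, and \<open>v\<close> solves
    (P) as the common point of an equilibrium.\<close>
  then show ?thesis
    using equilibrium_Fix_relaxed[OF eq, of \<theta> \<zeta>] equilibrium_solves_P[OF eq]
    unfolding equilibrium_warped_resolvent[OF eq, symmetric] by blast
qed

end
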